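(* Let $q=p^r$ be a power of a prime $p$ with $r\ge 1$, let $n\ge 1$, let $V=\mathbb F_q^n$ be the natural $GL_n(q)$-module, and let $I=(n_1,\dots,n_\ell)$ be a composition of $n$ with associated standard parabolic subgroup $P_I\subseteq GL_n(q)$. Then for every integer $k$ with $0\le k\le q-2$, the space of invariants $\big(S^\bullet(V)\otimes\wedge^\bullet(V)\otimes\mathrm{Det}^k\big)^{P_I}$ is a free module of rank $2^n$ over the algebra $S^\bullet(V)^{P_I}$.
   Context: $GL_n(q)$ acts naturally on the symmetric algebra $S^\bullet(V)$ and the exterior algebra $\wedge^\bullet(V)$ of $V$ (over $\mathbb F_q$), and diagonally on tensor products. $\mathrm{Det}$ is the one-dimensional $GL_n(q)$-module over $\mathbb F_q$ on which $g$ acts by $\det(g)$. A composition $I=(n_1,\dots,n_\ell)$ of $n$ is a sequence of positive integers with sum $n$. $P_I$ is the subgroup of $GL_n(q)$ of block upper triangular matrices with invertible diagonal blocks of sizes $n_1,\dots,n_\ell$ (in this order); matrices act on $V$ with basis $x_1,\dots,x_n$ by $g\cdot x_j=\sum_k g_{kj}x_k$. *)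

theory Defs
  imports
    "HOL-Algebra.Module"
    "HOL-Library.FuncSet"
    "HOL-Library.Poly_Mapping"
    "HOL-Computational_Algebra.Primes"
    "Jordan_Normal_Form.Determinant"
begin

text \<open>Throughout, the basis vector \<open>x\<^sub>j\<close> of \<open>V\<close> has an index \<open>j < n\<close>, counting from \<open>0\<close>.\<close>

section \<open>The general linear group and its standard parabolic subgroups\<close>

definition general_linear :: "nat \<Rightarrow> 'a::field mat set" where
  "general_linear n = {g \<in> carrier_mat n n. invertible_mat g}"

definition composition :: "nat list \<Rightarrow> nat \<Rightarrow> bool" where
  "composition ns n \<longleftrightarrow> (\<forall>m \<in> set ns. 0 < m) \<and> sum_list ns = n"

definition diag_block :: "nat list \<Rightarrow> nat \<Rightarrow> 'a mat \<Rightarrow> 'a mat" where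
  "diag_block ns b g = mat (ns ! b) (ns ! b)
     (\<lambda>(i, j). g $$ (sum_list (take b ns) + i, sum_list (take b ns) + j))"

text \<open>The entry at \<open>(i, j)\<close> lies strictly below the diagonal blocks iff some block boundary
  \<open>s = n\<^sub>1 + \<dots> + n\<^sub>b\<close> satisfies \<open>j < s \<le> i\<close>.\<close>

definition block_upper_triangular :: "nat list \<Rightarrow> 'a::zero mat \<Rightarrow> bool" where
  "block_upper_triangular ns g \<longleftrightarrow>
     (\<forall>b \<le> length ns. \<forall>i < dim_row g. \<forall>j < dim_col g.
        j < sum_list (take b ns) \<and> sum_list (take b ns) \<le> i \<longrightarrow> g $$ (i, j) = 0)"

definition parabolic :: "nat \<Rightarrow> nat list \<Rightarrow> 'a::field mat set" where
  "parabolic n ns = {g \<in> general_linear n. block_upper_triangular ns g \<and>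
     (\<forall>b < length ns. invertible_mat (diag_block ns b g))}"


section \<open>The symmetric algebra\<close>

text \<open>\<open>S(V)\<close> is the polynomial ring in \<open>x\<^sub>0, \<dots>, x\<^sub>n\<^sub>-\<^sub>1\<close>; a monomial is its exponent vector.\<close>

type_synonym 'a mpoly = "(nat \<Rightarrow>\<^sub>0 nat) \<Rightarrow>\<^sub>0 'a"

abbreviation const_poly :: "'a::zero \<Rightarrow> 'a mpoly" where
  "const_poly c \<equiv> Poly_Mapping.single 0 c"

definition sym_algebra :: "nat \<Rightarrow> 'a::field mpoly set" where
  "sym_algebra n = {f. \<forall>m \<in> Poly_Mapping.keys f. Poly_Mapping.keys m \<subseteq> {..<n}}"

definition sym_col :: "nat \<Rightarrow> 'a::field mat \<Rightarrow> nat \<Rightarrow> 'a mpoly" where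
  "sym_col n g j = (\<Sum>k<n. Poly_Mapping.single (Poly_Mapping.single k 1) (g $$ (k, j)))"

text \<open>The algebra homomorphism with \<open>x\<^sub>j \<mapsto> \<Sum>\<^sub>k g\<^sub>k\<^sub>j x\<^sub>k\<close>.\<close>

definition sym_act :: "nat \<Rightarrow> 'a::field mat \<Rightarrow> 'a mpoly \<Rightarrow> 'a mpoly" where
  "sym_act n g f = (\<Sum>m \<in> Poly_Mapping.keys f.
     const_poly (Poly_Mapping.lookup f m) * (\<Prod>j<n. sym_col n g j ^ Poly_Mapping.lookup m j))"


section \<open>The exterior algebra\<close>

text \<open>For \<open>J = {j\<^sub>1 < \<dots> < j\<^sub>m}\<close> the basis vector \<open>Poly_Mapping.single J 1\<close> stands for
  \<open>x\<^sub>J = x\<^bsub>j\<^sub>1\<^esub> \<and> \<dots> \<and> x\<^bsub>j\<^sub>m\<^esub>\<close>. The exterior algebra of \<open>V\<close> is spanned by the \<open>x\<^sub>J\<close> with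
  \<open>J \<subseteq> {..<n}\<close>.\<close>

type_synonym 'a ext = "nat set \<Rightarrow>\<^sub>0 'a"

text \<open>\<open>x\<^sub>J \<and> x\<^sub>K\<close> is \<open>0\<close> if \<open>J\<close> and \<open>K\<close> meet, and otherwise \<open>x\<^bsub>J \<union> K\<^esub>\<close> with the sign of the
  permutation that sorts the concatenation of \<open>J\<close> and \<open>K\<close>.\<close>

definition shuffle_sign :: "nat set \<Rightarrow> nat set \<Rightarrow> 'a::comm_ring_1" where
  "shuffle_sign J K = (- 1) ^ card {(a, b) \<in> J \<times> K. b < a}"

definition wedge :: "'a::comm_ring_1 ext \<Rightarrow> 'a ext \<Rightarrow> 'a ext" where
  "wedge u v = (\<Sum>J \<in> Poly_Mapping.keys u. \<Sum>K \<in> Poly_Mapping.keys v.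
     if J \<inter> K = {}
     then Poly_Mapping.single (J \<union> K)
            (shuffle_sign J K * Poly_Mapping.lookup u J * Poly_Mapping.lookup v K)
     else 0)"

definition ext_col :: "nat \<Rightarrow> 'a::field mat \<Rightarrow> nat \<Rightarrow> 'a ext" where
  "ext_col n g j = (\<Sum>k<n. Poly_Mapping.single {k} (g $$ (k, j)))"

text \<open>The linear map with \<open>x\<^bsub>j\<^sub>1\<^esub> \<and> \<dots> \<and> x\<^bsub>j\<^sub>m\<^esub> \<mapsto> g x\<^bsub>j\<^sub>1\<^esub> \<and> \<dots> \<and> g x\<^bsub>j\<^sub>m\<^esub>\<close>.\<close>

definition ext_act :: "nat \<Rightarrow> 'a::field mat \<Rightarrow> 'a ext \<Rightarrow> 'a ext" where
  "ext_act n g w = (\<Sum>J \<in> Poly_Mapping.keys w.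
     Poly_Mapping.map ((*) (Poly_Mapping.lookup w J))
       (foldr wedge (map (ext_col n g) (sorted_list_of_set J)) (Poly_Mapping.single {} 1)))"


section \<open>The tensor product and its diagonal action\<close>

text \<open>Since the \<open>x\<^sub>J\<close> form a basis of the exterior algebra, every element of \<open>S(V) \<otimes> \<Lambda>(V)\<close> is
  uniquely \<open>\<Sum>\<^sub>J f\<^sub>J \<otimes> x\<^sub>J\<close> with \<open>f\<^sub>J\<close> in \<open>S(V)\<close>; it is represented by the family \<open>J \<mapsto> f\<^sub>J\<close>.
  The module \<open>Det\<^sup>k\<close> is one-dimensional, so tensoring with it leaves the underlying space
  unchanged and multiplies the action of \<open>g\<close> by \<open>det g ^ k\<close>.\<close>

type_synonym 'a sym_ext = "nat set \<Rightarrow>\<^sub>0 'a mpoly"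

definition sym_ext_space :: "nat \<Rightarrow> 'a::field sym_ext set" where
  "sym_ext_space n = {t. Poly_Mapping.keys t \<subseteq> Pow {..<n} \<and>
     (\<forall>J. Poly_Mapping.lookup t J \<in> sym_algebra n)}"

definition poly_scale :: "'a::field mpoly \<Rightarrow> 'a sym_ext \<Rightarrow> 'a sym_ext" where
  "poly_scale f t = Poly_Mapping.map ((*) f) t"

definition pure_tensor :: "'a::field mpoly \<Rightarrow> 'a ext \<Rightarrow> 'a sym_ext" where
  "pure_tensor f w = Poly_Mapping.map (\<lambda>c. const_poly c * f) w"

text \<open>The action on \<open>S(V) \<otimes> \<Lambda>(V) \<otimes> Det\<^sup>k\<close>, given on \<open>f \<otimes> x\<^sub>J\<close> by
  \<open>det g ^ k \<cdot> (g f \<otimes> g x\<^sub>J)\<close>.\<close>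

definition sym_ext_act :: "nat \<Rightarrow> nat \<Rightarrow> 'a::field mat \<Rightarrow> 'a sym_ext \<Rightarrow> 'a sym_ext" where
  "sym_ext_act n k g t = (\<Sum>J \<in> Poly_Mapping.keys t.
     poly_scale (const_poly (det g ^ k))
       (pure_tensor (sym_act n g (Poly_Mapping.lookup t J))
                    (ext_act n g (Poly_Mapping.single J 1))))"


section \<open>Invariants\<close>

definition sym_invariants :: "nat \<Rightarrow> 'a::field mat set \<Rightarrow> 'a mpoly ring" where
  "sym_invariants n G =
     \<lparr>carrier = {f \<in> sym_algebra n. \<forall>g \<in> G. sym_act n g f = f},
      mult = (*), one = 1, zero = 0, add = (+)\<rparr>"

text \<open>The record type of modules also has fields for a multiplication and a unit, which play no
  role for a module.\<close>

definition sym_ext_invariants ::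
  "nat \<Rightarrow> nat \<Rightarrow> 'a::field mat set \<Rightarrow> ('a mpoly, 'a sym_ext) module" where
  "sym_ext_invariants n k G =
     \<lparr>carrier = {t \<in> sym_ext_space n. \<forall>g \<in> G. sym_ext_act n k g t = t},
      mult = undefined, one = undefined, zero = 0, add = (+), module.smult = poly_scale\<rparr>"


section \<open>Free modules of finite rank\<close>

definition free_module_of_rank ::
  "('r, 'x) ring_scheme \<Rightarrow> ('r, 'm, 'y) module_scheme \<Rightarrow> nat \<Rightarrow> bool" where
  "free_module_of_rank R M d \<longleftrightarrow> Module.module R M \<and>
     (\<exists>B. B \<subseteq> carrier M \<and> finite B \<and> card B = d \<and>
        (\<forall>t \<in> carrier M. \<exists>!c. c \<in> B \<rightarrow>\<^sub>E carrier R \<and>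
           t = finsum M (\<lambda>b. c b \<odot>\<^bsub>M\<^esub> b) B))"

end

theory Submission
  imports Defs "HOL-Library.Cardinality"
begin

text \<open>
  Let \<open>F\<^sub>s(T)\<close> be the additive polynomial whose roots are the linear forms in \<open>x\<^sub>0, \<dots>, x\<^bsub>s-1\<^esub>\<close>. If \<open>s\<close>
  is a block boundary, \<open>F\<^sub>s\<close> is invariant under \<open>P\<^sub>I\<close>, so the covectors
  \<open>D\<^sub>s = (F\<^sub>a(x\<^sub>i)\<^bsup>q^(s-a)\<^esup>)\<^sub>i\<close>, with \<open>a\<close> the start of the block of \<open>s\<close>, are equivariant: the
  contractions \<open>\<iota>\<^sub>s\<close> of \<open>S(V) \<otimes> \<Lambda>(V)\<close> with \<open>D\<^sub>s\<close> commute with \<open>P\<^sub>I\<close>. An element \<open>t\<close> is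
  determined by the scalar parts \<open>\<phi>\<^sub>J(t)\<close> of the iterated contractions \<open>\<iota>\<^sub>J t\<close>, \<open>J \<subseteq> {0, \<dots>, n-1}\<close>.

  Let \<open>L\<^sub>m\<close> be the product of the linear forms in \<open>x\<^sub>0, \<dots>, x\<^bsub>m-1\<^esub>\<close>, one for each line, and put
  \<open>e = q - 1 - k\<close>. Let \<open>m = n\<close> if \<open>k > 0\<close>, and otherwise let \<open>m\<close> be the end of the block of the largest
  element of \<open>J\<close>. The elements \<open>\<omega>\<^sub>J = L\<^sub>m\<^bsup>e-1\<^esup> \<cdot> \<iota>\<^bsub>{0, \<dots>, m-1} - J\<^esub> (x\<^sub>0 \<and> \<dots> \<and> x\<^bsub>m-1\<^esub>)\<close> are invariant,
  and \<open>\<phi>\<^sub>K(\<omega>\<^sub>J)\<close> is \<open>\<plusminus>L\<^sub>m\<^sup>e\<close> for \<open>K = J\<close> and \<open>0\<close> otherwise. They form a basis because \<open>L\<^sub>m\<^sup>e\<close> divides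
  \<open>\<phi>\<^sub>J(t)\<close> for every invariant \<open>t\<close>. As \<open>\<phi>\<^sub>J(t)\<close> is semi-invariant, it suffices that \<open>x\<^sub>a\<^sup>e\<close> divides it for
  \<open>a < m\<close>, and this follows from the invariance of \<open>t\<close> under the diagonal matrices that scale \<open>x\<^sub>a\<close> and
  the transvections \<open>x\<^sub>j \<mapsto> x\<^sub>j + x\<^sub>a\<close>.
\<close>

section \<open>Preliminaries on polynomials as finitely supported functions\<close>

definition X :: "nat \<Rightarrow> 'a::field mpoly" where
  "X i = Poly_Mapping.single (Poly_Mapping.single i 1) 1"

lemma dvd_power_diff:
  fixes u v d :: "'b::comm_ring_1"
  assumes "d dvd u - v"
  shows "d dvd u ^ i - v ^ i"
proof (induction i)
  case (Suc i)
  have "u ^ Suc i - v ^ Suc i = u * (u ^ i - v ^ i) + (u - v) * v ^ i"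
    by (simp add: algebra_simps)
  then show ?case using Suc assms by simp
qed simp

lemma dvd_prod_diff:
  fixes d :: "'b::comm_ring_1"
  assumes "finite A" "\<And>j. j \<in> A \<Longrightarrow> d dvd u j - v j"
  shows "d dvd (\<Prod>j\<in>A. u j) - (\<Prod>j\<in>A. v j)"
  using assms
proof (induction A rule: finite_induct)
  case (insert a A)
  have "(\<Prod>j\<in>insert a A. u j) - (\<Prod>j\<in>insert a A. v j) =
      u a * ((\<Prod>j\<in>A. u j) - (\<Prod>j\<in>A. v j)) + (u a - v a) * (\<Prod>j\<in>A. v j)"
    using insert.hyps by (simp add: algebra_simps)
  then show ?case using insert by simp
qed simp

lemma poly_mapping_sum_single:
  "(\<Sum>m\<in>Poly_Mapping.keys f. Poly_Mapping.single m (Poly_Mapping.lookup f m)) = f"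
  by (rule poly_mapping_eqI)
     (auto simp: lookup_sum lookup_single when_def in_keys_iff sum.delta)

text \<open>Finitely supported functions are finite sums of single ones, so statements that are
  additive in \<open>f\<close> need only be checked on monomials.\<close>

lemma poly_mapping_single_plus_induct [case_names zero single plus]:
  fixes f :: "'k \<Rightarrow>\<^sub>0 'b::comm_monoid_add"
  assumes "P 0"
    and "\<And>m c. P (Poly_Mapping.single m c)"
    and "\<And>f g. P f \<Longrightarrow> P g \<Longrightarrow> P (f + g)"
  shows "P f"
proof -
  have "finite A \<Longrightarrow> P (\<Sum>m\<in>A. Poly_Mapping.single m (Poly_Mapping.lookup f m))" for A
    by (induction A rule: finite_induct) (auto intro: assms)
  then show ?thesis
    using poly_mapping_sum_single[of f] by (metis finite_keys)
qed

lemma const_poly_add: "const_poly (a + b) = const_poly a + const_poly b"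
  by (rule single_add)

lemma const_poly_mult: "const_poly (a * b) = (const_poly a * const_poly b :: 'a::field mpoly)"
  by (simp add: mult_single)

lemma const_poly_power: "const_poly (a ^ m) = (const_poly a ^ m :: 'a::field mpoly)"
  by (induction m) (simp_all add: const_poly_mult)

lemma const_poly_sum: "const_poly (sum f A) = (\<Sum>i\<in>A. const_poly (f i))"
  by (induction A rule: infinite_finite_induct) (auto simp: single_add)

lemma const_poly_inject [simp]: "const_poly a = const_poly b \<longleftrightarrow> a = b"
  by (metis lookup_single_eq)

lemma const_poly_eq_0_iff [simp]: "const_poly a = 0 \<longleftrightarrow> a = 0"
  by (metis lookup_single_eq lookup_zero single_zero)

lemma const_poly_eq_1_iff [simp]: "const_poly a = (1 :: 'a::field mpoly) \<longleftrightarrow> a = 1"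
  by (metis lookup_single_eq single_one)


subsection \<open>The action on the symmetric algebra\<close>

text \<open>The image of a monomial under \<open>g\<close>. It turns sums of exponent vectors into
  products, which is why \<open>sym_act\<close> is multiplicative.\<close>

definition sym_monom :: "nat \<Rightarrow> 'a::field mat \<Rightarrow> (nat \<Rightarrow>\<^sub>0 nat) \<Rightarrow> 'a mpoly" where
  "sym_monom n g m = (\<Prod>j<n. sym_col n g j ^ Poly_Mapping.lookup m j)"

lemma sym_monom_0 [simp]: "sym_monom n g 0 = 1"
  by (simp add: sym_monom_def)

lemma sym_monom_add: "sym_monom n g (m + m') = sym_monom n g m * sym_monom n g m'"
  by (simp add: sym_monom_def lookup_add power_add prod.distrib)

text \<open>Sums over exact supports are awkward for \<open>f + h\<close>, where terms may cancel; a
  common finite superset makes both sides comparable.\<close>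

lemma sym_act_superset:
  assumes "finite A" "Poly_Mapping.keys f \<subseteq> A"
  shows "sym_act n g f = (\<Sum>m\<in>A. const_poly (Poly_Mapping.lookup f m) * sym_monom n g m)"
  unfolding sym_act_def sym_monom_def[symmetric]
  by (rule sum.mono_neutral_left) (use assms in \<open>auto simp: in_keys_iff\<close>)

lemma sym_act_single: "sym_act n g (Poly_Mapping.single m c) = const_poly c * sym_monom n g m"
  by (subst sym_act_superset[of "{m}"]) auto

lemma sym_act_0 [simp]: "sym_act n g 0 = 0"
  by (simp add: sym_act_def)

lemma sym_act_add: "sym_act n g (f + h) = sym_act n g f + sym_act n g h"
proof -
  let ?A = "Poly_Mapping.keys f \<union> Poly_Mapping.keys h"
  have "Poly_Mapping.keys (f + h) \<subseteq> ?A" by (rule keys_add)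
  then show ?thesis
    by (simp add: sym_act_superset[of ?A] lookup_add single_add distrib_right sum.distrib)
qed

lemma sym_act_const [simp]: "sym_act n g (const_poly c) = const_poly c"
  by (simp add: sym_act_single)

lemma sym_act_1 [simp]: "sym_act n g 1 = 1"
  using sym_act_const[of n g 1] by simp

lemma sym_act_mult: "sym_act n g (f * h) = sym_act n g f * sym_act n g h"
proof (induction f rule: poly_mapping_single_plus_induct)
  case (single m c)
  show ?case
  proof (induction h rule: poly_mapping_single_plus_induct)
    case (single m' c')
    show ?case
      by (simp only: mult_single sym_act_single sym_monom_add) (simp add: const_poly_mult mult_ac)
  qed (simp_all add: distrib_left sym_act_add)
qed (simp_all add: distrib_right sym_act_add)

lemma sym_act_uminus: "sym_act n g (- f) = - sym_act n g f"
  using sym_act_add[of n g f "- f"] by (simp add: eq_neg_iff_add_eq_0 add.commute)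

lemma sym_act_diff: "sym_act n g (f - h) = sym_act n g f - sym_act n g h"
  using sym_act_add[of n g f "- h"] by (simp add: sym_act_uminus)

lemma sym_act_power: "sym_act n g (f ^ m) = sym_act n g f ^ m"
  by (induction m) (simp_all add: sym_act_mult)

lemma sym_act_sum: "sym_act n g (sum f A) = (\<Sum>i\<in>A. sym_act n g (f i))"
  by (induction A rule: infinite_finite_induct) (simp_all add: sym_act_add)

lemma sym_act_prod: "sym_act n g (prod f A) = (\<Prod>i\<in>A. sym_act n g (f i))"
  by (induction A rule: infinite_finite_induct) (simp_all add: sym_act_mult)

lemma sym_act_X: "j < n \<Longrightarrow> sym_act n g (X j) = sym_col n g j"
proof -
  assume j: "j < n"
  have "sym_monom n g (Poly_Mapping.single j 1) = (\<Prod>i<n. if i = j then sym_col n g i else 1)"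
    unfolding sym_monom_def
    by (rule prod.cong) (auto simp: lookup_single when_def)
  also have "\<dots> = sym_col n g j" using j by simp
  finally show ?thesis unfolding X_def sym_act_single by simp
qed

text \<open>Both actions are ring homomorphisms that fix constants, so a congruence modulo
  \<open>d\<close> on the variables spreads to all polynomials. The matrices are arbitrary, so
  singular substitutions are included.\<close>

lemma sym_act_dvd_diff:
  assumes "\<And>j. j < n \<Longrightarrow> d dvd sym_col n g j - sym_col n h j"
  shows "d dvd sym_act n g f - sym_act n h f"
proof (induction f rule: poly_mapping_single_plus_induct)
  case zero
  show ?case by simp
next
  case (plus f f')
  have "sym_act n g (f + f') - sym_act n h (f + f') =
      (sym_act n g f - sym_act n h f) + (sym_act n g f' - sym_act n h f')"
    by (simp add: sym_act_add)
  then show ?case using plus by (simp only: dvd_add)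
next
  case (single m c)
  have "d dvd sym_monom n g m - sym_monom n h m"
    unfolding sym_monom_def by (rule dvd_prod_diff) (auto intro: dvd_power_diff assms)
  then show ?case by (simp add: sym_act_single right_diff_distrib[symmetric])
qed


subsection \<open>Linear forms\<close>

definition lin :: "nat \<Rightarrow> (nat \<Rightarrow> 'a::field) \<Rightarrow> 'a mpoly" where
  "lin n u = (\<Sum>k<n. const_poly (u k) * X k)"

lemma sym_col_eq_lin: "sym_col n g j = lin n (\<lambda>k. g $$ (k, j))"
  by (simp add: sym_col_def lin_def X_def mult_single)

lemma lin_cong: "(\<And>k. k < n \<Longrightarrow> u k = v k) \<Longrightarrow> lin n u = lin n v"
  by (simp add: lin_def)

lemma lookup_lin:
  assumes "i < n"
  shows "Poly_Mapping.lookup (lin n u) (Poly_Mapping.single i 1) = u i"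
proof -
  have "Poly_Mapping.single k (1::nat) = Poly_Mapping.single i 1 \<longleftrightarrow> k = i" for k
    by (metis lookup_single_eq lookup_single_not_eq zero_neq_one)
  then have "Poly_Mapping.lookup (lin n u) (Poly_Mapping.single i 1) = (\<Sum>k<n. if k = i then u k else 0)"
    unfolding lin_def lookup_sum X_def
    by (intro sum.cong) (simp_all add: mult_single lookup_single when_def del: One_nat_def)
  then show ?thesis using assms by simp
qed

lemma lin_eq_iff: "lin n u = lin n v \<longleftrightarrow> (\<forall>k<n. u k = v k)"
  by (metis lin_cong lookup_lin)

lemma lin_0 [simp]: "lin n (\<lambda>_. 0) = 0"
  by (simp add: lin_def)

lemma lin_eq_0_iff: "lin n u = 0 \<longleftrightarrow> (\<forall>k<n. u k = 0)"
  using lin_eq_iff[of n u "\<lambda>_. 0"] by simp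

lemma lin_add: "lin n u + lin n v = lin n (\<lambda>k. u k + v k)"
  by (simp add: lin_def sum.distrib single_add distrib_right)

lemma lin_diff: "lin n u - lin n v = lin n (\<lambda>k. u k - v k)"
  by (simp add: lin_def sum_subtractf single_diff left_diff_distrib)

lemma lin_unit: "i < n \<Longrightarrow> lin n (\<lambda>k. if k = i then c else 0) = const_poly c * X i"
  unfolding lin_def by (subst sum.remove[of _ i]) (auto intro!: sum.neutral)

lemma sym_act_lin: "sym_act n g (lin n u) = lin n (\<lambda>k. \<Sum>j<n. g $$ (k, j) * u j)"
proof -
  have "sym_act n g (lin n u) = (\<Sum>j<n. const_poly (u j) * lin n (\<lambda>k. g $$ (k, j)))"
    unfolding lin_def[of n u] sym_act_sum
    by (rule sum.cong) (simp_all add: sym_act_mult sym_act_X sym_col_eq_lin)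
  also have "\<dots> = (\<Sum>k<n. \<Sum>j<n. const_poly (u j) * (const_poly (g $$ (k, j)) * X k))"
    unfolding lin_def sum_distrib_left by (rule sum.swap)
  also have "\<dots> = lin n (\<lambda>k. \<Sum>j<n. g $$ (k, j) * u j)"
    unfolding lin_def const_poly_sum sum_distrib_right
    by (intro sum.cong) (simp_all add: const_poly_mult mult_ac)
  finally show ?thesis .
qed


subsection \<open>Polynomials in the first \<open>n\<close> variables\<close>

lemma sym_algebra_0 [simp]: "0 \<in> sym_algebra n"
  by (simp add: sym_algebra_def)

lemma sym_algebra_const [simp]: "const_poly c \<in> sym_algebra n"
  by (simp add: sym_algebra_def)

lemma sym_algebra_1 [simp]: "1 \<in> sym_algebra n"
  by (simp add: sym_algebra_def)

lemma sym_algebra_X: "i < n \<Longrightarrow> X i \<in> sym_algebra n"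
  by (simp add: X_def sym_algebra_def)

lemma sym_algebra_add: "f \<in> sym_algebra n \<Longrightarrow> h \<in> sym_algebra n \<Longrightarrow> f + h \<in> sym_algebra n"
  unfolding sym_algebra_def using keys_add[of f h] by blast

lemma sym_algebra_mult:
  assumes "f \<in> sym_algebra n" "h \<in> sym_algebra n"
  shows "f * h \<in> sym_algebra n"
  unfolding sym_algebra_def
proof safe
  fix m i assume m: "m \<in> Poly_Mapping.keys (f * h)" and i: "i \<in> Poly_Mapping.keys m"
  obtain a b where ab: "m = a + b" "a \<in> Poly_Mapping.keys f" "b \<in> Poly_Mapping.keys h"
    using keys_mult[of f h] m by blast
  then have "i \<in> Poly_Mapping.keys a \<union> Poly_Mapping.keys b"
    using i keys_add[of a b] by blast
  then show "i < n" using ab assms by (auto simp: sym_algebra_def)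
qed

lemma sym_algebra_sum: "(\<And>i. i \<in> A \<Longrightarrow> f i \<in> sym_algebra n) \<Longrightarrow> sum f A \<in> sym_algebra n"
  by (induction A rule: infinite_finite_induct) (auto intro: sym_algebra_add)

lemma sym_algebra_prod: "(\<And>i. i \<in> A \<Longrightarrow> f i \<in> sym_algebra n) \<Longrightarrow> prod f A \<in> sym_algebra n"
  by (induction A rule: infinite_finite_induct) (auto intro: sym_algebra_mult)

lemma sym_algebra_power: "f \<in> sym_algebra n \<Longrightarrow> f ^ m \<in> sym_algebra n"
  by (induction m) (auto intro: sym_algebra_mult)

lemma sym_algebra_uminus: "f \<in> sym_algebra n \<Longrightarrow> - f \<in> sym_algebra n"
  by (simp add: sym_algebra_def keys_def)

lemma sym_algebra_diff: "f \<in> sym_algebra n \<Longrightarrow> h \<in> sym_algebra n \<Longrightarrow> f - h \<in> sym_algebra n"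
  using sym_algebra_add[of f n "- h"] sym_algebra_uminus[of h n] by simp

lemma sym_algebra_lin: "lin n u \<in> sym_algebra n"
  unfolding lin_def by (intro sym_algebra_sum sym_algebra_mult sym_algebra_const sym_algebra_X) auto

lemma sym_act_closed: "sym_act n g f \<in> sym_algebra n"
  unfolding sym_act_def sym_col_eq_lin
  by (intro sym_algebra_sum sym_algebra_mult sym_algebra_prod sym_algebra_power sym_algebra_lin
      sym_algebra_const)

text \<open>The type \<open>'a mpoly\<close> has infinitely many variables, and
  \<open>sym_act n\<close> sends those of index at least \<open>n\<close> to \<open>1\<close>. So
  the identity matrix acts as a ring retraction onto \<open>sym_algebra n\<close>.\<close>

lemma sym_act_one:
  assumes "f \<in> sym_algebra n"
  shows "sym_act n (1\<^sub>m n) f = f"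
proof -
  have col: "sym_col n (1\<^sub>m n :: 'a mat) j = X j" if "j < n" for j :: nat
  proof -
    have "lin n (\<lambda>k. (1\<^sub>m n :: 'a mat) $$ (k, j)) = lin n (\<lambda>k. if k = j then 1 else 0 :: 'a)"
      using that by (intro lin_cong) auto
    then show ?thesis using that by (simp add: sym_col_eq_lin lin_unit)
  qed
  have pow: "X j ^ i = (Poly_Mapping.single (Poly_Mapping.single j i) 1 :: 'a mpoly)" for i j
    by (induction i) (simp_all add: X_def mult_single single_add[symmetric] del: single_one)
  have prod: "(\<Prod>j\<in>A. Poly_Mapping.single (u j) 1) = (Poly_Mapping.single (sum u A) 1 :: 'a mpoly)"
    for A :: "nat set" and u
    by (induction A rule: infinite_finite_induct) (simp_all add: mult_single)
  have "sym_monom n (1\<^sub>m n :: 'a mat) m = Poly_Mapping.single m 1" if "m \<in> Poly_Mapping.keys f" for m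
  proof -
    have "sym_monom n (1\<^sub>m n :: 'a mat) m
        = Poly_Mapping.single (\<Sum>j<n. Poly_Mapping.single j (Poly_Mapping.lookup m j)) 1"
      unfolding sym_monom_def prod[symmetric] by (rule prod.cong) (simp_all add: col pow del: single_one)
    also have "(\<Sum>j<n. Poly_Mapping.single j (Poly_Mapping.lookup m j))
        = (\<Sum>j\<in>Poly_Mapping.keys m. Poly_Mapping.single j (Poly_Mapping.lookup m j))"
      using that assms by (intro sum.mono_neutral_right) (auto simp: sym_algebra_def in_keys_iff)
    finally show ?thesis by (simp add: poly_mapping_sum_single)
  qed
  then have "sym_act n (1\<^sub>m n) f
      = (\<Sum>m\<in>Poly_Mapping.keys f. Poly_Mapping.single m (Poly_Mapping.lookup f m))"
    unfolding sym_act_def sym_monom_def[symmetric] by (intro sum.cong) (simp_all add: mult_single)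
  then show ?thesis by (simp add: poly_mapping_sum_single)
qed

text \<open>The retraction given by the identity matrix fixes \<open>f * h\<close> and
  \<open>f\<close>, hence also \<open>h\<close> after cancelling \<open>f\<close>; and its image is
  \<open>sym_algebra n\<close>.\<close>

lemma sym_algebra_cancel:
  assumes "f * h \<in> sym_algebra n" "f \<in> sym_algebra n" "f \<noteq> 0"
  shows "h \<in> sym_algebra n"
proof -
  have "f * sym_act n (1\<^sub>m n) h = f * h"
    using sym_act_one[OF assms(1)] by (simp add: sym_act_mult sym_act_one[OF assms(2)])
  then have "sym_act n (1\<^sub>m n) h = h" using assms(3) by simp
  then show ?thesis by (metis sym_act_closed)
qed


subsection \<open>Contraction and exterior multiplication\<close>

text \<open>The sign of moving \<open>x\<^sub>i\<close> past the factors of smaller index in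
  \<open>x\<^sub>K\<close>. Whether \<open>i\<close> itself lies in \<open>K\<close> makes no
  difference.\<close>

definition ext_sign :: "nat \<Rightarrow> nat set \<Rightarrow> 'b::comm_ring_1" where
  "ext_sign i K = (- 1) ^ card {k \<in> K. k < i}"

lemma ext_sign_square: "ext_sign i K * (ext_sign i K * x) = x"
  by (simp add: ext_sign_def mult.assoc[symmetric] power_mult_distrib[symmetric])

lemma ext_sign_insert:
  "ext_sign i (insert j K) = (if j < i \<and> j \<notin> K then - ext_sign i K else ext_sign i K)"
proof (cases "j < i \<and> j \<notin> K")
  case True
  then have "{k \<in> insert j K. k < i} = insert j {k \<in> K. k < i}" by auto
  then show ?thesis using True by (simp add: ext_sign_def)
next
  case False
  then have "{k \<in> insert j K. k < i} = {k \<in> K. k < i}" by auto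
  then show ?thesis using False unfolding ext_sign_def by presburger
qed

lemma ext_sign_remove:
  "ext_sign i (K - {j}) = (if j < i \<and> j \<in> K then - ext_sign i K else ext_sign i K)"
proof (cases "j \<in> K")
  case True
  then have "insert j (K - {j}) = K" by auto
  then show ?thesis using True ext_sign_insert[of i j "K - {j}"]
    by (metis Diff_iff insertI1 minus_minus)
qed simp

text \<open>Contraction with the dual basis vector of \<open>x\<^sub>i\<close>, described on
  coefficients rather than on basis vectors.\<close>

lift_definition contr :: "nat \<Rightarrow> (nat set \<Rightarrow>\<^sub>0 'b::comm_ring_1) \<Rightarrow> nat set \<Rightarrow>\<^sub>0 'b"
  is "\<lambda>i t K. if i \<in> K then 0 else ext_sign i K * t (insert i K)"
proof -
  fix i and t :: "nat set \<Rightarrow> 'b"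
  assume "finite {K. t K \<noteq> 0}"
  moreover have "{K. (if i \<in> K then 0 else ext_sign i K * t (insert i K)) \<noteq> 0}
      \<subseteq> (\<lambda>L. L - {i}) ` {K. t K \<noteq> 0}"
  proof
    fix K assume "K \<in> {K. (if i \<in> K then 0 else ext_sign i K * t (insert i K)) \<noteq> 0}"
    then have "i \<notin> K" "t (insert i K) \<noteq> 0" by (auto split: if_splits)
    then show "K \<in> (\<lambda>L. L - {i}) ` {K. t K \<noteq> 0}"
      by (intro image_eqI[of _ _ "insert i K"]) auto
  qed
  ultimately show "finite {K. (if i \<in> K then 0 else ext_sign i K * t (insert i K)) \<noteq> 0}"
    by (rule finite_surj)
qed

text \<open>Left exterior multiplication by \<open>x\<^sub>i\<close>. The coefficient ring is
  general because it is applied both to \<open>'a ext\<close> and to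
  \<open>'a sym_ext\<close>.\<close>

lift_definition create :: "nat \<Rightarrow> (nat set \<Rightarrow>\<^sub>0 'b::comm_ring_1) \<Rightarrow> nat set \<Rightarrow>\<^sub>0 'b"
  is "\<lambda>i t K. if i \<in> K then ext_sign i K * t (K - {i}) else 0"
proof -
  fix i and t :: "nat set \<Rightarrow> 'b"
  assume "finite {K. t K \<noteq> 0}"
  moreover have "{K. (if i \<in> K then ext_sign i K * t (K - {i}) else 0) \<noteq> 0}
      \<subseteq> insert i ` {K. t K \<noteq> 0}"
  proof
    fix K assume "K \<in> {K. (if i \<in> K then ext_sign i K * t (K - {i}) else 0) \<noteq> 0}"
    then have "i \<in> K" "t (K - {i}) \<noteq> 0" by (auto split: if_splits)
    then show "K \<in> insert i ` {K. t K \<noteq> 0}"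
      by (intro image_eqI[of _ _ "K - {i}"]) auto
  qed
  ultimately show "finite {K. (if i \<in> K then ext_sign i K * t (K - {i}) else 0) \<noteq> 0}"
    by (rule finite_surj)
qed

lemma lookup_poly_scale [simp]:
  "Poly_Mapping.lookup (poly_scale f t) K = f * Poly_Mapping.lookup t K"
  by (simp add: poly_scale_def map.rep_eq when_def)

lemma poly_scale_add: "poly_scale f (t + u) = poly_scale f t + poly_scale f u"
  by (rule poly_mapping_eqI) (simp add: lookup_add distrib_left)

lemma poly_scale_add_left: "poly_scale (f + h) t = poly_scale f t + poly_scale h t"
  by (rule poly_mapping_eqI) (simp add: lookup_add distrib_right)

lemma poly_scale_poly_scale: "poly_scale f (poly_scale h t) = poly_scale (f * h) t"
  by (rule poly_mapping_eqI) (simp add: mult.assoc)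

lemma poly_scale_1 [simp]: "poly_scale 1 t = t"
  by (rule poly_mapping_eqI) simp

lemma poly_scale_0 [simp]: "poly_scale 0 t = 0"
  by (rule poly_mapping_eqI) simp

lemma poly_scale_0_right [simp]: "poly_scale f 0 = 0"
  by (rule poly_mapping_eqI) simp

lemma poly_scale_uminus: "poly_scale (- f) t = - poly_scale f t"
  by (rule poly_mapping_eqI) simp

lemma poly_scale_uminus_right: "poly_scale f (- t) = - poly_scale f t"
  by (rule poly_mapping_eqI) simp

lemma poly_scale_diff: "poly_scale f (t - u) = poly_scale f t - poly_scale f u"
  by (rule poly_mapping_eqI) (simp add: lookup_minus right_diff_distrib)

lemma poly_scale_diff_left: "poly_scale (f - h) t = poly_scale f t - poly_scale h t"
  by (rule poly_mapping_eqI) (simp add: lookup_minus left_diff_distrib)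

lemma poly_scale_sum: "poly_scale f (sum t A) = (\<Sum>i\<in>A. poly_scale f (t i))"
  by (rule poly_mapping_eqI) (simp add: lookup_sum sum_distrib_left)

lemma poly_scale_sum_left: "poly_scale (sum f A) t = (\<Sum>i\<in>A. poly_scale (f i) t)"
  by (rule poly_mapping_eqI) (simp add: lookup_sum sum_distrib_right)

lemma contr_add: "contr i (t + u) = contr i t + contr i u"
  by (rule poly_mapping_eqI) (simp add: contr.rep_eq lookup_add distrib_left)

lemma contr_0 [simp]: "contr i 0 = 0"
  by (rule poly_mapping_eqI) (simp add: contr.rep_eq)

lemma contr_sum: "contr i (sum t A) = (\<Sum>j\<in>A. contr i (t j))"
  by (induction A rule: infinite_finite_induct) (simp_all add: contr_add)

lemma contr_poly_scale: "contr i (poly_scale f t) = poly_scale f (contr i t)"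
  by (rule poly_mapping_eqI) (simp add: contr.rep_eq)

lemma create_add: "create i (t + u) = create i t + create i u"
  by (rule poly_mapping_eqI) (simp add: create.rep_eq lookup_add distrib_left)

lemma create_0 [simp]: "create i 0 = 0"
  by (rule poly_mapping_eqI) (simp add: create.rep_eq)

lemma create_sum: "create i (sum t A) = (\<Sum>j\<in>A. create i (t j))"
  by (induction A rule: infinite_finite_induct) (simp_all add: create_add)

lemma create_poly_scale: "create i (poly_scale f t) = poly_scale f (create i t)"
  by (rule poly_mapping_eqI) (simp add: create.rep_eq)

lemma contr_single:
  fixes f :: "'b::comm_ring_1"
  shows "contr i (Poly_Mapping.single A f) =
    (if i \<in> A then Poly_Mapping.single (A - {i}) (ext_sign i A * f) else 0)"
proof (rule poly_mapping_eqI)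
  fix K
  show "Poly_Mapping.lookup (contr i (Poly_Mapping.single A f)) K =
      Poly_Mapping.lookup (if i \<in> A then Poly_Mapping.single (A - {i}) (ext_sign i A * f) else 0) K"
  proof (cases "i \<in> A \<and> K = A - {i}")
    case True
    then have "i \<notin> K" "insert i K = A" "ext_sign i K = (ext_sign i A :: 'b)"
      by (auto simp: ext_sign_remove)
    then show ?thesis using True by (simp only: contr.rep_eq lookup_single_eq if_True if_False simp_thms)
  next
    case False
    then have "i \<in> K \<or> A \<noteq> insert i K" by auto
    then have "Poly_Mapping.lookup (contr i (Poly_Mapping.single A f)) K = 0"
      using lookup_single_not_eq[of A "insert i K" f] by (cases "i \<in> K") (simp_all add: contr.rep_eq)
    moreover have "Poly_Mapping.lookup (if i \<in> A then Poly_Mapping.single (A - {i}) (ext_sign i A * f) else 0) K = 0"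
      using False lookup_single_not_eq[of "A - {i}" K "ext_sign i A * f"] by (cases "i \<in> A") auto
    ultimately show ?thesis by simp
  qed
qed

lemma contr_anticommute: "contr i (contr j t) = - contr j (contr i t)"
proof (rule poly_mapping_eqI)
  fix K
  show "Poly_Mapping.lookup (contr i (contr j t)) K = Poly_Mapping.lookup (- contr j (contr i t)) K"
    by (auto simp: contr.rep_eq ext_sign_insert insert_commute[of i j] mult.left_commute)
qed

lemma contr_contr: "contr i (contr i t) = 0"
  by (rule poly_mapping_eqI) (simp add: contr.rep_eq)

text \<open>The canonical anticommutation relation between contraction and exterior multiplication,
  the source of the Leibniz rule for \<open>iota\<close>.\<close>

lemma contr_create: "contr i (create k t) = (if i = k then t else 0) - create k (contr i t)"
proof (rule poly_mapping_eqI)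
  fix K
  show "Poly_Mapping.lookup (contr i (create k t)) K
      = Poly_Mapping.lookup ((if i = k then t else 0) - create k (contr i t)) K"
  proof (cases "i = k")
    case True
    then show ?thesis
      by (auto simp: lookup_minus contr.rep_eq create.rep_eq ext_sign_insert ext_sign_remove
          ext_sign_square insert_absorb)
  next
    case False
    then have "insert i K - {k} = insert i (K - {k})" by auto
    then show ?thesis using False
      by (auto simp: lookup_minus contr.rep_eq create.rep_eq ext_sign_insert ext_sign_remove
          mult.left_commute)
  qed
qed

section \<open>Contraction with a covector of polynomials\<close>

definition iota :: "nat \<Rightarrow> (nat \<Rightarrow> 'a::field mpoly) \<Rightarrow> 'a sym_ext \<Rightarrow> 'a sym_ext" where
  "iota n D t = (\<Sum>i<n. poly_scale (D i) (contr i t))"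

lemma iota_cong: "(\<And>i. i < n \<Longrightarrow> D i = E i) \<Longrightarrow> iota n D t = iota n E t"
  by (simp add: iota_def)

lemma lookup_iota:
  "Poly_Mapping.lookup (iota n D t) K =
    (\<Sum>i<n. if i \<in> K then 0 else D i * (ext_sign i K * Poly_Mapping.lookup t (insert i K)))"
  unfolding iota_def lookup_sum by (rule sum.cong) (auto simp: contr.rep_eq)

lemma iota_add: "iota n D (t + u) = iota n D t + iota n D u"
  by (simp add: iota_def contr_add poly_scale_add sum.distrib)

lemma iota_0 [simp]: "iota n D 0 = 0"
  by (simp add: iota_def)

lemma iota_sum: "iota n D (sum t A) = (\<Sum>j\<in>A. iota n D (t j))"
  by (induction A rule: infinite_finite_induct) (simp_all add: iota_add)

lemma iota_uminus: "iota n D (- t) = - iota n D t"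
  using iota_add[of n D t "- t"] by (simp add: eq_neg_iff_add_eq_0 add.commute)

lemma iota_poly_scale: "iota n D (poly_scale f t) = poly_scale f (iota n D t)"
  unfolding iota_def poly_scale_sum
  by (rule sum.cong) (simp_all add: contr_poly_scale poly_scale_poly_scale mult.commute)

lemma iota_sum_left:
  "iota n (\<lambda>i. \<Sum>s\<in>A. c s * D s i) t = (\<Sum>s\<in>A. poly_scale (c s) (iota n (D s) t))"
  unfolding iota_def poly_scale_sum poly_scale_sum_left
  by (subst sum.swap) (simp add: poly_scale_poly_scale)

lemma iota_unit: "i < n \<Longrightarrow> iota n (\<lambda>j. if j = i then f else 0) t = poly_scale f (contr i t)"
  unfolding iota_def by (subst sum.remove[of _ i]) (auto intro!: sum.neutral)

lemma iota_anticommute: "iota n D (iota n E t) = - iota n E (iota n D t)"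
proof -
  have "iota n D (iota n E t) = (\<Sum>i<n. \<Sum>j<n. poly_scale (D i * E j) (contr i (contr j t)))"
    by (simp add: iota_def contr_sum contr_poly_scale poly_scale_sum poly_scale_poly_scale)
  also have "\<dots> = (\<Sum>j<n. \<Sum>i<n. poly_scale (D i * E j) (contr i (contr j t)))"
    by (rule sum.swap)
  also have "\<dots> = (\<Sum>j<n. \<Sum>i<n. - poly_scale (E j * D i) (contr j (contr i t)))"
    by (intro sum.cong refl) (subst contr_anticommute, simp only: poly_scale_uminus_right mult.commute)
  also have "\<dots> = - iota n E (iota n D t)"
    by (simp add: iota_def contr_sum contr_poly_scale poly_scale_sum poly_scale_poly_scale sum_negf)
  finally show ?thesis .
qed

lemma double_sum_antisym:
  fixes f :: "nat \<Rightarrow> nat \<Rightarrow> 'b::ab_group_add"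
  assumes "\<And>i. f i i = 0" "\<And>i j. f i j = - f j i"
  shows "(\<Sum>i<n. \<Sum>j<n. f i j) = 0"
proof (induction n)
  case (Suc n)
  have "(\<Sum>i<n. f i n) + (\<Sum>j<n. f n j) = (\<Sum>i<n. f i n + f n i)"
    by (simp add: sum.distrib)
  also have "\<dots> = 0" using assms(2) by (intro sum.neutral) (metis add.left_inverse)
  finally show ?case using Suc assms(1) by (simp add: sum.distrib add_ac)
qed simp

text \<open>Anticommutativity only gives \<open>2 \<cdot> \<iota>\<^sub>D \<iota>\<^sub>D = 0\<close>, which is void in characteristic \<open>2\<close>.\<close>

lemma iota_iota: "iota n D (iota n D t) = 0"
proof -
  have "iota n D (iota n D t) = (\<Sum>i<n. \<Sum>j<n. poly_scale (D i * D j) (contr i (contr j t)))"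
    by (simp add: iota_def contr_sum contr_poly_scale poly_scale_sum poly_scale_poly_scale)
  also have "\<dots> = 0"
  proof (rule double_sum_antisym)
    fix i j
    show "poly_scale (D i * D j) (contr i (contr j t)) = - poly_scale (D j * D i) (contr j (contr i t))"
      by (subst contr_anticommute) (simp only: poly_scale_uminus_right mult.commute)
  qed (simp add: contr_contr)
  finally show ?thesis .
qed

text \<open>The graded Leibniz rule for the product with \<open>x\<^sub>k\<close>: the minus sign
  comes from \<open>contr_create\<close>, the scalar is the value of the covector \<open>D\<close>
  on \<open>x\<^sub>k\<close>.\<close>

lemma iota_create:
  assumes "k < n"
  shows "iota n D (create k t) = poly_scale (D k) t - create k (iota n D t)"
proof -
  have "iota n D (create k t)
      = (\<Sum>i<n. poly_scale (D i) (if i = k then t else 0) - create k (poly_scale (D i) (contr i t)))"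
    unfolding iota_def by (rule sum.cong) (simp_all add: contr_create poly_scale_diff create_poly_scale)
  also have "\<dots> = (\<Sum>i<n. if i = k then poly_scale (D i) t else 0) - create k (iota n D t)"
    unfolding sum_subtractf iota_def create_sum
    by (rule arg_cong2[where f = "(-)"]) (simp_all add: if_distrib[of "poly_scale _"] cong: if_cong)
  finally show ?thesis using assms by simp
qed


subsection \<open>The action on the basis of the exterior algebra\<close>

text \<open>The image \<open>g x\<^sub>J\<close>, with its coefficients read as constant polynomials
  so that contractions with polynomial covectors apply to it.\<close>

definition ext_gen :: "nat \<Rightarrow> 'a::field mat \<Rightarrow> nat set \<Rightarrow> 'a sym_ext" where
  "ext_gen n g J = pure_tensor 1 (ext_act n g (Poly_Mapping.single J 1))"

lemma lookup_pure_tensor: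
  "Poly_Mapping.lookup (pure_tensor f w) K = const_poly (Poly_Mapping.lookup w K) * f"
  by (simp add: pure_tensor_def map.rep_eq when_def)

lemma pure_tensor_eq: "pure_tensor f w = poly_scale f (pure_tensor 1 w)"
  by (rule poly_mapping_eqI) (simp add: lookup_pure_tensor mult.commute)

lemma ext_act_single:
  "ext_act n g (Poly_Mapping.single J 1) =
    foldr wedge (map (ext_col n g) (sorted_list_of_set J)) (Poly_Mapping.single {} 1)"
  unfolding ext_act_def by (simp, rule poly_mapping_eqI) (simp add: map.rep_eq when_def)

lemma lookup_ext_col_singleton:
  "Poly_Mapping.lookup (ext_col n g j) {k} = (if k < n then g $$ (k, j) else 0)"
  unfolding ext_col_def lookup_sum
  by (simp add: lookup_single when_def)

lemma keys_ext_col: "Poly_Mapping.keys (ext_col n g j) \<subseteq> (\<lambda>k. {k}) ` {..<n}"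
proof
  fix J assume "J \<in> Poly_Mapping.keys (ext_col n g j)"
  then have "Poly_Mapping.lookup (ext_col n g j) J \<noteq> 0" by (simp add: in_keys_iff)
  then show "J \<in> (\<lambda>k. {k}) ` {..<n}"
    unfolding ext_col_def lookup_sum
    by (metis (mono_tags, lifting) image_eqI lookup_single_not_eq sum.neutral)
qed

lemma shuffle_sign_singleton: "shuffle_sign {k} K = ext_sign k K"
proof -
  have "{(a, b). (a, b) \<in> {k} \<times> K \<and> b < a} = Pair k ` {b \<in> K. b < k}" by auto
  then show ?thesis
    by (simp add: shuffle_sign_def ext_sign_def card_image inj_on_def)
qed

text \<open>Only the sets \<open>L - {k}\<close> contribute to the coefficient at \<open>L\<close>,
  with the sign of \<open>create\<close>. From here on exterior multiplications replace
  \<open>wedge\<close>.\<close>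

lemma lookup_wedge_ext_col:
  "Poly_Mapping.lookup (wedge (ext_col n g j) w) L =
    (\<Sum>k<n. g $$ (k, j) * Poly_Mapping.lookup (create k w) L)"
proof -
  let ?t = "\<lambda>J K. if J \<inter> K = {} then Poly_Mapping.single (J \<union> K)
      (shuffle_sign J K * Poly_Mapping.lookup (ext_col n g j) J * Poly_Mapping.lookup w K) else 0"
  have "wedge (ext_col n g j) w = (\<Sum>J\<in>(\<lambda>k. {k}) ` {..<n}. \<Sum>K\<in>Poly_Mapping.keys w. ?t J K)"
    unfolding wedge_def
    by (rule sum.mono_neutral_left)
       (use keys_ext_col[of n g j] in \<open>auto simp: not_in_keys_iff_lookup_eq_zero intro!: sum.neutral\<close>)
  also have "\<dots> = (\<Sum>k<n. \<Sum>K\<in>Poly_Mapping.keys w. ?t {k} K)"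
    by (subst sum.reindex) (auto simp: inj_on_def)
  finally have "Poly_Mapping.lookup (wedge (ext_col n g j) w) L =
      (\<Sum>k<n. \<Sum>K\<in>Poly_Mapping.keys w. Poly_Mapping.lookup (?t {k} K) L)"
    by (simp add: lookup_sum)
  also have "\<dots> = (\<Sum>k<n. g $$ (k, j) * Poly_Mapping.lookup (create k w) L)"
  proof (rule sum.cong[OF refl])
    fix k assume k: "k \<in> {..<n}"
    have "(\<Sum>K\<in>Poly_Mapping.keys w. Poly_Mapping.lookup (?t {k} K) L)
        = (\<Sum>K\<in>Poly_Mapping.keys w. if K = L - {k} then
            (if k \<in> L then ext_sign k L * g $$ (k, j) * Poly_Mapping.lookup w K else 0) else 0)"
    proof (rule sum.cong[OF refl])
      fix K
      have "k \<notin> K \<and> insert k K = L \<longleftrightarrow> K = L - {k} \<and> k \<in> L" by auto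
      then show "Poly_Mapping.lookup (?t {k} K) L = (if K = L - {k} then
            (if k \<in> L then ext_sign k L * g $$ (k, j) * Poly_Mapping.lookup w K else 0) else 0)"
        using k by (auto simp: lookup_single when_def shuffle_sign_singleton lookup_ext_col_singleton
            ext_sign_remove)
    qed
    also have "\<dots> = g $$ (k, j) * Poly_Mapping.lookup (create k w) L"
      by (auto simp: create.rep_eq in_keys_iff)
    finally show "(\<Sum>K\<in>Poly_Mapping.keys w. Poly_Mapping.lookup (?t {k} K) L)
        = g $$ (k, j) * Poly_Mapping.lookup (create k w) L" .
  qed
  finally show ?thesis .
qed

lemma ext_gen_empty [simp]: "ext_gen n g {} = Poly_Mapping.single {} 1"
  by (rule poly_mapping_eqI)
     (simp add: ext_gen_def lookup_pure_tensor ext_act_single lookup_single when_def)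

text \<open>\<open>ext_act\<close> folds over the sorted list, whose head is the minimum
  \<open>j\<close>; so \<open>g x\<^sub>j\<close> is multiplied from the left.\<close>

lemma ext_gen_insert:
  assumes "finite J" "\<forall>i\<in>J. j < i"
  shows "ext_gen n g (insert j J) = (\<Sum>k<n. poly_scale (const_poly (g $$ (k, j))) (create k (ext_gen n g J)))"
proof (rule poly_mapping_eqI)
  fix K
  have j: "j \<notin> J" using assms(2) by auto
  have sorted: "sorted_list_of_set (insert j J) = j # sorted_list_of_set J"
    using assms j by (simp add: insort_is_Cons less_imp_le)
  have "Poly_Mapping.lookup (create k (ext_gen n g J)) K
      = const_poly (Poly_Mapping.lookup (create k (ext_act n g (Poly_Mapping.single J 1))) K)" for k
  proof -
    \<comment> \<open>The sign is an element of \<open>'a mpoly\<close> on one side and of the field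
      on the other.\<close>
    have sgn: "ext_sign k K = const_poly (ext_sign k K :: 'a)"
      by (cases "even (card {i \<in> K. i < k})") (simp_all add: ext_sign_def single_uminus)
    show ?thesis
      by (simp add: create.rep_eq ext_gen_def lookup_pure_tensor const_poly_mult sgn[symmetric])
  qed
  then show "Poly_Mapping.lookup (ext_gen n g (insert j J)) K =
      Poly_Mapping.lookup (\<Sum>k<n. poly_scale (const_poly (g $$ (k, j))) (create k (ext_gen n g J))) K"
    unfolding ext_gen_def[of n g "insert j J"] lookup_pure_tensor ext_act_single sorted list.map
      foldr.simps o_apply lookup_wedge_ext_col lookup_sum lookup_poly_scale
    by (simp add: ext_act_single const_poly_sum const_poly_mult)
qed

text \<open>The first assumption says that the value of \<open>D'\<close> on
  \<open>g x\<^sub>j\<close> is the image under \<open>g\<close> of the value of \<open>D\<close> on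
  \<open>x\<^sub>j\<close>: \<open>D'\<close> is the covector \<open>D\<close> transported by
  \<open>g\<close>. The Leibniz rule is then applied along the recursion for
  \<open>ext_gen\<close>.\<close>

lemma iota_ext_gen:
  assumes "\<And>j. j < n \<Longrightarrow> sym_act n g (D j) = (\<Sum>k<n. const_poly (g $$ (k, j)) * D' k)"
    and "finite J" "J \<subseteq> {..<n}"
  shows "iota n D' (ext_gen n g J) =
    (\<Sum>i\<in>J. poly_scale (ext_sign i J * sym_act n g (D i)) (ext_gen n g (J - {i})))"
  using assms(2,3)
proof (induction J rule: finite_linorder_min_induct)
  case empty
  show ?case
    by (rule poly_mapping_eqI) (auto simp: lookup_iota lookup_single when_def simp del: single_one intro!: sum.neutral)
next
  case (insert j J)
  \<comment> \<open>\<open>?E\<close> is exterior multiplication by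
    \<open>g x\<^sub>j\<close>.\<close>
  let ?E = "\<lambda>t. \<Sum>k<n. poly_scale (const_poly (g $$ (k, j))) (create k t)"
  have j: "j < n" "j \<notin> J" using insert.prems insert.hyps by auto
  have E_sum: "?E (sum t A) = (\<Sum>i\<in>A. ?E (t i))" for t :: "nat \<Rightarrow> 'a sym_ext" and A
    unfolding create_sum poly_scale_sum by (rule sum.swap)
  have E_scale: "?E (poly_scale f t) = poly_scale f (?E t)" for f t
    by (simp add: create_poly_scale poly_scale_sum poly_scale_poly_scale mult.commute)
  have "iota n D' (ext_gen n g (insert j J)) = iota n D' (?E (ext_gen n g J))"
    using insert.hyps by (simp add: ext_gen_insert)
  also have "\<dots> = (\<Sum>k<n. poly_scale (const_poly (g $$ (k, j)) * D' k) (ext_gen n g J)) -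
      ?E (iota n D' (ext_gen n g J))"
    unfolding iota_sum iota_poly_scale sum_subtractf[symmetric]
    by (rule sum.cong) (simp_all add: iota_create poly_scale_diff poly_scale_poly_scale)
  also have "(\<Sum>k<n. poly_scale (const_poly (g $$ (k, j)) * D' k) (ext_gen n g J))
      = poly_scale (sym_act n g (D j)) (ext_gen n g J)"
    by (simp add: assms(1) j poly_scale_sum_left)
  also have "?E (iota n D' (ext_gen n g J)) =
      (\<Sum>i\<in>J. poly_scale (ext_sign i J * sym_act n g (D i)) (?E (ext_gen n g (J - {i}))))"
    using insert by (simp only: E_sum E_scale insert_subset)
  also have "\<dots> = (\<Sum>i\<in>J. - poly_scale (ext_sign i (insert j J) * sym_act n g (D i))
      (ext_gen n g (insert j J - {i})))"
  proof (rule sum.cong[OF refl])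
    fix i assume i: "i \<in> J"
    then have "insert j J - {i} = insert j (J - {i})" using j by auto
    moreover have "?E (ext_gen n g (J - {i})) = ext_gen n g (insert j (J - {i}))"
      using insert.hyps by (intro ext_gen_insert[symmetric]) auto
    ultimately show "poly_scale (ext_sign i J * sym_act n g (D i)) (?E (ext_gen n g (J - {i})))
        = - poly_scale (ext_sign i (insert j J) * sym_act n g (D i)) (ext_gen n g (insert j J - {i}))"
      using i insert.hyps j by (simp add: ext_sign_insert poly_scale_uminus)
  qed
  also have "poly_scale (sym_act n g (D j)) (ext_gen n g J) - \<dots> =
      (\<Sum>i\<in>insert j J. poly_scale (ext_sign i (insert j J) * sym_act n g (D i))
        (ext_gen n g (insert j J - {i})))"
  proof -
    \<comment> \<open>As \<open>j\<close> is the minimum, its own term carries the sign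
      \<open>1\<close>.\<close>
    have "{k \<in> insert j J. k < j} = {}" using insert.hyps by auto
    then have "ext_sign j (insert j J) = (1 :: 'a mpoly)" unfolding ext_sign_def by (simp only: card.empty power_0)
    moreover have "insert j J - {j} = J" using j by auto
    ultimately show ?thesis using insert.hyps j by (simp add: sum_negf)
  qed
  finally show ?case .
qed

text \<open>The vanishing entries say that \<open>g\<close> preserves the span of the first
  \<open>m\<close> variables; each step of the recursion adds exactly one index, which keeps the
  size.\<close>

lemma keys_ext_gen:
  assumes "finite J" "J \<subseteq> {..<m}" "m \<le> n"
    and "\<And>k j. j < m \<Longrightarrow> m \<le> k \<Longrightarrow> k < n \<Longrightarrow> g $$ (k, j) = 0"
    and "K \<in> Poly_Mapping.keys (ext_gen n g J)"
  shows "finite K \<and> K \<subseteq> {..<m} \<and> card K = card J"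
  using assms(1,2,5)
proof (induction J arbitrary: K rule: finite_linorder_min_induct)
  case empty
  then show ?case by (simp split: if_splits)
next
  case (insert j J)
  have "Poly_Mapping.lookup (ext_gen n g (insert j J)) K \<noteq> 0"
    using insert.prems by (simp add: in_keys_iff)
  then have "(\<Sum>k<n. const_poly (g $$ (k, j)) * Poly_Mapping.lookup (create k (ext_gen n g J)) K) \<noteq> 0"
    using insert.hyps by (simp add: ext_gen_insert lookup_sum)
  then obtain k where k: "k < n" "g $$ (k, j) \<noteq> 0"
      "Poly_Mapping.lookup (create k (ext_gen n g J)) K \<noteq> 0"
    by (metis (no_types, lifting) lessThan_iff mult_zero_left mult_zero_right single_zero sum.neutral)
  then have *: "k \<in> K" "K - {k} \<in> Poly_Mapping.keys (ext_gen n g J)"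
    by (auto simp: create.rep_eq in_keys_iff split: if_splits)
  have K: "finite (K - {k})" "K - {k} \<subseteq> {..<m}" "card (K - {k}) = card J"
    using insert.IH[OF _ *(2)] insert.prems(1) by blast+
  have "k < m" using k assms(4)[of j k] insert.prems by (meson insert_subset lessThan_iff not_le)
  then have "finite K" "K \<subseteq> {..<m}" using K(1,2) by auto
  moreover have "card K = Suc (card J)"
    using K(1,3) *(1) by (metis card.remove calculation(1))
  moreover have "j \<notin> J" using insert.hyps by auto
  ultimately show ?case using insert.hyps by simp
qed

lemma lookup_ext_gen_empty:
  assumes "finite J" "J \<noteq> {}"
  shows "Poly_Mapping.lookup (ext_gen n g J) {} = 0"
  using assms
proof (induction J rule: finite_linorder_min_induct)
  case (insert j J)
  then show ?case by (simp add: ext_gen_insert lookup_sum create.rep_eq)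
qed simp

text \<open>The top exterior power of a stable subspace is a line. The scalar is the leading minor
  of size \<open>m\<close>; \<open>sym_act_top_form\<close> later ties it to the action on
  \<open>form_prod\<close>.\<close>

lemma ext_gen_top:
  assumes "m \<le> n" "\<And>k j. j < m \<Longrightarrow> m \<le> k \<Longrightarrow> k < n \<Longrightarrow> g $$ (k, j) = 0"
  obtains \<delta> where "ext_gen n g {..<m} = Poly_Mapping.single {..<m} (const_poly \<delta>)"
proof -
  let ?\<delta> = "Poly_Mapping.lookup (ext_act n g (Poly_Mapping.single {..<m} 1)) {..<m}"
  have "ext_gen n g {..<m} = Poly_Mapping.single {..<m} (const_poly ?\<delta>)"
  proof (rule poly_mapping_eqI)
    fix K
    show "Poly_Mapping.lookup (ext_gen n g {..<m}) K
        = Poly_Mapping.lookup (Poly_Mapping.single {..<m} (const_poly ?\<delta>)) K"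
    proof (cases "K = {..<m}")
      case True
      then show ?thesis by (simp add: ext_gen_def lookup_pure_tensor)
    next
      case False
      have "K \<notin> Poly_Mapping.keys (ext_gen n g {..<m})"
        using keys_ext_gen[of "{..<m}" m n g K] assms False
        by (metis card_subset_eq finite_lessThan order_refl)
      then show ?thesis using False by (simp add: in_keys_iff lookup_single when_def)
    qed
  qed
  then show ?thesis by (rule that)
qed


subsection \<open>The diagonal action\<close>

lemma sym_ext_act_superset:
  assumes "finite A" "Poly_Mapping.keys t \<subseteq> A"
  shows "sym_ext_act n k g t = (\<Sum>J\<in>A. poly_scale
    (const_poly (det g ^ k) * sym_act n g (Poly_Mapping.lookup t J)) (ext_gen n g J))"
proof -
  have "sym_ext_act n k g t = (\<Sum>J\<in>Poly_Mapping.keys t. poly_scale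
      (const_poly (det g ^ k) * sym_act n g (Poly_Mapping.lookup t J)) (ext_gen n g J))"
    unfolding sym_ext_act_def ext_gen_def
    by (rule sum.cong[OF refl]) (subst pure_tensor_eq, simp add: poly_scale_poly_scale)
  also have "\<dots> = (\<Sum>J\<in>A. poly_scale
      (const_poly (det g ^ k) * sym_act n g (Poly_Mapping.lookup t J)) (ext_gen n g J))"
    by (rule sum.mono_neutral_left) (use assms in \<open>auto simp: in_keys_iff\<close>)
  finally show ?thesis .
qed

lemma sym_ext_act_0 [simp]: "sym_ext_act n k g 0 = 0"
  by (simp add: sym_ext_act_def)

lemma sym_ext_act_add: "sym_ext_act n k g (t + u) = sym_ext_act n k g t + sym_ext_act n k g u"
proof -
  let ?A = "Poly_Mapping.keys t \<union> Poly_Mapping.keys u"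
  have "Poly_Mapping.keys (t + u) \<subseteq> ?A" by (rule keys_add)
  then show ?thesis
    by (simp add: sym_ext_act_superset[of ?A] lookup_add sym_act_add distrib_left
        poly_scale_add_left sum.distrib)
qed

lemma sym_ext_act_uminus: "sym_ext_act n k g (- t) = - sym_ext_act n k g t"
  using sym_ext_act_add[of n k g t "- t"] by (simp add: eq_neg_iff_add_eq_0 add.commute)

lemma sym_ext_act_poly_scale:
  "sym_ext_act n k g (poly_scale f t) = poly_scale (sym_act n g f) (sym_ext_act n k g t)"
proof -
  let ?A = "Poly_Mapping.keys t"
  have "Poly_Mapping.keys (poly_scale f t) \<subseteq> ?A" by (auto simp: in_keys_iff)
  then show ?thesis
    by (simp add: sym_ext_act_superset[of ?A] poly_scale_sum poly_scale_poly_scale sym_act_mult mult_ac)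
qed

lemma sym_ext_act_single:
  "sym_ext_act n k g (Poly_Mapping.single J f) =
    poly_scale (const_poly (det g ^ k) * sym_act n g f) (ext_gen n g J)"
  by (subst sym_ext_act_superset[of "{J}"]) auto

lemma sym_ext_spaceD:
  assumes "t \<in> sym_ext_space n"
  shows "Poly_Mapping.keys t \<subseteq> Pow {..<n}" "Poly_Mapping.lookup t J \<in> sym_algebra n"
  using assms by (auto simp: sym_ext_space_def)

lemma sym_ext_space_0 [simp]: "0 \<in> sym_ext_space n"
  by (simp add: sym_ext_space_def)

lemma sym_ext_space_add:
  "t \<in> sym_ext_space n \<Longrightarrow> u \<in> sym_ext_space n \<Longrightarrow> t + u \<in> sym_ext_space n"
  unfolding sym_ext_space_def using keys_add[of t u]
  by (simp add: lookup_add sym_algebra_add) (meson Un_subset_iff order_trans)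

lemma sym_ext_space_uminus: "t \<in> sym_ext_space n \<Longrightarrow> - t \<in> sym_ext_space n"
  unfolding sym_ext_space_def by (auto simp: keys_def intro: sym_algebra_uminus)

lemma sym_ext_space_diff:
  "t \<in> sym_ext_space n \<Longrightarrow> u \<in> sym_ext_space n \<Longrightarrow> t - u \<in> sym_ext_space n"
  using sym_ext_space_add[of t n "- u"] sym_ext_space_uminus[of u n] by simp

lemma sym_ext_space_sum:
  "(\<And>i. i \<in> A \<Longrightarrow> t i \<in> sym_ext_space n) \<Longrightarrow> sum t A \<in> sym_ext_space n"
  by (induction A rule: infinite_finite_induct) (auto intro: sym_ext_space_add)

lemma sym_ext_space_poly_scale:
  "f \<in> sym_algebra n \<Longrightarrow> t \<in> sym_ext_space n \<Longrightarrow> poly_scale f t \<in> sym_ext_space n"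
  unfolding sym_ext_space_def by (auto simp: in_keys_iff intro: sym_algebra_mult)

lemma sym_ext_space_single:
  "f \<in> sym_algebra n \<Longrightarrow> J \<subseteq> {..<n} \<Longrightarrow> Poly_Mapping.single J f \<in> sym_ext_space n"
  unfolding sym_ext_space_def by (auto simp: lookup_single when_def)

lemma sym_ext_space_contr:
  assumes "t \<in> sym_ext_space n"
  shows "contr i t \<in> sym_ext_space n"
proof -
  have "ext_sign i K \<in> sym_algebra n" for K
    unfolding ext_sign_def by (intro sym_algebra_power sym_algebra_uminus sym_algebra_1)
  then show ?thesis
    using assms unfolding sym_ext_space_def
    by (auto simp: contr.rep_eq in_keys_iff intro: sym_algebra_mult split: if_splits)
qed

lemma sym_ext_space_iota:
  "(\<And>i. i < n \<Longrightarrow> D i \<in> sym_algebra n) \<Longrightarrow> t \<in> sym_ext_space n \<Longrightarrow> iota n D t \<in> sym_ext_space n"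
  unfolding iota_def by (intro sym_ext_space_sum sym_ext_space_poly_scale sym_ext_space_contr) auto

lemma sym_act_ext_sign: "sym_act n g (ext_sign i K) = ext_sign i K"
  by (simp add: ext_sign_def sym_act_power sym_act_uminus)

text \<open>Applied with \<open>D' = D\<close> for equivariant covectors, and with a transported
  dual basis for reading off coefficients. Both sides are sums over pairs of a set \<open>J\<close>
  and an element \<open>i\<close> removed from it.\<close>

lemma sym_ext_act_iota:
  assumes D: "\<And>j. j < n \<Longrightarrow> sym_act n g (D j) = (\<Sum>k<n. const_poly (g $$ (k, j)) * D' k)"
    and t: "t \<in> sym_ext_space n"
  shows "sym_ext_act n k g (iota n D t) = iota n D' (sym_ext_act n k g t)"
proof -
  let ?P = "Pow {..<n}" and ?c = "const_poly (det g ^ k)"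
  \<comment> \<open>\<open>T J i\<close> is the image under the action of what the
    \<open>J\<close>-component leaves when \<open>x\<^sub>i\<close> is contracted.\<close>
  define T where "T J i = poly_scale (?c * (sym_act n g (Poly_Mapping.lookup t J) *
      (ext_sign i J * sym_act n g (D i)))) (ext_gen n g (J - {i}))" for J i
  have keys: "Poly_Mapping.keys (iota n D t) \<subseteq> ?P"
  proof
    fix K assume "K \<in> Poly_Mapping.keys (iota n D t)"
    then obtain i where "i < n" "Poly_Mapping.lookup t (insert i K) \<noteq> 0"
      unfolding in_keys_iff lookup_iota
      by (elim sum.not_neutral_contains_not_neutral) (auto split: if_splits)
    then have "insert i K \<in> Poly_Mapping.keys t" by (simp add: in_keys_iff)
    then show "K \<in> ?P" using sym_ext_spaceD(1)[OF t] by blast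
  qed
  have "sym_ext_act n k g (iota n D t) = (\<Sum>K\<in>?P. \<Sum>i<n. if i \<in> K then 0 else T (insert i K) i)"
  proof (subst sym_ext_act_superset[OF _ keys], simp, rule sum.cong[OF refl])
    fix K
    have "poly_scale (?c * sym_act n g (Poly_Mapping.lookup (iota n D t) K)) (ext_gen n g K) =
      (\<Sum>i<n. poly_scale (?c * sym_act n g (if i \<in> K then 0 else
        D i * (ext_sign i K * Poly_Mapping.lookup t (insert i K)))) (ext_gen n g K))"
      by (simp add: lookup_iota sym_act_sum sum_distrib_left poly_scale_sum_left)
    also have "\<dots> = (\<Sum>i<n. if i \<in> K then 0 else T (insert i K) i)"
      by (rule sum.cong[OF refl])
        (auto simp: T_def sym_act_mult sym_act_ext_sign ext_sign_insert mult_ac)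
    finally show "poly_scale (?c * sym_act n g (Poly_Mapping.lookup (iota n D t) K)) (ext_gen n g K) =
      (\<Sum>i<n. if i \<in> K then 0 else T (insert i K) i)" .
  qed
  also have "\<dots> = (\<Sum>K\<in>?P. \<Sum>i\<in>{..<n} - K. T (insert i K) i)"
    by (rule sum.cong[OF refl], rule sum.mono_neutral_cong_right) auto
  also have "\<dots> = (\<Sum>(K, i)\<in>(SIGMA K:?P. {..<n} - K). T (insert i K) i)"
    by (subst sum.Sigma) auto
  \<comment> \<open>A set \<open>K\<close> with a missing index \<open>i\<close> corresponds to
    \<open>J = insert i K\<close> with the chosen element \<open>i\<close>.\<close>
  also have "\<dots> = (\<Sum>(J, i)\<in>(SIGMA J:?P. J). T J i)"
    by (rule sum.reindex_bij_witness[of _ "\<lambda>(J, i). (J - {i}, i)" "\<lambda>(K, i). (insert i K, i)"])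
      (auto simp: insert_absorb)
  also have "\<dots> = (\<Sum>J\<in>?P. \<Sum>i\<in>J. T J i)"
    by (subst sum.Sigma) (auto intro: finite_subset)
  also have "\<dots> = iota n D' (sym_ext_act n k g t)"
    unfolding sym_ext_act_superset[OF _ sym_ext_spaceD(1)[OF t], simplified] iota_sum
  proof (rule sum.cong[OF refl])
    fix J assume "J \<in> ?P"
    then have "finite J" "J \<subseteq> {..<n}" by (auto intro: finite_subset)
    then show "(\<Sum>i\<in>J. T J i) = iota n D'
        (poly_scale (?c * sym_act n g (Poly_Mapping.lookup t J)) (ext_gen n g J))"
      unfolding iota_poly_scale
      by (subst iota_ext_gen[OF D]) (simp_all add: T_def poly_scale_sum poly_scale_poly_scale mult.assoc)
  qed
  finally show ?thesis .
qed

definition scalar_part :: "'a::field sym_ext \<Rightarrow> 'a mpoly" where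
  "scalar_part t = Poly_Mapping.lookup t {}"

lemma scalar_part_simps [simp]:
  "scalar_part (t + u) = scalar_part t + scalar_part u"
  "scalar_part (t - u) = scalar_part t - scalar_part u"
  "scalar_part (- t) = - scalar_part t"
  "scalar_part 0 = 0"
  "scalar_part (poly_scale f t) = f * scalar_part t"
  by (simp_all add: scalar_part_def lookup_add lookup_minus)

lemma scalar_part_sum: "scalar_part (sum t A) = (\<Sum>i\<in>A. scalar_part (t i))"
  by (simp add: scalar_part_def lookup_sum)

text \<open>The action keeps the exterior degree, so only the component at \<open>J = {}\<close>
  reaches the scalar part.\<close>

lemma scalar_part_act:
  assumes "t \<in> sym_ext_space n"
  shows "scalar_part (sym_ext_act n k g t) = const_poly (det g ^ k) * sym_act n g (scalar_part t)"
proof -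
  have "scalar_part (sym_ext_act n k g t) = (\<Sum>J\<in>Pow {..<n}. if J = {} then
      const_poly (det g ^ k) * sym_act n g (scalar_part t) else 0)"
    unfolding sym_ext_act_superset[OF _ sym_ext_spaceD(1)[OF assms], simplified] scalar_part_sum
  proof (rule sum.cong[OF refl])
    fix J assume "J \<in> Pow {..<n}"
    then have "finite J" by (auto intro: finite_subset)
    then show "scalar_part (poly_scale (const_poly (det g ^ k) *
        sym_act n g (Poly_Mapping.lookup t J)) (ext_gen n g J)) =
        (if J = {} then const_poly (det g ^ k) * sym_act n g (scalar_part t) else 0)"
      by (simp add: scalar_part_def lookup_ext_gen_empty lookup_single)
  qed
  then show ?thesis by simp
qed


subsection \<open>Iterated contractions\<close>

definition iotas :: "nat \<Rightarrow> ('s \<Rightarrow> nat \<Rightarrow> 'a::field mpoly) \<Rightarrow> 's list \<Rightarrow> 'a sym_ext \<Rightarrow> 'a sym_ext" where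
  "iotas n D xs t = foldr (\<lambda>s. iota n (D s)) xs t"

lemma iotas_Nil [simp]: "iotas n D [] t = t"
  and iotas_Cons [simp]: "iotas n D (s # xs) t = iota n (D s) (iotas n D xs t)"
  and iotas_append: "iotas n D (xs @ ys) t = iotas n D xs (iotas n D ys t)"
  by (simp_all add: iotas_def)

lemma iotas_0 [simp]: "iotas n D xs 0 = 0"
  by (induction xs) simp_all

lemma iotas_add: "iotas n D xs (t + u) = iotas n D xs t + iotas n D xs u"
  by (induction xs) (simp_all add: iota_add)

lemma iotas_uminus: "iotas n D xs (- t) = - iotas n D xs t"
  by (induction xs) (simp_all add: iota_uminus)

lemma iotas_sum: "iotas n D xs (sum t A) = (\<Sum>i\<in>A. iotas n D xs (t i))"
  by (induction A rule: infinite_finite_induct) (simp_all add: iotas_add)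

lemma iotas_poly_scale: "iotas n D xs (poly_scale f t) = poly_scale f (iotas n D xs t)"
  by (induction xs) (simp_all add: iota_poly_scale)

lemma iotas_cong: "(\<And>s i. s \<in> set xs \<Longrightarrow> i < n \<Longrightarrow> D s i = E s i) \<Longrightarrow> iotas n D xs t = iotas n E xs t"
  by (induction xs) (auto intro: iota_cong)

lemma sym_ext_space_iotas:
  "(\<And>s i. s \<in> set xs \<Longrightarrow> i < n \<Longrightarrow> D s i \<in> sym_algebra n) \<Longrightarrow> t \<in> sym_ext_space n \<Longrightarrow>
    iotas n D xs t \<in> sym_ext_space n"
  by (induction xs) (auto intro: sym_ext_space_iota)

lemma sym_ext_act_iotas:
  assumes "\<And>s j. s \<in> set xs \<Longrightarrow> j < n \<Longrightarrow>
      sym_act n g (D s j) = (\<Sum>k<n. const_poly (g $$ (k, j)) * D' s k)"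
    and "\<And>s i. s \<in> set xs \<Longrightarrow> i < n \<Longrightarrow> D s i \<in> sym_algebra n"
    and "t \<in> sym_ext_space n"
  shows "sym_ext_act n k g (iotas n D xs t) = iotas n D' xs (sym_ext_act n k g t)"
  using assms(1,2)
proof (induction xs)
  case (Cons s xs)
  have "iotas n D xs t \<in> sym_ext_space n"
    by (rule sym_ext_space_iotas) (use Cons.prems assms(3) in auto)
  then have "sym_ext_act n k g (iotas n D (s # xs) t)
      = iota n (D' s) (sym_ext_act n k g (iotas n D xs t))"
    using Cons.prems(1)[of s] by (simp add: sym_ext_act_iota[of n g "D s" "D' s"])
  then show ?case using Cons by simp
qed simp

text \<open>Each exchange costs a sign by \<open>iota_anticommute\<close>. The total sign is left
  open, since vanishing and divisibility do not depend on it.\<close>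

lemma iota_iotas_commute:
  "iota n E (iotas n D xs t) = iotas n D xs (iota n E t) \<or>
    iota n E (iotas n D xs t) = - iotas n D xs (iota n E t)"
proof (induction xs)
  case (Cons s xs)
  have "iota n E (iotas n D (s # xs) t) = - iota n (D s) (iota n E (iotas n D xs t))"
    using iota_anticommute[of n E "D s" "iotas n D xs t"] by simp
  then show ?case using Cons.IH by (auto simp: iota_uminus)
qed simp

lemma iotas_perm:
  assumes "mset xs = mset ys"
  shows "iotas n D xs t = iotas n D ys t \<or> iotas n D xs t = - iotas n D ys t"
  using assms
proof (induction xs arbitrary: ys)
  case (Cons s xs)
  then have "s \<in> set ys" by (metis list.set_intros(1) mset_eq_setD)
  then obtain us vs where ys: "ys = us @ s # vs" by (meson split_list)
  then have "mset xs = mset (us @ vs)" using Cons.prems by simp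
  then have "iotas n D xs t = iotas n D (us @ vs) t \<or> iotas n D xs t = - iotas n D (us @ vs) t"
    by (rule Cons.IH)
  moreover have "iota n (D s) (iotas n D us (iotas n D vs t)) = iotas n D ys t \<or>
      iota n (D s) (iotas n D us (iotas n D vs t)) = - iotas n D ys t"
    using iota_iotas_commute[of n "D s" D us "iotas n D vs t"] by (simp add: ys iotas_append)
  ultimately show ?case by (auto simp: iotas_append iota_uminus)
qed simp

lemma iotas_eq_0:
  assumes "s \<in> set xs" "iota n (D s) t = 0"
  shows "iotas n D xs t = 0"
proof -
  obtain us vs where xs: "xs = us @ s # vs" using assms(1) by (meson split_list)
  have "iota n (D s) (iotas n D vs t) = 0"
    using iota_iotas_commute[of n "D s" D vs t] assms(2) by auto
  then show ?thesis by (simp add: xs iotas_append)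
qed

text \<open>Bringing the two copies of a repeated contraction together reduces the claim to
  \<open>iota_iota\<close>.\<close>

lemma iotas_not_distinct:
  assumes "\<not> distinct xs"
  shows "iotas n D xs t = 0"
proof -
  obtain us vs ws s where "xs = us @ [s] @ vs @ [s] @ ws"
    using assms not_distinct_decomp by blast
  moreover have "iota n (D s) (iotas n D vs (iota n (D s) u)) = 0" for u
    using iota_iotas_commute[of n "D s" D vs "iota n (D s) u"] by (auto simp: iota_iota)
  ultimately show ?thesis by (simp add: iotas_append)
qed

text \<open>Finiteness is demanded because infinite sets have \<open>card\<close> equal to
  \<open>0\<close>.\<close>

definition homogeneous :: "nat \<Rightarrow> 'a::field sym_ext \<Rightarrow> bool" where
  "homogeneous d t \<longleftrightarrow> (\<forall>K\<in>Poly_Mapping.keys t. finite K \<and> card K = d)"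

text \<open>Truncated subtraction is harmless: in degree \<open>0\<close> there is nothing to
  contract and the result is zero.\<close>

lemma homogeneous_iota:
  assumes "homogeneous d t"
  shows "homogeneous (d - 1) (iota n D t)"
  unfolding homogeneous_def
proof
  fix K assume "K \<in> Poly_Mapping.keys (iota n D t)"
  then have "(\<Sum>i<n. if i \<in> K then 0 else
      D i * (ext_sign i K * Poly_Mapping.lookup t (insert i K))) \<noteq> 0"
    by (simp add: in_keys_iff lookup_iota)
  then obtain i where "i < n" "i \<notin> K" "Poly_Mapping.lookup t (insert i K) \<noteq> 0"
    by (elim sum.not_neutral_contains_not_neutral) (auto split: if_splits)
  then have "insert i K \<in> Poly_Mapping.keys t" by (simp add: in_keys_iff)
  then have "finite (insert i K) \<and> card (insert i K) = d"
    by (rule bspec[OF assms[unfolded homogeneous_def]])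
  then show "finite K \<and> card K = d - 1" using \<open>i \<notin> K\<close> by auto
qed

lemma homogeneous_iotas: "homogeneous d t \<Longrightarrow> homogeneous (d - length xs) (iotas n D xs t)"
  by (induction xs) (auto dest: homogeneous_iota[of _ _ n])

lemma homogeneous_scalar_part: "homogeneous d t \<Longrightarrow> 0 < d \<Longrightarrow> scalar_part t = 0"
  unfolding homogeneous_def scalar_part_def by (metis card.empty in_keys_iff less_irrefl)

text \<open>Every coefficient is, up to sign, a scalar part; this reduces statements on coefficients to
  the equivariance of contractions.\<close>

lemma lookup_eq_scalar_part:
  assumes "set xs = K" "distinct xs" "K \<subseteq> {..<n}"
  shows "scalar_part (iotas n (\<lambda>s i. if i = s then 1 else 0) xs t) = Poly_Mapping.lookup t K \<or>
    scalar_part (iotas n (\<lambda>s i. if i = s then 1 else 0) xs t) = - Poly_Mapping.lookup t K"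
proof -
  let ?E = "\<lambda>s i :: nat. if i = s then 1 else 0"
  \<comment> \<open>Generalised from \<open>{}\<close> to all \<open>L\<close> disjoint from
    \<open>K\<close>, because contracting by \<open>s\<close> passes from \<open>L\<close> to
    \<open>insert s L\<close>.\<close>
  have "Poly_Mapping.lookup (iotas n ?E xs t) L = Poly_Mapping.lookup t (L \<union> K) \<or>
      Poly_Mapping.lookup (iotas n ?E xs t) L = - Poly_Mapping.lookup t (L \<union> K)"
    if "L \<inter> K = {}" for L
    using assms that
  proof (induction xs arbitrary: K L)
    case (Cons s xs)
    have s: "s < n" "s \<notin> L" "s \<notin> set xs" using Cons.prems by auto
    have "iotas n ?E (s # xs) t = contr s (iotas n ?E xs t)"
      using s iota_unit[of s n 1] by simp
    then have "Poly_Mapping.lookup (iotas n ?E (s # xs) t) L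
        = ext_sign s L * Poly_Mapping.lookup (iotas n ?E xs t) (insert s L)"
      using s by (simp add: contr.rep_eq)
    moreover have "ext_sign s L = (1 :: 'a mpoly) \<or> ext_sign s L = (- 1 :: 'a mpoly)"
      unfolding ext_sign_def by (cases "even (card {k \<in> L. k < s})") auto
    moreover have "Poly_Mapping.lookup (iotas n ?E xs t) (insert s L)
          = Poly_Mapping.lookup t (insert s L \<union> set xs) \<or>
        Poly_Mapping.lookup (iotas n ?E xs t) (insert s L)
          = - Poly_Mapping.lookup t (insert s L \<union> set xs)"
      by (rule Cons.IH) (use Cons.prems in auto)
    moreover have "insert s L \<union> set xs = L \<union> K" using Cons.prems by auto
    ultimately show ?case by (elim disjE) simp_all
  qed simp
  from this[of "{}"] show ?thesis by (simp add: scalar_part_def)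
qed


subsection \<open>Powers in and over a finite field\<close>

lemma card_field_gt_1: "1 < CARD('a::{field,finite})"
proof -
  have "card {0, 1 :: 'a} \<le> CARD('a)" by (rule card_mono) auto
  then show ?thesis by simp
qed

text \<open>Multiplication by \<open>c\<close> permutes the units, so the product of all units
  absorbs one factor \<open>c\<close> for each of them.\<close>

lemma power_card_minus_one:
  fixes c :: "'a::{field,finite}"
  assumes "c \<noteq> 0"
  shows "c ^ (CARD('a) - 1) = 1"
proof -
  have "(\<Prod>y\<in>UNIV-{0}. c * y) = (\<Prod>y\<in>UNIV-{0}. y)"
    by (rule prod.reindex_bij_witness[of _ "\<lambda>y. y / c" "\<lambda>y. c * y"]) (use assms in auto)
  then have "c ^ (CARD('a) - 1) * \<Prod>(UNIV-{0}) = 1 * \<Prod>(UNIV-{0 :: 'a})"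
    by (simp add: prod.distrib)
  then show ?thesis by simp
qed

lemma power_card:
  fixes c :: "'a::{field,finite}"
  shows "c ^ CARD('a) = c"
proof (cases "c = 0")
  case False
  have "c ^ CARD('a) = c * c ^ (CARD('a) - 1)"
    by (metis Suc_diff_1 finite_UNIV_card_ge_0 finite power_Suc)
  then show ?thesis by (simp only: power_card_minus_one[OF False] mult_1_right)
qed simp

lemma power_card_power:
  fixes c :: "'a::{field,finite}"
  shows "c ^ (CARD('a) ^ m) = c"
  by (induction m) (simp_all add: power_mult power_card)

text \<open>Otherwise the remainder \<open>?r\<close> would give the nonzero polynomial
  \<open>T^?r - 1\<close> with all \<open>CARD('a) - 1\<close> units as roots, more than its
  degree.\<close>

lemma power_eq_one_dvd:
  assumes "\<And>c :: 'a::{field,finite}. c \<noteq> 0 \<Longrightarrow> c ^ N = 1"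
  shows "CARD('a) - 1 dvd N"
proof (rule ccontr)
  let ?r = "N mod (CARD('a) - 1)"
  assume "\<not> CARD('a) - 1 dvd N"
  then have r: "0 < ?r" by (simp add: mod_greater_zero_iff_not_dvd)
  have "0 < CARD('a) - 1" using card_field_gt_1[where 'a = 'a] by simp
  then have lt: "?r < CARD('a) - 1" by simp
  define P where "P = Polynomial.monom 1 ?r - (1 :: 'a poly)"
  have "poly.coeff P ?r = 1" using r by (simp add: P_def)
  then have "P \<noteq> 0" by auto
  have "c ^ ?r = 1" if "c \<noteq> 0" for c :: 'a
  proof -
    have "c ^ N = c ^ ((CARD('a) - 1) * (N div (CARD('a) - 1)) + ?r)" by simp
    then show ?thesis
      using assms[OF that] power_card_minus_one[OF that] by (simp only: power_add power_mult power_one mult_1)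
  qed
  then have "UNIV - {0} \<subseteq> {x. poly P x = 0}" by (auto simp: P_def poly_monom)
  then have "CARD('a) - 1 \<le> card {x. poly P x = 0}"
    using card_mono[of "{x. poly P x = 0}" "UNIV - {0}"] by simp
  also have "\<dots> \<le> degree P" by (rule card_poly_roots_bound[OF \<open>P \<noteq> 0\<close>])
  also have "\<dots> \<le> ?r" unfolding P_def by (rule degree_diff_le) (simp_all add: degree_monom_le)
  finally show False using lt by simp
qed

text \<open>The Frobenius map is additive because \<open>p\<close> is the characteristic of the
  polynomial ring.\<close>

lemma mpoly_power_card_sum:
  fixes f :: "'i \<Rightarrow> 'a::{field,finite} mpoly"
  assumes "prime p" "CARD('a) = p ^ r"
  shows "(\<Sum>i\<in>A. f i) ^ (CARD('a) ^ m) = (\<Sum>i\<in>A. f i ^ (CARD('a) ^ m))"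
proof -
  \<comment> \<open>Shifting by \<open>1\<close> permutes the field, so \<open>1\<close> summed over
    all elements is zero.\<close>
  have "(\<Sum>x\<in>UNIV. x) = (\<Sum>x\<in>UNIV. x + 1 :: 'a)"
    by (rule sum.reindex_bij_witness[of _ "\<lambda>x. x + 1" "\<lambda>x. x - 1"]) auto
  then have "of_nat (CARD('a)) = (0 :: 'a)" by (simp add: sum.distrib)
  then have "of_nat p = (0 :: 'a)" using assms(2) by simp
  then have "of_nat p = (0 :: 'a mpoly)" by (metis single_of_nat single_zero)
  then have "CHAR('a mpoly) dvd p" by (simp add: of_nat_eq_0_iff_char_dvd)
  moreover have "CHAR('a mpoly) \<noteq> 1" by simp
  ultimately have char: "CHAR('a mpoly) = p"
    using assms(1) by (metis prime_nat_iff)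
  have "CARD('a) ^ m = CHAR('a mpoly) ^ (r * m)" by (simp add: char assms(2) power_mult)
  then show ?thesis using assms(1) char by (intro freshmans_dream_sum') auto
qed

text \<open>The homogeneous form of the factorisation of \<open>T^q - T\<close> over the field with
  \<open>q\<close> elements. Both sides are monic of degree \<open>q\<close> in \<open>f\<close> and
  agree at the points \<open>const_poly c * h\<close>, which are \<open>q\<close> distinct points
  only if \<open>h\<close> is nonzero.\<close>

lemma prod_linear_factors:
  fixes f h :: "'a::{field,finite} mpoly"
  shows "(\<Prod>c\<in>UNIV. f - const_poly c * h) = f ^ CARD('a) - h ^ (CARD('a) - 1) * f"
proof (cases "h = 0")
  case True
  then show ?thesis using card_field_gt_1[where 'a = 'a] by (simp add: power_0_left)
next
  case False
  let ?q = "CARD('a)"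
  define P where "P = (\<Prod>c\<in>UNIV. [:- (const_poly (c::'a) * h), 1:])"
  define Q where "Q = Polynomial.monom 1 ?q - [:0, h ^ (?q - 1):]"
  have q: "1 < ?q" by (rule card_field_gt_1)
  have degP: "degree P = ?q" unfolding P_def by (subst degree_prod_eq_sum_degree) auto
  have "lead_coeff P = 1" unfolding P_def by (simp add: lead_coeff_prod)
  then have coeffP: "poly.coeff P ?q = 1" by (simp add: degP)
  have coeffQ: "poly.coeff Q ?q = 1" using q by (simp add: Q_def coeff_pCons split: nat.split)
  have degQ: "degree Q \<le> ?q" unfolding Q_def
    by (rule degree_diff_le) (use q in \<open>simp_all add: degree_monom_le\<close>)
  let ?A = "range (\<lambda>c::'a. const_poly c * h)"
  have "card ?A = ?q" by (rule card_image) (use False in \<open>auto simp: inj_on_def\<close>)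
  moreover have "poly P x = poly Q x" if x_in: "x \<in> ?A" for x
  proof -
    obtain c :: 'a where x: "x = const_poly c * h" using x_in by blast
    have "poly P x = 0" unfolding P_def poly_prod by (rule prod_zero) (use x in auto)
    have "const_poly c ^ ?q = const_poly c" by (simp add: const_poly_power[symmetric] power_card)
    moreover have "h ^ (?q - 1) * h = h ^ ?q" using q by (intro power_minus_mult) simp
    moreover have "poly Q x = const_poly c ^ ?q * h ^ ?q - const_poly c * (h ^ (?q - 1) * h)"
      unfolding Q_def x by (simp only: poly_diff poly_monom poly_pCons poly_0 power_mult_distrib mult_ac mult_1_left
          mult_zero_right mult_zero_left add_0_right add_0_left)
    ultimately have "poly Q x = 0" by (simp only: diff_self)
    then show ?thesis using \<open>poly P x = 0\<close> by simp
  qed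
  ultimately have "P = Q"
    using coeffP coeffQ degP degQ by (intro poly_eqI_degree_lead_coeff[of _ ?q _ ?A]) auto
  then have "poly P f = poly Q f" by simp
  then show ?thesis by (simp add: P_def Q_def poly_prod poly_monom mult.commute)
qed


subsection \<open>Dickson polynomials\<close>

text \<open>\<open>dickson a\<close> is the additive polynomial whose roots are the linear forms in the first
  \<open>a\<close> variables; the recursion makes additivity evident, see \<open>dickson_eq_prod\<close> for the roots.\<close>

fun dickson :: "nat \<Rightarrow> 'a::{field,finite} mpoly \<Rightarrow> 'a mpoly" where
  "dickson 0 f = f"
| "dickson (Suc a) f = dickson a f ^ CARD('a) - dickson a (X a) ^ (CARD('a) - 1) * dickson a f"

lemma dvd_dickson: "f dvd dickson a f"
proof (induction a)
  case (Suc a)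
  have "f dvd dickson a f ^ CARD('a)"
    by (rule dvd_trans[OF Suc], rule dvd_power) auto
  then show ?case using Suc by (simp add: dvd_diff)
qed simp

text \<open>The coefficient subtracted at \<open>Suc a\<close> is the one that makes
  \<open>X a\<close> a root; earlier roots persist.\<close>

lemma dickson_vanishes: "i < a \<Longrightarrow> dickson a (X i :: 'a::{field,finite} mpoly) = 0"
proof (induction a)
  case (Suc a)
  show ?case
  proof (cases "i = a")
    case True
    have "dickson a (X a :: 'a mpoly) ^ CARD('a) = dickson a (X a) ^ (CARD('a) - 1) * dickson a (X a)"
      by (metis finite_UNIV_card_ge_0 finite power_minus_mult)
    then show ?thesis using True by simp
  next
    case False
    then show ?thesis using Suc by simp
  qed
qed simp

lemma dickson_closed: "a \<le> n \<Longrightarrow> f \<in> sym_algebra n \<Longrightarrow> dickson a f \<in> sym_algebra n"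
  by (induction a arbitrary: f)
     (simp_all add: sym_algebra_diff sym_algebra_power sym_algebra_mult sym_algebra_X)

lemma const_poly_power_card: "const_poly (c :: 'a::{field,finite}) ^ (CARD('a) ^ m) = const_poly c"
  by (simp add: const_poly_power[symmetric] power_card_power)

lemma dickson_scale:
  "dickson a (const_poly c * f) = const_poly c * dickson a (f :: 'a::{field,finite} mpoly)"
proof (induction a)
  case (Suc a)
  then show ?case
    using const_poly_power_card[of c 1]
    by (simp add: power_mult_distrib right_diff_distrib mult.left_commute)
qed simp

lemma dickson_sum:
  fixes f :: "'i \<Rightarrow> 'a::{field,finite} mpoly"
  assumes "prime p" "CARD('a) = p ^ r"
  shows "dickson a (\<Sum>i\<in>A. f i) = (\<Sum>i\<in>A. dickson a (f i))"
proof (induction a)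
  case (Suc a)
  then show ?case
    using mpoly_power_card_sum[OF assms, of "\<lambda>i. dickson a (f i)" A 1]
    by (simp add: sum_subtractf sum_distrib_left)
qed simp

lemma dickson_diff:
  fixes f h :: "'a::{field,finite} mpoly"
  assumes "prime p" "CARD('a) = p ^ r"
  shows "dickson a (f - h) = dickson a f - dickson a h"
proof -
  have "dickson a ((f - h) + h) = dickson a (f - h) + dickson a h"
    using dickson_sum[OF assms, where A = "UNIV :: bool set" and a = a and f = "\<lambda>b. if b then f - h else h"]
    by (simp add: UNIV_bool add.commute)
  then show ?thesis by simp
qed

text \<open>The \<open>q\<close>-th power shifts the expansion by one place, and the subtracted
  multiple has lower degree, so the leading coefficient stays \<open>1\<close>. Used with
  \<open>a = 0\<close> for the Moore determinant and with a block start \<open>a\<close> for the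
  equivariant rows.\<close>

lemma dickson_expansion:
  assumes "prime p" "CARD('a::{field,finite}) = p ^ r"
  shows "\<exists>c. c s = 1 \<and> (\<forall>f :: 'a mpoly. dickson (a + s) f = (\<Sum>t\<le>s. c t * dickson a f ^ (CARD('a) ^ t)))"
proof (induction s)
  case 0
  show ?case by (rule exI[of _ "\<lambda>_. 1"]) simp
next
  case (Suc s)
  let ?q = "CARD('a)"
  obtain c where c: "c s = 1" "\<And>f :: 'a mpoly. dickson (a + s) f = (\<Sum>t\<le>s. c t * dickson a f ^ (?q ^ t))"
    using Suc by blast
  define e where "e = dickson (a + s) (X (a + s) :: 'a mpoly) ^ (?q - 1)"
  \<comment> \<open>The \<open>case\<close> is the shift by the \<open>q\<close>-th power, the
    \<open>if\<close> the multiple subtracted in the recursion.\<close>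
  define c' where "c' t = (case t of 0 \<Rightarrow> 0 | Suc t \<Rightarrow> c t ^ ?q) - (if t \<le> s then e * c t else 0)" for t
  have "dickson (a + Suc s) f = (\<Sum>t\<le>Suc s. c' t * dickson a f ^ (?q ^ t))" for f :: "'a mpoly"
  proof -
    let ?d = "dickson a f"
    have "(\<Sum>t\<le>s. c t * ?d ^ (?q ^ t)) ^ ?q = (\<Sum>t\<le>s. (c t * ?d ^ (?q ^ t)) ^ ?q)"
      using mpoly_power_card_sum[OF assms, of "\<lambda>t. c t * ?d ^ (?q ^ t)" "{..s}" 1] by simp
    also have "\<dots> = (\<Sum>t\<le>s. c t ^ ?q * ?d ^ (?q ^ Suc t))"
      by (simp add: power_mult_distrib power_mult[symmetric] mult.commute)
    also have "\<dots> = (\<Sum>t\<le>Suc s. (case t of 0 \<Rightarrow> 0 | Suc t \<Rightarrow> c t ^ ?q) * ?d ^ (?q ^ t))"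
      by (subst sum.atMost_Suc_shift) simp
    finally have 1: "(\<Sum>t\<le>s. c t * ?d ^ (?q ^ t)) ^ ?q
        = (\<Sum>t\<le>Suc s. (case t of 0 \<Rightarrow> 0 | Suc t \<Rightarrow> c t ^ ?q) * ?d ^ (?q ^ t))" .
    have 2: "e * (\<Sum>t\<le>s. c t * ?d ^ (?q ^ t))
        = (\<Sum>t\<le>Suc s. (if t \<le> s then e * c t else 0) * ?d ^ (?q ^ t))"
      by (simp add: sum_distrib_left mult.assoc)
    have "dickson (a + Suc s) f = (\<Sum>t\<le>s. c t * ?d ^ (?q ^ t)) ^ ?q - e * (\<Sum>t\<le>s. c t * ?d ^ (?q ^ t))"
      by (simp add: c(2)[symmetric] e_def)
    then show ?thesis unfolding 1 2 c'_def left_diff_distrib sum_subtractf .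
  qed
  moreover have "c' (Suc s) = 1" by (simp add: c'_def c(1))
  ultimately show ?case by blast
qed

definition forms_upto :: "nat \<Rightarrow> nat \<Rightarrow> 'a::field mpoly set" where
  "forms_upto n a = {lin n u | u. \<forall>k\<ge>a. u k = 0}"

lemma X_eq_lin: "i < n \<Longrightarrow> X i = lin n (\<lambda>k. if k = i then 1 else 0)"
  by (simp add: lin_unit)

lemma forms_upto_0: "forms_upto n 0 = {0}"
proof -
  have "lin n u = 0" if "\<forall>k\<ge>0. u k = 0" for u :: "nat \<Rightarrow> 'a" using that by (simp add: lin_eq_0_iff)
  then show ?thesis unfolding forms_upto_def by (auto intro: exI[of _ "\<lambda>_. 0"])
qed

lemma forms_upto_Suc:
  assumes "a < n"
  shows "bij_betw (\<lambda>(c, v). const_poly c * X a + v) (UNIV \<times> forms_upto n a)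
    (forms_upto n (Suc a) :: 'a::field mpoly set)"
proof -
  have eq: "const_poly c * X a + lin n u = lin n (\<lambda>k. (if k = a then c else 0) + u k)" for c and u :: "nat \<Rightarrow> 'a"
    using assms by (simp add: lin_unit[symmetric] lin_add)
  show ?thesis
  proof (rule bij_betwI')
    fix x y :: "'a \<times> 'a mpoly"
    assume "x \<in> UNIV \<times> forms_upto n a" "y \<in> UNIV \<times> forms_upto n a"
    then obtain c u d w where x: "x = (c, lin n u)" "\<forall>k\<ge>a. u k = 0" and y: "y = (d, lin n w)" "\<forall>k\<ge>a. w k = 0"
      unfolding forms_upto_def by (cases x; cases y) auto
    show "((case x of (c, v) \<Rightarrow> const_poly c * X a + v) = (case y of (c, v) \<Rightarrow> const_poly c * X a + v)) = (x = y)"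
    proof
      assume "(case x of (c, v) \<Rightarrow> const_poly c * X a + v) = (case y of (c, v) \<Rightarrow> const_poly c * X a + v)"
      then have "\<forall>k<n. (if k = a then c else 0) + u k = (if k = a then d else 0) + w k"
        by (simp add: x y eq lin_eq_iff)
      then have "c = d" "\<forall>k<n. u k = w k"
        using assms x(2) y(2) by (metis add_cancel_right_right le_refl add_0)+
      then show "x = y" by (simp add: x y lin_eq_iff)
    qed simp
  next
    fix x :: "'a \<times> 'a mpoly"
    assume "x \<in> UNIV \<times> forms_upto n a"
    then obtain c u where "x = (c, lin n u)" "\<forall>k\<ge>a. u k = 0"
      unfolding forms_upto_def by (cases x) auto
    then show "(case x of (c, v) \<Rightarrow> const_poly c * X a + v) \<in> forms_upto n (Suc a)"
      unfolding forms_upto_def by (auto simp: eq)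
  next
    fix y :: "'a mpoly"
    assume "y \<in> forms_upto n (Suc a)"
    then obtain u where u: "y = lin n u" "\<forall>k\<ge>Suc a. u k = 0" unfolding forms_upto_def by auto
    have "y = const_poly (u a) * X a + lin n (\<lambda>k. if k < a then u k else 0)"
      unfolding eq u(1) by (rule lin_cong) (use u(2) in \<open>auto simp: not_less Suc_le_eq dest: le_neq_implies_less\<close>)
    moreover have "lin n (\<lambda>k. if k < a then u k else 0) \<in> forms_upto n a"
      unfolding forms_upto_def by (auto intro!: exI[of _ "\<lambda>k. if k < a then u k else 0"])
    ultimately show "\<exists>x\<in>UNIV \<times> forms_upto n a. y = (case x of (c, v) \<Rightarrow> const_poly c * X a + v)"
      by (intro bexI[of _ "(u a, lin n (\<lambda>k. if k < a then u k else 0))"]) auto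
  qed
qed

lemma finite_forms_upto: "a \<le> n \<Longrightarrow> finite (forms_upto n a :: 'a::{field,finite} mpoly set)"
proof (induction a)
  case (Suc a)
  then show ?case using bij_betw_finite[OF forms_upto_Suc[of a n, where 'a = 'a]] by simp
qed (simp add: forms_upto_0)

text \<open>Group the roots by their coefficient \<open>c\<close> at \<open>X a\<close>. By
  induction and additivity each group contributes
  \<open>dickson a f - const_poly c * dickson a (X a)\<close>, and
  \<open>prod_linear_factors\<close> multiplies these up to the recursion.\<close>

lemma dickson_eq_prod:
  fixes f :: "'a::{field,finite} mpoly"
  assumes "prime p" "CARD('a) = p ^ r" "a \<le> n"
  shows "dickson a f = (\<Prod>v\<in>forms_upto n a. f - v)"
  using assms(3)
proof (induction a arbitrary: f)
  case (Suc a)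
  have "(\<Prod>v\<in>forms_upto n (Suc a). f - v)
      = (\<Prod>x\<in>UNIV \<times> forms_upto n a. f - (case x of (c, v) \<Rightarrow> const_poly c * X a + v))"
    using Suc.prems by (intro prod.reindex_bij_betw[OF forms_upto_Suc, symmetric]) auto
  also have "\<dots> = (\<Prod>(c, v)\<in>UNIV \<times> forms_upto n a. (f - const_poly c * X a) - v)"
    by (rule prod.cong) (auto simp: diff_diff_eq)
  also have "\<dots> = (\<Prod>c\<in>UNIV. \<Prod>v\<in>forms_upto n a. (f - const_poly c * X a) - v)"
    by (rule prod.cartesian_product[symmetric])
  also have "\<dots> = (\<Prod>c\<in>UNIV. dickson a f - const_poly c * dickson a (X a))"
    using Suc by (simp add: dickson_diff[OF assms(1,2)] dickson_scale del: Suc.IH flip: Suc.IH)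
  finally show ?case by (simp add: prod_linear_factors)
qed (simp add: forms_upto_0)

lemma sym_act_sym_act_lin:
  assumes "g \<in> carrier_mat n n" "h \<in> carrier_mat n n" "h * g = 1\<^sub>m n"
  shows "sym_act n h (sym_act n g (lin n u)) = lin n u"
proof -
  have "(\<Sum>j<n. h $$ (l, j) * (\<Sum>i<n. g $$ (j, i) * u i)) = u l" if "l < n" for l
  proof -
    have "(\<Sum>j<n. h $$ (l, j) * (\<Sum>i<n. g $$ (j, i) * u i))
        = (\<Sum>i<n. (\<Sum>j<n. h $$ (l, j) * g $$ (j, i)) * u i)"
      unfolding sum_distrib_left sum_distrib_right by (subst sum.swap) (simp add: mult.assoc)
    also have "\<dots> = (\<Sum>i<n. (h * g) $$ (l, i) * u i)"
    proof (rule sum.cong[OF refl])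
      fix i assume "i \<in> {..<n}"
      then have "(h * g) $$ (l, i) = (\<Sum>j<n. h $$ (l, j) * g $$ (j, i))"
        using assms(1,2) that by (simp add: scalar_prod_def atLeast0LessThan)
      then show "(\<Sum>j<n. h $$ (l, j) * g $$ (j, i)) * u i = (h * g) $$ (l, i) * u i" by simp
    qed
    also have "\<dots> = (\<Sum>i<n. if i = l then u i else 0)"
      unfolding assms(3) by (rule sum.cong[OF refl]) (use that in auto)
    finally show ?thesis using that by simp
  qed
  then show ?thesis unfolding sym_act_lin by (intro lin_cong) simp
qed

text \<open>The vanishing entries make \<open>g\<close> map the roots, the forms in the first
  \<open>a\<close> variables, to themselves; being injective on a finite set, it permutes
  them.\<close>

lemma sym_act_dickson:
  fixes f :: "'a::{field,finite} mpoly"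
  assumes "prime p" "CARD('a) = p ^ r" "a \<le> n"
    and "g \<in> carrier_mat n n" "h \<in> carrier_mat n n" "h * g = 1\<^sub>m n"
    and zero: "\<And>k j. j < a \<Longrightarrow> a \<le> k \<Longrightarrow> k < n \<Longrightarrow> g $$ (k, j) = 0"
  shows "sym_act n g (dickson a f) = dickson a (sym_act n g f)"
proof -
  let ?V = "forms_upto n a :: 'a mpoly set"
  have inj: "inj_on (sym_act n g) ?V"
    by (rule inj_on_inverseI[of _ "sym_act n h"])
       (auto simp: forms_upto_def sym_act_sym_act_lin[OF assms(4,5,6)])
  have "sym_act n g ` ?V \<subseteq> ?V"
  proof
    fix w assume "w \<in> sym_act n g ` ?V"
    then obtain u where u: "w = sym_act n g (lin n u)" "\<forall>k\<ge>a. u k = 0" by (auto simp: forms_upto_def)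
    let ?u = "\<lambda>k. if k < a then \<Sum>j<n. g $$ (k, j) * u j else 0"
    have "(\<Sum>j<n. g $$ (k, j) * u j) = 0" if "a \<le> k" "k < n" for k
      by (rule sum.neutral) (metis mult_zero_left mult_zero_right not_le that u(2) zero)
    then have "w = lin n ?u" unfolding u(1) sym_act_lin by (intro lin_cong) simp
    then show "w \<in> ?V" unfolding forms_upto_def by (auto intro!: exI[of _ ?u])
  qed
  then have img: "sym_act n g ` ?V = ?V"
    using endo_inj_surj[OF finite_forms_upto[OF assms(3)] _ inj] by blast
  have "sym_act n g (dickson a f) = (\<Prod>v\<in>?V. sym_act n g f - sym_act n g v)"
    by (simp add: dickson_eq_prod[OF assms(1-3)] sym_act_prod sym_act_diff)
  also have "\<dots> = (\<Prod>v\<in>sym_act n g ` ?V. sym_act n g f - v)"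
    by (simp add: prod.reindex[OF inj])
  finally show ?thesis by (simp add: img dickson_eq_prod[OF assms(1-3)])
qed

text \<open>This is \<open>L\<^sub>m\<close>: every line of forms has one representative
  \<open>X a - v\<close> with \<open>v\<close> in the earlier variables, and
  \<open>dickson a (X a)\<close> collects those with fixed \<open>a\<close>.\<close>

definition form_prod :: "nat \<Rightarrow> 'a::{field,finite} mpoly" where
  "form_prod m = (\<Prod>a<m. dickson a (X a))"

lemma form_prod_closed: "m \<le> n \<Longrightarrow> form_prod m \<in> sym_algebra n"
  unfolding form_prod_def by (intro sym_algebra_prod dickson_closed sym_algebra_X) auto

lemma form_prod_eq:
  assumes "prime p" "CARD('a::{field,finite}) = p ^ r" "m \<le> n"
  shows "form_prod m = (\<Prod>(a, v)\<in>(SIGMA a:{..<m}. forms_upto n a). X a - (v :: 'a mpoly))"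
proof -
  have "form_prod m = (\<Prod>a<m. \<Prod>v\<in>forms_upto n a. X a - (v :: 'a mpoly))"
    unfolding form_prod_def
    by (rule prod.cong) (use assms in \<open>auto simp: dickson_eq_prod[OF assms(1,2), of _ n]\<close>)
  then show ?thesis by (subst prod.Sigma[symmetric]) (use assms in \<open>auto intro!: finite_forms_upto\<close>)
qed


subsection \<open>Matrices that change a single column\<close>

text \<open>One family covers scalings and transvections of \<open>X j\<close>, for
  \<open>u j \<noteq> 0\<close>, and the singular substitution of a form in the other variables for
  \<open>X j\<close>, for \<open>u j = 0\<close>.\<close>

definition col_mat :: "nat \<Rightarrow> nat \<Rightarrow> (nat \<Rightarrow> 'a::field) \<Rightarrow> 'a mat" where
  "col_mat n j u = mat n n (\<lambda>(k, i). if i = j then u k else if k = i then 1 else 0)"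

lemma col_mat_carrier [simp]: "col_mat n j u \<in> carrier_mat n n"
  by (simp add: col_mat_def)

lemma col_mat_index:
  "k < n \<Longrightarrow> i < n \<Longrightarrow> col_mat n j u $$ (k, i) = (if i = j then u k else if k = i then 1 else 0)"
  by (simp add: col_mat_def)

lemma sym_col_col_mat: "i < n \<Longrightarrow> sym_col n (col_mat n j u) i = (if i = j then lin n u else X i)"
  unfolding sym_col_eq_lin by (auto simp: X_eq_lin col_mat_index intro!: lin_cong)

lemma sym_act_col_mat_lin:
  assumes "j < n"
  shows "sym_act n (col_mat n j u) (lin n w) = lin n (\<lambda>k. w j * u k + (if k = j then 0 else w k))"
  unfolding sym_act_lin
proof (rule lin_cong)
  fix k assume k: "k < n"
  have "(\<Sum>i<n. col_mat n j u $$ (k, i) * w i)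
      = u k * w j + (\<Sum>i\<in>{..<n} - {j}. col_mat n j u $$ (k, i) * w i)"
    by (subst sum.remove[of _ j]) (use assms k in \<open>auto simp: col_mat_index\<close>)
  also have "(\<Sum>i\<in>{..<n} - {j}. col_mat n j u $$ (k, i) * w i)
      = (\<Sum>i\<in>{..<n} - {j}. if i = k then w k else 0)"
    by (rule sum.cong) (use k in \<open>auto simp: col_mat_index\<close>)
  finally have "(\<Sum>i<n. col_mat n j u $$ (k, i) * w i)
      = u k * w j + (\<Sum>i\<in>{..<n} - {j}. if i = k then w k else 0)" .
  then show "(\<Sum>i<n. col_mat n j u $$ (k, i) * w i) = w j * u k + (if k = j then 0 else w k)"
    using k by (simp add: mult.commute)
qed

text \<open>Acting by this matrix substitutes \<open>lin n u\<close> for \<open>X j\<close>, which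
  changes nothing modulo the difference of the two.\<close>

lemma sym_act_col_mat_dvd:
  assumes "j < n" "f \<in> sym_algebra n"
  shows "X j - lin n u dvd f - sym_act n (col_mat n j u) f"
proof -
  have one: "1\<^sub>m n = col_mat n j (\<lambda>k. if k = j then 1 else 0 :: 'a)"
    by (rule eq_matI) (auto simp: col_mat_def)
  have "X j - lin n u dvd sym_act n (1\<^sub>m n) f - sym_act n (col_mat n j u) f"
    by (rule sym_act_dvd_diff) (simp add: one sym_col_col_mat X_eq_lin[OF assms(1), symmetric])
  then show ?thesis using assms(2) by (simp add: sym_act_one)
qed


subsection \<open>Divisibility by products of linear forms\<close>

text \<open>A form \<open>l = x\<^sub>a - v\<close> is prime because substituting \<open>v\<close> for \<open>x\<^sub>a\<close> is a
  homomorphism to a domain with kernel generated by \<open>l\<close>.\<close>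

lemma form_power_dvd_cancel:
  assumes l: "l \<in> sym_algebra n" "l \<noteq> 0" "sym_act n S l = 0"
      "\<And>f. f \<in> sym_algebra n \<Longrightarrow> l dvd f - sym_act n S f"
    and P: "sym_act n S P \<noteq> 0" and R: "R \<in> sym_algebra n"
    and "l ^ e dvd P * R"
  shows "l ^ e dvd R"
  using assms(7)
proof (induction e)
  case (Suc e)
  \<comment> \<open>Strip off the factors known by induction; it remains to divide the cofactor
    \<open>R'\<close> by \<open>l\<close> once more.\<close>
  then have "l ^ e dvd R" by (metis dvd_trans le_imp_power_dvd le_SucI order_refl)
  then obtain R' where R': "R = l ^ e * R'" by (rule dvdE)
  then have "R' \<in> sym_algebra n"
    using sym_algebra_cancel[of "l ^ e" R' n] R l by (auto intro: sym_algebra_power)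
  obtain s where "P * R = l ^ Suc e * s" using Suc.prems by (rule dvdE)
  then have "l ^ e * (P * R') = l ^ e * (l * s)" by (simp add: R' mult_ac)
  then have "P * R' = l * s" using l(2) by simp
  then have "sym_act n S P * sym_act n S R' = 0" using l(3) by (metis mult_zero_left sym_act_mult)
  then have "sym_act n S R' = 0" using P by simp
  then have "l dvd R'" using l(4)[OF \<open>R' \<in> sym_algebra n\<close>] by simp
  then show ?case by (simp add: R' mult_dvd_mono mult.commute)
qed simp

lemma form_indexE:
  assumes "i \<in> (SIGMA a:{..<m}. forms_upto n a)"
  obtains a u where "i = (a, lin n u)" "a < m" "\<forall>k\<ge>a. u k = 0"
  using assms by (auto simp: forms_upto_def)

text \<open>The substitution that kills one of the forms kills none of the others, so their powers
  can be split off one at a time by \<open>form_power_dvd_cancel\<close>.\<close>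

lemma form_prod_power_dvd:
  fixes h :: "'a::{field,finite} mpoly"
  assumes "prime p" "CARD('a) = p ^ r" "m \<le> n" "h \<in> sym_algebra n"
    and dvd: "\<And>a v. a < m \<Longrightarrow> v \<in> forms_upto n a \<Longrightarrow> (X a - v) ^ e dvd h"
  shows "form_prod m ^ e dvd h"
proof -
  let ?T = "SIGMA a:{..<m}. (forms_upto n a :: 'a mpoly set)"
  let ?l = "\<lambda>(a, v). X a - v :: 'a mpoly"
  have finite: "finite ?T" using assms(3) by (intro finite_SigmaI finite_forms_upto) auto
  have closed: "?l i \<in> sym_algebra n" if "i \<in> ?T" for i
    using that assms(3) by (auto simp: forms_upto_def intro!: sym_algebra_diff sym_algebra_X sym_algebra_lin)
  have sub: "\<exists>S. sym_act n S (?l i) = 0 \<and> (\<forall>f\<in>sym_algebra n. ?l i dvd f - sym_act n S f) \<and>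
      (\<forall>j\<in>?T. j \<noteq> i \<longrightarrow> sym_act n S (?l j) \<noteq> 0)" if i_in: "i \<in> ?T" for i
  proof -
    obtain a u where i: "i = (a, lin n u)" and a: "a < m" "a < n" and u: "\<forall>k\<ge>a. u k = 0"
      using form_indexE[OF i_in] assms(3) by (metis less_le_trans)
    have act: "sym_act n (col_mat n a u) (X b - lin n w)
        = lin n (\<lambda>k. ((if a = b then 1 else 0) - w a) * u k +
          (if k = a then 0 else (if k = b then 1 else 0) - w k))" if "b < n" for b w
      unfolding X_eq_lin[OF that] lin_diff sym_act_col_mat_lin[OF a(2)] by simp
    have "sym_act n (col_mat n a u) (?l i) = 0"
      unfolding i prod.case act[OF a(2)] lin_eq_0_iff using u by auto
    moreover have "?l i dvd f - sym_act n (col_mat n a u) f" if "f \<in> sym_algebra n" for f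
      unfolding i prod.case by (rule sym_act_col_mat_dvd[OF a(2) that])
    moreover have "sym_act n (col_mat n a u) (?l j) \<noteq> 0" if "j \<in> ?T" "j \<noteq> i" for j
    proof
      assume zero: "sym_act n (col_mat n a u) (?l j) = 0"
      obtain b w where j: "j = (b, lin n w)" and b: "b < m" "b < n" and w: "\<forall>k\<ge>b. w k = 0"
        using form_indexE[OF \<open>j \<in> ?T\<close>] assms(3) by (metis less_le_trans)
      have eq: "((if a = b then 1 else 0) - w a) * u k +
          (if k = a then 0 else (if k = b then 1 else 0) - w k) = 0" if "k < n" for k
        using zero that unfolding j prod.case act[OF b(2)] lin_eq_0_iff by blast
      have "a = b"
      proof (rule ccontr)
        assume "a \<noteq> b"
        \<comment> \<open>The coefficient at \<open>X b\<close> forces \<open>u b\<close> and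
          \<open>w a\<close> to be nonzero, so each of \<open>a\<close> and \<open>b\<close> would
          be smaller than the other.\<close>
        then have *: "w a * u b = 1" using eq[OF b(2)] w by auto
        then have "u b \<noteq> 0" "w a \<noteq> 0" by auto
        then have "b < a" "a < b" using u w by (metis not_le)+
        then show False by simp
      qed
      moreover have "u k = w k" if "k < n" for k
        using eq[OF that] u w \<open>a = b\<close> by (cases "k = a") auto
      then have "lin n u = lin n w" by (rule lin_cong)
      ultimately show False using \<open>j \<noteq> i\<close> i j by simp
    qed
    ultimately show ?thesis by blast
  qed
  have "(\<Prod>i\<in>A. ?l i) ^ e dvd h" if "A \<subseteq> ?T" "finite A" for A
    using that(2,1)
  proof (induction A rule: finite_induct)
    case (insert i A)
    have i: "i \<in> ?T" and A: "A \<subseteq> ?T" using insert.prems by simp_all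
    obtain R where R: "h = (\<Prod>i\<in>A. ?l i) ^ e * R" using insert.IH[OF A] by (rule dvdE)
    from sub[OF i] obtain S where S: "sym_act n S (?l i) = 0"
        "\<forall>f\<in>sym_algebra n. ?l i dvd f - sym_act n S f"
        "\<forall>j\<in>?T. j \<noteq> i \<longrightarrow> sym_act n S (?l j) \<noteq> 0"
      by (elim exE conjE)
    have ne: "?l j \<noteq> 0" if j_in: "j \<in> ?T" for j
    proof -
      obtain a u where "j = (a, lin n u)" "a < n" "\<forall>k\<ge>a. u k = 0"
        using form_indexE[OF j_in] assms(3) by (metis less_le_trans)
      then show ?thesis by (auto simp: X_eq_lin lin_diff lin_eq_0_iff intro!: exI[of _ a])
    qed
    have "\<forall>j\<in>A. sym_act n S (?l j) \<noteq> 0"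
    proof
      fix j assume "j \<in> A"
      then have "j \<in> ?T" "j \<noteq> i" using A insert.hyps by (rule_tac subsetD, simp_all) blast
      then show "sym_act n S (?l j) \<noteq> 0" by (rule mp[OF bspec[OF S(3)]])
    qed
    then have "(\<Prod>j\<in>A. sym_act n S (?l j)) ^ e \<noteq> 0"
      using insert.hyps(1) by (simp only: power_eq_0_iff prod_zero_iff) simp
    then have P: "sym_act n S ((\<Prod>i\<in>A. ?l i) ^ e) \<noteq> 0"
      by (simp only: sym_act_power sym_act_prod) simp
    have "(\<Prod>i\<in>A. ?l i) ^ e \<in> sym_algebra n"
      by (intro sym_algebra_power sym_algebra_prod closed) (rule subsetD[OF A])
    moreover have "\<forall>j\<in>A. ?l j \<noteq> 0"
      using ne A by (meson subsetD)
    then have "(\<Prod>i\<in>A. ?l i) ^ e \<noteq> 0"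
      using insert.hyps(1) by (simp only: power_eq_0_iff prod_zero_iff) simp
    ultimately have R_in: "R \<in> sym_algebra n"
      using sym_algebra_cancel[of "(\<Prod>i\<in>A. ?l i) ^ e" R n] assms(4) unfolding R by simp
    have dvd_i: "?l i ^ e dvd (\<Prod>i\<in>A. ?l i) ^ e * R"
      unfolding R[symmetric] using i dvd by (cases i) simp
    have "?l i ^ e dvd R"
      by (rule form_power_dvd_cancel[OF closed[OF i] ne[OF i] S(1) _ P R_in dvd_i]) (rule bspec[OF S(2)])
    then have "?l i ^ e * (\<Prod>i\<in>A. ?l i) ^ e dvd R * (\<Prod>i\<in>A. ?l i) ^ e"
      by (rule mult_dvd_mono) simp
    then show ?case
      unfolding R prod.insert[OF insert.hyps] power_mult_distrib by (simp only: mult.commute)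
  qed simp
  from this[OF order_refl finite] show ?thesis
    by (simp add: form_prod_eq[OF assms(1-3)])
qed

lemma form_prod_nonzero: "form_prod m \<noteq> (0 :: 'a::{field,finite} mpoly)"
  if "prime p" "CARD('a) = p ^ r"
proof -
  have "X a - v \<noteq> 0" if v: "v \<in> forms_upto m a" and "a < m" for a and v :: "'a mpoly"
  proof -
    obtain u where "v = lin m u" "\<forall>k\<ge>a. u k = 0" using v by (auto simp: forms_upto_def)
    then show ?thesis using \<open>a < m\<close> by (auto simp: X_eq_lin lin_diff lin_eq_0_iff intro!: exI[of _ a])
  qed
  moreover have "finite (SIGMA a:{..<m}. (forms_upto m a :: 'a mpoly set))"
    by (intro finite_SigmaI finite_forms_upto) auto
  ultimately show ?thesis
    by (subst form_prod_eq[OF that, of m m]) auto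
qed


subsection \<open>The Moore determinant\<close>

text \<open>Acting by \<open>g\<close> on the Moore matrix \<open>A\<close> multiplies it by
  \<open>g\<close> from the right, since Frobenius powers are additive and fix the field. The
  unitriangular \<open>Q\<close> turns \<open>A\<close> into the triangular \<open>T\<close>, whose
  diagonal product is \<open>form_prod n\<close>.\<close>

lemma sym_act_form_prod:
  fixes g :: "'a::{field,finite} mat"
  assumes "prime p" "CARD('a) = p ^ r" "g \<in> carrier_mat n n"
  shows "sym_act n g (form_prod n) = const_poly (det g) * form_prod n"
proof -
  let ?q = "CARD('a)"
  define A where "A = mat n n (\<lambda>(t, i). X i ^ (?q ^ t) :: 'a mpoly)"
  define T where "T = mat n n (\<lambda>(s, i). dickson s (X i) :: 'a mpoly)"
  have "\<forall>s. \<exists>c. c s = 1 \<and> (\<forall>f :: 'a mpoly. dickson s f = (\<Sum>t\<le>s. c t * f ^ (?q ^ t)))"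
    using dickson_expansion[OF assms(1,2), of _ 0] by simp
  then obtain c where c: "\<And>s. c s s = 1"
      "\<And>s (f :: 'a mpoly). dickson s f = (\<Sum>t\<le>s. c s t * f ^ (?q ^ t))"
    by metis
  define Q where "Q = mat n n (\<lambda>(s, t). if t \<le> s then c s t else 0)"
  have [simp]: "A \<in> carrier_mat n n" "T \<in> carrier_mat n n" "Q \<in> carrier_mat n n"
    by (simp_all add: A_def T_def Q_def)
  have "T = Q * A"
  proof (rule eq_matI)
    fix s i assume "s < dim_row (Q * A)" "i < dim_col (Q * A)"
    then have si: "s < n" "i < n" by (simp_all add: Q_def A_def)
    then have "(Q * A) $$ (s, i) = (\<Sum>t<n. (if t \<le> s then c s t else 0) * X i ^ (?q ^ t))"
      by (simp add: Q_def A_def times_mat_def scalar_prod_def atLeast0LessThan)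
    also have "\<dots> = (\<Sum>t\<le>s. c s t * X i ^ (?q ^ t))"
      by (rule sum.mono_neutral_cong_right) (use si in auto)
    finally show "T $$ (s, i) = (Q * A) $$ (s, i)" using si by (simp add: T_def c(2)[of s])
  qed (simp_all add: T_def Q_def A_def)
  moreover have "det Q = 1"
  proof -
    have "det Q = prod_list (diag_mat Q)"
      by (rule det_lower_triangular[of n]) (auto simp: Q_def)
    then show ?thesis by (simp add: prod_list_diag_prod Q_def c(1))
  qed
  moreover have "det T = form_prod n"
  proof -
    have "det T = prod_list (diag_mat T)"
      by (rule det_upper_triangular[of _ n]) (auto simp: T_def dickson_vanishes)
    then show ?thesis by (simp add: prod_list_diag_prod T_def form_prod_def atLeast0LessThan)
  qed
  ultimately have detA: "det A = form_prod n" by (simp add: det_mult[of Q n A])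
  interpret act: comm_ring_hom "sym_act n g"
    by unfold_locales (simp_all add: sym_act_mult sym_act_add)
  interpret const: comm_ring_hom "const_poly :: 'a \<Rightarrow> 'a mpoly"
    by unfold_locales (simp_all add: const_poly_mult const_poly_add)
  have "map_mat (sym_act n g) A = A * map_mat const_poly g"
  proof (rule eq_matI)
    fix t i assume "t < dim_row (A * map_mat const_poly g)" "i < dim_col (A * map_mat const_poly g)"
    then have ti: "t < n" "i < n" using assms(3) by (auto simp: A_def)
    then have "map_mat (sym_act n g) A $$ (t, i) = (\<Sum>k<n. const_poly (g $$ (k, i)) * X k) ^ (?q ^ t)"
      by (simp add: A_def sym_act_power sym_act_X sym_col_eq_lin lin_def)
    also have "\<dots> = (\<Sum>k<n. X k ^ (?q ^ t) * const_poly (g $$ (k, i)))"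
      by (simp add: mpoly_power_card_sum[OF assms(1,2)] power_mult_distrib const_poly_power_card mult.commute)
    also have "\<dots> = (A * map_mat const_poly g) $$ (t, i)"
      using ti assms(3) by (simp add: A_def times_mat_def scalar_prod_def atLeast0LessThan)
    finally show "map_mat (sym_act n g) A $$ (t, i) = (A * map_mat const_poly g) $$ (t, i)" .
  qed (use assms(3) in \<open>auto simp: A_def\<close>)
  then have "det (map_mat (sym_act n g) A) = det A * det (map_mat const_poly g :: 'a mpoly mat)"
    using assms(3) by (simp add: det_mult[of A n])
  then show ?thesis by (simp add: detA mult.commute)
qed


subsection \<open>Elements of the parabolic subgroup\<close>

text \<open>Cramer's rule for the identity matrix.\<close>

lemma det_col_mat:
  assumes "j < n"
  shows "det (col_mat n j u) = u j"
proof -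
  have "col_mat n j u = replace_col (1\<^sub>m n) (1\<^sub>m n *\<^sub>v vec n u) j"
    by (rule eq_matI) (auto simp: col_mat_def replace_col_def)
  then show ?thesis using cramer_lemma_mat[of "1\<^sub>m n" n "vec n u" j] assms by (simp only: one_carrier_mat) simp
qed

lemma col_mat_mult:
  assumes "j < n"
  shows "col_mat n j u * col_mat n j v = col_mat n j (\<lambda>k. v j * u k + (if k = j then 0 else v k))"
proof (rule eq_matI)
  fix k i assume "k < dim_row (col_mat n j (\<lambda>k. v j * u k + (if k = j then 0 else v k)))"
    "i < dim_col (col_mat n j (\<lambda>k. v j * u k + (if k = j then 0 else v k)))"
  then have ki: "k < n" "i < n" by (simp_all add: col_mat_def)
  let ?w = "\<lambda>l. if i = j then v l else if l = i then 1 else 0"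
  have "(col_mat n j u * col_mat n j v) $$ (k, i) = (\<Sum>l<n. col_mat n j u $$ (k, l) * ?w l)"
    using ki by (auto simp: scalar_prod_def atLeast0LessThan col_mat_def intro!: sum.cong)
  also have "\<dots> = u k * ?w j + (\<Sum>l\<in>{..<n} - {j}. col_mat n j u $$ (k, l) * ?w l)"
    using assms ki by (subst sum.remove[of _ j]) (auto simp: col_mat_index)
  also have "(\<Sum>l\<in>{..<n} - {j}. col_mat n j u $$ (k, l) * ?w l)
      = (\<Sum>l\<in>{..<n} - {j}. if l = k then ?w k else 0)"
    by (rule sum.cong) (use ki in \<open>auto simp: col_mat_index\<close>)
  finally show "(col_mat n j u * col_mat n j v) $$ (k, i) =
      col_mat n j (\<lambda>k. v j * u k + (if k = j then 0 else v k)) $$ (k, i)"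
    using ki assms by (auto simp: col_mat_index mult.commute)
qed (simp_all add: col_mat_def)

lemma col_mat_one: "col_mat n j (\<lambda>k. if k = j then 1 else 0) = 1\<^sub>m n"
  by (rule eq_matI) (auto simp: col_mat_def)

lemma col_mat_inverse:
  assumes "j < n" "u j \<noteq> 0"
  defines "v \<equiv> \<lambda>k. (if k = j then 1 else - u k) / u j"
  shows "col_mat n j u * col_mat n j v = 1\<^sub>m n" "col_mat n j v * col_mat n j u = 1\<^sub>m n"
proof -
  have 1: "(\<lambda>k. v j * u k + (if k = j then 0 else v k)) = (\<lambda>k. if k = j then 1 else 0)"
    using assms(2) by (auto simp: v_def fun_eq_iff)
  show "col_mat n j u * col_mat n j v = 1\<^sub>m n"
    unfolding col_mat_mult[OF assms(1)] 1 by (rule col_mat_one)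
  have 2: "(\<lambda>k. u j * v k + (if k = j then 0 else u k)) = (\<lambda>k. if k = j then 1 else 0)"
    using assms(2) by (auto simp: v_def fun_eq_iff)
  show "col_mat n j v * col_mat n j u = 1\<^sub>m n"
    unfolding col_mat_mult[OF assms(1)] 2 by (rule col_mat_one)
qed

lemma sum_list_take_Suc: "b < length I \<Longrightarrow> sum_list (take (Suc b) I) = sum_list (take b I) + I ! b"
  for I :: "nat list"
  by (simp add: take_Suc_conv_app_nth)

lemma sum_list_take_le: "sum_list (take b I) \<le> sum_list I" for I :: "nat list"
  by (metis append_take_drop_id le_add1 sum_list_append)

lemma block_upper_triangular_zero:
  assumes "g \<in> carrier_mat n n" "block_upper_triangular I g"
    and "b \<le> length I" "j < sum_list (take b I)" "sum_list (take b I) \<le> i" "i < n"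
  shows "g $$ (i, j) = 0"
proof -
  have "i < dim_row g" "j < dim_col g" using assms by auto
  then show ?thesis using assms(2-5) unfolding block_upper_triangular_def by blast
qed

text \<open>A product entry in the block only sees indices of the block: for smaller indices the
  entry of \<open>g\<close> vanishes, for larger ones that of \<open>h\<close>.\<close>

lemma diag_block_mult:
  assumes g: "g \<in> carrier_mat n n" "block_upper_triangular I g"
    and h: "h \<in> carrier_mat n n" "block_upper_triangular I h"
    and "sum_list I = n" "b < length I" "g * h = 1\<^sub>m n"
  shows "diag_block I b g * diag_block I b h = 1\<^sub>m (I ! b)"
proof (rule eq_matI)
  let ?o = "sum_list (take b I)" and ?m = "I ! b"
  have le: "?o + ?m \<le> n" using sum_list_take_Suc[OF assms(6)] sum_list_take_le[of "Suc b" I] assms(5) by simp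
  fix i j assume "i < dim_row (1\<^sub>m ?m)" "j < dim_col (1\<^sub>m ?m)"
  then have ij: "i < ?m" "j < ?m" by simp_all
  have "(diag_block I b g * diag_block I b h) $$ (i, j)
      = (\<Sum>l<?m. g $$ (?o + i, ?o + l) * h $$ (?o + l, ?o + j))"
    using ij by (auto simp: diag_block_def scalar_prod_def atLeast0LessThan intro!: sum.cong)
  also have "\<dots> = (\<Sum>l\<in>{?o..<?o + ?m}. g $$ (?o + i, l) * h $$ (l, ?o + j))"
    by (rule sum.reindex_bij_witness[of _ "\<lambda>l. l - ?o" "\<lambda>l. ?o + l"]) auto
  also have "\<dots> = (\<Sum>l<n. g $$ (?o + i, l) * h $$ (l, ?o + j))"
  proof (rule sum.mono_neutral_left)
    show "\<forall>l\<in>{..<n} - {?o..<?o + ?m}. g $$ (?o + i, l) * h $$ (l, ?o + j) = 0"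
    proof
      fix l assume l: "l \<in> {..<n} - {?o..<?o + ?m}"
      show "g $$ (?o + i, l) * h $$ (l, ?o + j) = 0"
      proof (cases "l < ?o")
        case True
        then have "g $$ (?o + i, l) = 0"
          using le ij assms(6) by (intro block_upper_triangular_zero[OF g, of b]) auto
        then show ?thesis by simp
      next
        case False
        then have "h $$ (l, ?o + j) = 0"
          using l ij assms(6) sum_list_take_Suc[OF assms(6)]
          by (intro block_upper_triangular_zero[OF h, of "Suc b"]) auto
        then show ?thesis by simp
      qed
    qed
  qed (use le in auto)
  also have "\<dots> = (g * h) $$ (?o + i, ?o + j)"
    using g(1) h(1) le ij by (simp add: scalar_prod_def atLeast0LessThan)
  also have "\<dots> = 1\<^sub>m ?m $$ (i, j)" using le ij by (simp add: assms(7))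
  finally show "(diag_block I b g * diag_block I b h) $$ (i, j) = 1\<^sub>m ?m $$ (i, j)" .
qed (simp_all add: diag_block_def)

text \<open>As the inverse is block triangular too, its diagonal blocks invert those of
  \<open>g\<close> by \<open>diag_block_mult\<close>.\<close>

lemma parabolicI:
  assumes "g \<in> carrier_mat n n" "h \<in> carrier_mat n n" "g * h = 1\<^sub>m n" "h * g = 1\<^sub>m n"
    and "block_upper_triangular I g" "block_upper_triangular I h" "sum_list I = n"
  shows "g \<in> parabolic n I"
proof -
  have "invertible_mat g"
    unfolding invertible_mat_def inverts_mat_def square_mat.simps using assms by auto
  moreover have "invertible_mat (diag_block I b g)" if "b < length I" for b
  proof -
    have "diag_block I b g * diag_block I b h = 1\<^sub>m (I ! b)" "diag_block I b h * diag_block I b g = 1\<^sub>m (I ! b)"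
      using assms that by (auto intro: diag_block_mult)
    then show ?thesis
      unfolding invertible_mat_def inverts_mat_def square_mat.simps
      by (auto simp: diag_block_def intro!: exI[of _ "diag_block I b h"])
  qed
  ultimately show ?thesis using assms by (auto simp: parabolic_def general_linear_def)
qed

lemma parabolicE:
  assumes "g \<in> parabolic n I"
  obtains h where "g \<in> carrier_mat n n" "h \<in> carrier_mat n n" "g * h = 1\<^sub>m n" "h * g = 1\<^sub>m n"
proof -
  have g: "g \<in> carrier_mat n n" "invertible_mat g"
    using assms by (auto simp: parabolic_def general_linear_def)
  then obtain h where h: "g * h = 1\<^sub>m n" "h * g = 1\<^sub>m (dim_row h)"
    unfolding invertible_mat_def inverts_mat_def by auto
  have "dim_col h = n" using arg_cong[OF h(1), of dim_col] by simp
  moreover have "dim_row h = n" using arg_cong[OF h(2), of dim_col] g(1) by simp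
  ultimately show ?thesis using that g(1) h by auto
qed

section \<open>The setting: the parabolic subgroup and the boundaries of its blocks\<close>

locale parabolic_invariants =
  fixes p r n k :: nat and I :: "nat list" and G :: "'a::{field,finite} mat set"
  assumes prime: "prime p" and card_field: "CARD('a) = p ^ r"
    and composition: "composition I n" and k_le: "k + 2 \<le> CARD('a)"
  defines "G \<equiv> parabolic n I"
begin

definition boundaries :: "nat set" where
  "boundaries = {sum_list (take b I) | b. b \<le> length I}"

lemma sum_list_I: "sum_list I = n"
  using composition by (simp add: composition_def)

lemma boundaries_le: "s \<in> boundaries \<Longrightarrow> s \<le> n"
  using sum_list_take_le[of _ I] by (auto simp: boundaries_def sum_list_I)

lemma finite_boundaries [simp]: "finite boundaries"
  by (rule finite_subset[of _ "{..n}"]) (auto dest: boundaries_le)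

lemma zero_boundary [simp]: "0 \<in> boundaries"
  unfolding boundaries_def by (auto intro!: exI[of _ 0])

lemma n_boundary [simp]: "n \<in> boundaries"
  unfolding boundaries_def by (auto intro!: exI[of _ "length I"] simp: sum_list_I)

lemma block_upper_triangular_iff:
  assumes "g \<in> carrier_mat n n"
  shows "block_upper_triangular I g \<longleftrightarrow>
    (\<forall>s\<in>boundaries. \<forall>i<n. \<forall>j<n. j < s \<and> s \<le> i \<longrightarrow> g $$ (i, j) = 0)"
  using assms by (auto simp: block_upper_triangular_def boundaries_def)

lemma G_zero: "g \<in> G \<Longrightarrow> s \<in> boundaries \<Longrightarrow> j < s \<Longrightarrow> s \<le> i \<Longrightarrow> i < n \<Longrightarrow> g $$ (i, j) = 0"
  using block_upper_triangular_iff[of g]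
  by (auto simp: G_def parabolic_def general_linear_def)

text \<open>The condition allows entries of column \<open>j\<close> only down to the end of the
  block of \<open>j\<close>; the inverse has the same shape.\<close>

lemma col_mat_in_G:
  assumes "j < n" "u j \<noteq> 0"
    and "\<And>s i. s \<in> boundaries \<Longrightarrow> j < s \<Longrightarrow> s \<le> i \<Longrightarrow> i < n \<Longrightarrow> u i = 0"
  shows "col_mat n j u \<in> G"
  unfolding G_def
proof (rule parabolicI)
  let ?v = "\<lambda>k. (if k = j then 1 else - u k) / u j"
  show "col_mat n j u * col_mat n j ?v = 1\<^sub>m n" "col_mat n j ?v * col_mat n j u = 1\<^sub>m n"
    using col_mat_inverse[of j n u, OF assms(1,2)] by auto
  show "block_upper_triangular I (col_mat n j u)" "block_upper_triangular I (col_mat n j ?v)"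
    using assms(3) by (auto simp: block_upper_triangular_iff col_mat_index)
qed (simp_all add: sum_list_I)

definition block_start :: "nat \<Rightarrow> nat" where
  "block_start s = Max {t \<in> boundaries. t \<le> s}"

lemma block_start: "block_start s \<in> boundaries" "block_start s \<le> s"
proof -
  have "block_start s \<in> {t \<in> boundaries. t \<le> s}"
    unfolding block_start_def by (rule Max_in) (auto intro: exI[of _ 0])
  then show "block_start s \<in> boundaries" "block_start s \<le> s" by auto
qed

lemma le_block_start: "t \<in> boundaries \<Longrightarrow> t \<le> s \<Longrightarrow> t \<le> block_start s"
  unfolding block_start_def by (rule Max_ge) auto

lemma block_start_eq: "block_start s \<le> t \<Longrightarrow> t \<le> s \<Longrightarrow> block_start t = block_start s"
  by (meson block_start le_block_start order_antisym order_trans)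


subsection \<open>Equivariant covectors\<close>

text \<open>The covector \<open>D\<^sub>s\<close>. A block start \<open>a\<close> yields one
  equivariant covector \<open>dickson a (X i)\<close>; its Frobenius powers provide one covector for
  each index of the block.\<close>

definition row :: "nat \<Rightarrow> nat \<Rightarrow> 'a mpoly" where
  "row s i = dickson (block_start s) (X i) ^ (CARD('a) ^ (s - block_start s))"

lemma row_closed: "s < n \<Longrightarrow> i < n \<Longrightarrow> row s i \<in> sym_algebra n"
  unfolding row_def using block_start(2)[of s]
  by (intro sym_algebra_power dickson_closed sym_algebra_X) auto

lemma row_zero: "i < block_start s \<Longrightarrow> row s i = 0"
  by (simp add: row_def dickson_vanishes)

lemma X_dvd_row: "X i dvd row s i"
  unfolding row_def by (rule dvd_trans[OF dvd_dickson], rule dvd_power) auto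

text \<open>Since \<open>block_start s\<close> is a boundary, \<open>sym_act_dickson\<close>
  applies; the rest is additivity and the fact that Frobenius powers fix the constants.\<close>

lemma sym_act_row:
  assumes "g \<in> G" "s < n" "j < n"
  shows "sym_act n g (row s j) = (\<Sum>k<n. const_poly (g $$ (k, j)) * row s k)"
proof -
  let ?m = "s - block_start s"
  obtain h where gh: "g \<in> carrier_mat n n" "h \<in> carrier_mat n n" "g * h = 1\<^sub>m n" "h * g = 1\<^sub>m n"
    using assms(1) unfolding G_def by (rule parabolicE)
  have "block_start s \<le> n" using block_start(2)[of s] assms(2) by simp
  then have "sym_act n g (dickson (block_start s) (X j)) = dickson (block_start s) (sym_act n g (X j))"
    using gh G_zero[OF assms(1) block_start(1)[of s]]
    by (intro sym_act_dickson[OF prime card_field]) auto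
  also have "\<dots> = (\<Sum>k<n. const_poly (g $$ (k, j)) * dickson (block_start s) (X k))"
    using assms(3) by (simp add: sym_act_X sym_col_eq_lin lin_def dickson_sum[OF prime card_field] dickson_scale)
  finally have "sym_act n g (row s j)
      = (\<Sum>k<n. const_poly (g $$ (k, j)) * dickson (block_start s) (X k)) ^ (CARD('a) ^ ?m)"
    by (simp add: row_def sym_act_power)
  also have "\<dots> = (\<Sum>k<n. const_poly (g $$ (k, j)) * row s k)"
    by (simp add: mpoly_power_card_sum[OF prime card_field] power_mult_distrib const_poly_power_card row_def)
  finally show ?thesis .
qed

text \<open>The triangular rows \<open>dickson s (X i)\<close> are not equivariant, but they differ from the equivariant
  ones by a unitriangular change of rows.\<close>

lemma dickson_row:
  "\<exists>c. c s = 1 \<and> (\<forall>i. dickson s (X i) = (\<Sum>t\<in>{block_start s..s}. c t * row t i))"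
proof -
  let ?a = "block_start s"
  obtain c where c: "c (s - ?a) = 1"
      "\<And>f :: 'a mpoly. dickson (?a + (s - ?a)) f = (\<Sum>t\<le>s - ?a. c t * dickson ?a f ^ (CARD('a) ^ t))"
    using dickson_expansion[OF prime card_field, of "s - ?a" ?a] by blast
  have "dickson s (X i) = (\<Sum>t\<in>{?a..s}. c (t - ?a) * row t i)" for i
  proof -
    have "dickson s (X i) = (\<Sum>t\<le>s - ?a. c t * dickson ?a (X i) ^ (CARD('a) ^ t))"
      using c(2)[of "X i"] block_start(2)[of s] by simp
    also have "\<dots> = (\<Sum>t\<in>{?a..s}. c (t - ?a) * dickson ?a (X i) ^ (CARD('a) ^ (t - ?a)))"
      by (rule sum.reindex_bij_witness[of _ "\<lambda>t. t - ?a" "\<lambda>t. t + ?a"])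
         (use block_start(2)[of s] in auto)
    also have "\<dots> = (\<Sum>t\<in>{?a..s}. c (t - ?a) * row t i)"
      by (rule sum.cong) (auto simp: row_def block_start_eq)
    finally show ?thesis .
  qed
  then show ?thesis using c(1) by (intro exI[of _ "\<lambda>t. c (t - ?a)"]) auto
qed

lemma iota_dickson:
  obtains c where "c s = 1"
    "\<And>t. iota n (\<lambda>i. dickson s (X i)) t = (\<Sum>l\<in>{block_start s..s}. poly_scale (c l) (iota n (row l) t))"
proof -
  obtain c where c: "c s = 1" "\<And>i. dickson s (X i) = (\<Sum>t\<in>{block_start s..s}. c t * row t i)"
    using dickson_row[of s] by blast
  have "iota n (\<lambda>i. dickson s (X i)) t = (\<Sum>l\<in>{block_start s..s}. poly_scale (c l) (iota n (row l) t))" for t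
    unfolding c(2) by (rule iota_sum_left)
  then show ?thesis using that c(1) by blast
qed

text \<open>In the expansion of the triangular row \<open>m\<close> every term but the last repeats
  one of the rows before \<open>m\<close> and drops out.\<close>

lemma iotas_dickson:
  "iotas n (\<lambda>s i. dickson s (X i)) [0..<m] t = iotas n row [0..<m] t"
proof (induction m arbitrary: t)
  case (Suc m)
  obtain c where c: "c m = 1" "\<And>t. iota n (\<lambda>i. dickson m (X i)) t
      = (\<Sum>l\<in>{block_start m..m}. poly_scale (c l) (iota n (row l) t))"
    using iota_dickson[of m] by blast
  have "iotas n (\<lambda>s i. dickson s (X i)) [0..<Suc m] t
      = iotas n row [0..<m] (iota n (\<lambda>i. dickson m (X i)) t)"
    by (simp add: iotas_append Suc)
  also have "\<dots> = (\<Sum>l\<in>{block_start m..m}. poly_scale (c l) (iotas n row ([0..<m] @ [l]) t))"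
    unfolding c(2) by (simp add: iotas_sum iotas_poly_scale iotas_append)
  also have "\<dots> = (\<Sum>l\<in>{block_start m..m}. if l = m then iotas n row ([0..<m] @ [m]) t else 0)"
  proof (rule sum.cong[OF refl])
    fix l assume "l \<in> {block_start m..m}"
    then have "\<not> distinct ([0..<m] @ [l])" if "l \<noteq> m" using that by auto
    then show "poly_scale (c l) (iotas n row ([0..<m] @ [l]) t)
        = (if l = m then iotas n row ([0..<m] @ [m]) t else 0)"
      by (cases "l = m") (simp_all add: c(1) iotas_not_distinct del: distinct_append)
  qed
  also have "\<dots> = iotas n row [0..<Suc m] t" using block_start(2)[of m] by simp
  finally show ?case .
qed simp

text \<open>With the triangular rows only diagonal entries survive: row \<open>m\<close> vanishes on
  earlier variables, and later ones do not occur in the form.\<close>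

lemma scalar_part_top:
  assumes "m \<le> n"
  shows "scalar_part (iotas n row [0..<m] (Poly_Mapping.single {..<m} 1)) = form_prod m \<or>
    scalar_part (iotas n row [0..<m] (Poly_Mapping.single {..<m} 1)) = - form_prod m"
  unfolding iotas_dickson[symmetric] using assms
proof (induction m)
  case 0
  show ?case by (simp add: scalar_part_def form_prod_def del: single_one)
next
  case (Suc m)
  let ?T = "\<lambda>s i. dickson s (X i) :: 'a mpoly"
  let ?y = "\<lambda>m. Poly_Mapping.single {..<m} 1 :: 'a sym_ext"
  have "iota n (?T m) (?y (Suc m))
      = (\<Sum>i<n. if i = m then poly_scale (?T m m * ext_sign m {..<Suc m}) (?y m) else 0)"
    unfolding iota_def
  proof (rule sum.cong[OF refl])
    fix i
    have diff: "{..<Suc m} - {m} = {..<m}" by auto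
    have scale: "poly_scale (?T m m) (Poly_Mapping.single {..<m} (ext_sign m {..<Suc m}))
        = poly_scale (?T m m * ext_sign m {..<Suc m}) (?y m)"
      by (rule poly_mapping_eqI) (simp add: lookup_single when_def)
    consider "i < m" | "i = m" | "m < i" by linarith
    then show "poly_scale (?T m i) (contr i (?y (Suc m)))
        = (if i = m then poly_scale (?T m m * ext_sign m {..<Suc m}) (?y m) else 0)"
    proof cases
      case 2
      then show ?thesis by (simp add: contr_single diff scale)
    qed (simp_all add: dickson_vanishes contr_single)
  qed
  then have top: "iota n (?T m) (?y (Suc m)) = poly_scale (?T m m * ext_sign m {..<Suc m}) (?y m)"
    using Suc.prems by simp
  have sign: "ext_sign m {..<Suc m} = (1 :: 'a mpoly) \<or> ext_sign m {..<Suc m} = (- 1 :: 'a mpoly)"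
    unfolding ext_sign_def by (cases "even (card {k \<in> {..<Suc m}. k < m})") auto
  have "scalar_part (iotas n ?T [0..<Suc m] (?y (Suc m)))
      = (?T m m * ext_sign m {..<Suc m}) * scalar_part (iotas n ?T [0..<m] (?y m))"
    by (simp add: iotas_append top iotas_poly_scale)
  moreover have "scalar_part (iotas n ?T [0..<m] (?y m)) = form_prod m \<or>
      scalar_part (iotas n ?T [0..<m] (?y m)) = - form_prod m"
    using Suc by simp
  moreover have "form_prod (Suc m) = ?T m m * form_prod m"
    by (simp add: form_prod_def mult.commute)
  ultimately show ?case using sign by (elim disjE) (simp_all del: upt_Suc)
qed

lemma dickson_X_nonzero: "dickson i (X i) \<noteq> (0 :: 'a mpoly)"
  using form_prod_nonzero[OF prime card_field, of "Suc i"] by (auto simp: form_prod_def)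

text \<open>Back substitution: the triangular rows have nonzero diagonal, so all
  \<open>contr i u\<close> vanish, starting with the last variable. This leaves only the coefficient
  at the empty set.\<close>

lemma iota_rows_eq_0:
  assumes keys: "Poly_Mapping.keys u \<subseteq> Pow {..<n}"
    and iota: "\<And>s. s < n \<Longrightarrow> iota n (row s) u = 0"
    and "scalar_part u = 0"
  shows "u = 0"
proof -
  have T: "iota n (\<lambda>i. dickson s (X i)) u = 0" if s: "s < n" for s
  proof -
    obtain c where c: "\<And>t. iota n (\<lambda>i. dickson s (X i)) t
        = (\<Sum>l\<in>{block_start s..s}. poly_scale (c l) (iota n (row l) t))"
      using iota_dickson[of s] by blast
    have "iota n (\<lambda>i. dickson s (X i)) u
        = (\<Sum>l\<in>{block_start s..s}. poly_scale (c l) (iota n (row l) u))"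
      by (rule c)
    also have "\<dots> = 0" using iota s by (intro sum.neutral) simp
    finally show ?thesis .
  qed
  have contr: "i < n \<Longrightarrow> contr i u = 0" for i
  proof (induction "n - i" arbitrary: i rule: less_induct)
    case less
    have "iota n (\<lambda>j. dickson i (X j)) u
        = (\<Sum>j<n. if j = i then poly_scale (dickson i (X i)) (contr i u) else 0)"
      unfolding iota_def
    proof (rule sum.cong[OF refl])
      fix j assume j: "j \<in> {..<n}"
      consider "j < i" | "j = i" | "i < j" by linarith
      then show "poly_scale (dickson i (X j)) (contr j u)
          = (if j = i then poly_scale (dickson i (X i)) (contr i u) else 0)"
      proof cases
        case 3
        then have "contr j u = 0" using j less by auto
        then show ?thesis using 3 by simp
      qed (simp_all add: dickson_vanishes)
    qed
    then have "poly_scale (dickson i (X i)) (contr i u) = 0" using T less.prems by simp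
    then have "dickson i (X i) * Poly_Mapping.lookup (contr i u) K = 0" for K
      by (simp only: lookup_poly_scale[symmetric] lookup_zero)
    then show "contr i u = 0" using dickson_X_nonzero by (intro poly_mapping_eqI) simp
  qed
  show "u = 0"
  proof (rule poly_mapping_eqI)
    fix K
    show "Poly_Mapping.lookup u K = Poly_Mapping.lookup 0 K"
    proof (cases "K = {} \<or> K \<notin> Poly_Mapping.keys u")
      case True
      then show ?thesis using assms(3) by (auto simp: scalar_part_def in_keys_iff)
    next
      case False
      then obtain i where i: "i \<in> K" "i < n" using keys by blast
      then have "ext_sign i (K - {i}) * Poly_Mapping.lookup u K = 0"
        using arg_cong[OF contr[OF i(2)], of "\<lambda>t. Poly_Mapping.lookup t (K - {i})"]
        by (simp add: contr.rep_eq insert_absorb)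
      then show ?thesis by (simp add: ext_sign_def)
    qed
  qed
qed

text \<open>These are the \<open>\<phi>\<^sub>J\<close> of the opening comment; the sorted list
  fixes their signs.\<close>

definition coord :: "nat set \<Rightarrow> 'a sym_ext \<Rightarrow> 'a mpoly" where
  "coord J t = scalar_part (iotas n row (sorted_list_of_set J) t)"

lemma coord_diff: "coord J (t - u) = coord J t - coord J u"
  using iotas_add[of n row "sorted_list_of_set J" t "- u"] by (simp add: coord_def iotas_uminus)

lemma coord_sum: "coord J (sum t A) = (\<Sum>i\<in>A. coord J (t i))"
  by (simp add: coord_def iotas_sum scalar_part_sum)

lemma coord_poly_scale: "coord J (poly_scale f t) = f * coord J t"
  by (simp add: coord_def iotas_poly_scale)

lemma sym_ext_space_rows:
  "set xs \<subseteq> {..<n} \<Longrightarrow> t \<in> sym_ext_space n \<Longrightarrow> iotas n row xs t \<in> sym_ext_space n"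
  by (rule sym_ext_space_iotas) (auto intro: row_closed)

lemma set_sorted_sub: "J \<subseteq> {..<n} \<Longrightarrow> set (sorted_list_of_set J) = J"
  by (meson finite_lessThan finite_subset set_sorted_list_of_set)

lemma coord_closed: "J \<subseteq> {..<n} \<Longrightarrow> t \<in> sym_ext_space n \<Longrightarrow> coord J t \<in> sym_algebra n"
  unfolding coord_def scalar_part_def
  by (intro sym_ext_spaceD(2) sym_ext_space_rows) (simp_all add: set_sorted_sub)

text \<open>Downward induction on \<open>J\<close>: a further contraction repeats a row or leads, up
  to sign, to a larger set, and the scalar part is \<open>coord J t\<close>. So
  \<open>iota_rows_eq_0\<close> applies, and \<open>J = {}\<close> gives \<open>t\<close>.\<close>

lemma coords_eq_0:
  assumes t: "t \<in> sym_ext_space n" and coord: "\<And>J. J \<subseteq> {..<n} \<Longrightarrow> coord J t = 0"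
  shows "t = 0"
proof -
  have "J \<subseteq> {..<n} \<Longrightarrow> iotas n row (sorted_list_of_set J) t = 0" for J
  proof (induction "card ({..<n} - J)" arbitrary: J rule: less_induct)
    case less
    have fin: "finite J" using less.prems by (rule finite_subset) simp
    show ?case
    proof (rule iota_rows_eq_0)
      show "Poly_Mapping.keys (iotas n row (sorted_list_of_set J) t) \<subseteq> Pow {..<n}"
        using less.prems t by (intro sym_ext_spaceD(1) sym_ext_space_rows) (simp_all add: set_sorted_sub)
      show "scalar_part (iotas n row (sorted_list_of_set J) t) = 0"
        using coord[OF less.prems] by (simp add: coord_def)
      fix s assume s: "s < n"
      show "iota n (row s) (iotas n row (sorted_list_of_set J) t) = 0"
      proof (cases "s \<in> J")
        case True
        then have "\<not> distinct (s # sorted_list_of_set J)" using fin by simp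
        then have "iotas n row (s # sorted_list_of_set J) t = 0" by (rule iotas_not_distinct)
        then show ?thesis by simp
      next
        case False
        then have "mset (s # sorted_list_of_set J) = mset (sorted_list_of_set (insert s J))"
          using fin by simp
        from iotas_perm[OF this, of n row t]
        have "iotas n row (s # sorted_list_of_set J) t = iotas n row (sorted_list_of_set (insert s J)) t \<or>
            iotas n row (s # sorted_list_of_set J) t = - iotas n row (sorted_list_of_set (insert s J)) t" .
        moreover have "card ({..<n} - insert s J) < card ({..<n} - J)"
          by (rule psubset_card_mono) (use s False in auto)
        then have "iotas n row (sorted_list_of_set (insert s J)) t = 0"
          using less.hyps[of "insert s J"] less.prems s by simp
        ultimately show ?thesis by auto
      qed
    qed
  qed
  from this[of "{}"] show ?thesis by simp
qed

end


subsection \<open>Divisibility of the coefficients of an invariant\<close>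

lemma sym_act_torus_single:
  assumes "a < n" "Poly_Mapping.single m c \<in> sym_algebra n"
  shows "sym_act n (col_mat n a (\<lambda>i. if i = a then b else 0)) (Poly_Mapping.single m c)
    = const_poly (b ^ Poly_Mapping.lookup m a) * Poly_Mapping.single m c"
proof -
  let ?g = "col_mat n a (\<lambda>i. if i = a then b else 0)"
  have col: "sym_col n ?g j = (if j = a then const_poly b else 1) * sym_col n (1\<^sub>m n) j" if "j < n" for j
    using that unfolding col_mat_one[of n a, symmetric]
    by (simp add: sym_col_col_mat lin_unit assms(1))
  have "sym_monom n ?g m = (\<Prod>j<n. (if j = a then const_poly (b ^ Poly_Mapping.lookup m a) else 1) *
      sym_col n (1\<^sub>m n) j ^ Poly_Mapping.lookup m j)"
    unfolding sym_monom_def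
    by (rule prod.cong) (auto simp: col power_mult_distrib const_poly_power)
  also have "\<dots> = const_poly (b ^ Poly_Mapping.lookup m a) * sym_monom n (1\<^sub>m n) m"
    unfolding sym_monom_def prod.distrib using assms(1) by simp
  finally have "sym_act n ?g (Poly_Mapping.single m c)
      = const_poly (b ^ Poly_Mapping.lookup m a) * sym_act n (1\<^sub>m n) (Poly_Mapping.single m c)"
    by (simp add: sym_act_single mult.left_commute)
  then show ?thesis by (simp add: sym_act_one[OF assms(2)])
qed

text \<open>Scaling \<open>X a\<close> is diagonal on monomials; this later turns invariance into
  congruences on exponents.\<close>

lemma lookup_sym_act_torus:
  assumes "a < n" "f \<in> sym_algebra n"
  shows "Poly_Mapping.lookup (sym_act n (col_mat n a (\<lambda>i. if i = a then b else 0)) f) m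
    = b ^ Poly_Mapping.lookup m a * Poly_Mapping.lookup f m"
proof -
  let ?g = "col_mat n a (\<lambda>i. if i = a then b else 0)"
  have "sym_act n ?g f = (\<Sum>m\<in>Poly_Mapping.keys f. sym_act n ?g (Poly_Mapping.single m (Poly_Mapping.lookup f m)))"
    by (simp add: poly_mapping_sum_single flip: sym_act_sum)
  also have "\<dots> = (\<Sum>m\<in>Poly_Mapping.keys f.
      Poly_Mapping.single m (b ^ Poly_Mapping.lookup m a * Poly_Mapping.lookup f m))"
  proof (rule sum.cong[OF refl])
    fix m assume "m \<in> Poly_Mapping.keys f"
    then have "Poly_Mapping.single m (Poly_Mapping.lookup f m) \<in> sym_algebra n"
      using assms(2) by (simp add: sym_algebra_def)
    then show "sym_act n ?g (Poly_Mapping.single m (Poly_Mapping.lookup f m))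
        = Poly_Mapping.single m (b ^ Poly_Mapping.lookup m a * Poly_Mapping.lookup f m)"
      using assms(1) by (simp add: sym_act_torus_single mult_single)
  qed
  finally have "Poly_Mapping.lookup (sym_act n ?g f) m = (\<Sum>m'\<in>Poly_Mapping.keys f.
      if m' = m then b ^ Poly_Mapping.lookup m a * Poly_Mapping.lookup f m else 0)"
    by (simp add: lookup_sum lookup_single when_def cong: if_cong sum.cong)
  then show ?thesis by (simp add: in_keys_iff)
qed

lemma X_power: "X a ^ d = Poly_Mapping.single (Poly_Mapping.single a d) 1"
proof (induction d)
  case (Suc d)
  have "Poly_Mapping.single a 1 + Poly_Mapping.single a d = (Poly_Mapping.single a (Suc d) :: nat \<Rightarrow>\<^sub>0 nat)"
    by (simp add: single_add[symmetric])
  then show ?case unfolding power_Suc Suc unfolding X_def mult_single by simp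
qed simp

lemma X_power_dvdI:
  assumes "\<And>m. m \<in> Poly_Mapping.keys f \<Longrightarrow> d \<le> Poly_Mapping.lookup m a"
  shows "X a ^ d dvd f"
proof -
  have "X a ^ d dvd Poly_Mapping.single m (Poly_Mapping.lookup f m)" if "m \<in> Poly_Mapping.keys f" for m
  proof -
    \<comment> \<open>Subtraction of exponents is truncated; the assumption makes it exact.\<close>
    have "Poly_Mapping.single a d + (m - Poly_Mapping.single a d) = m"
      by (rule poly_mapping_eqI)
         (use assms[OF that] in \<open>auto simp: lookup_add lookup_minus lookup_single when_def\<close>)
    then have "Poly_Mapping.single m (Poly_Mapping.lookup f m)
        = X a ^ d * Poly_Mapping.single (m - Poly_Mapping.single a d) (Poly_Mapping.lookup f m)"
      by (simp add: X_power mult_single)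
    then show ?thesis by simp
  qed
  then have "X a ^ d dvd (\<Sum>m\<in>Poly_Mapping.keys f. Poly_Mapping.single m (Poly_Mapping.lookup f m))"
    by (intro dvd_sum)
  then show ?thesis by (simp add: poly_mapping_sum_single)
qed

lemma X_dvd_keys:
  assumes "X a dvd f" "m \<in> Poly_Mapping.keys f"
  shows "0 < Poly_Mapping.lookup m a"
proof -
  obtain h where h: "f = X a * h" using assms(1) by (rule dvdE)
  have "Poly_Mapping.keys (X a :: 'a mpoly) \<subseteq> {Poly_Mapping.single a 1}"
    by (simp add: X_def)
  then obtain m' where "m = Poly_Mapping.single a 1 + m'"
    using keys_mult[of "X a" h] assms(2) unfolding h by blast
  then show ?thesis by (simp add: lookup_add)
qed

context parabolic_invariants
begin

text \<open>The exponent \<open>e\<close> of the opening comment; \<open>k_le\<close> makes it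
  positive.\<close>

definition defect :: nat where
  "defect = CARD('a) - 1 - k"

lemma defect_pos: "0 < defect"
  using k_le by (simp add: defect_def)

text \<open>The dual basis. These covectors need not be equivariant, but contracting with them reads
  off coefficients by \<open>lookup_eq_scalar_part\<close>.\<close>

abbreviation unit_row :: "nat \<Rightarrow> nat \<Rightarrow> 'a mpoly" where
  "unit_row \<equiv> \<lambda>s i. if i = s then 1 else 0"

definition invariants :: "'a sym_ext set" where
  "invariants = {t \<in> sym_ext_space n. \<forall>g\<in>G. sym_ext_act n k g t = t}"

lemma invariantsD:
  "t \<in> invariants \<Longrightarrow> t \<in> sym_ext_space n"
  "t \<in> invariants \<Longrightarrow> g \<in> G \<Longrightarrow> sym_ext_act n k g t = t"
  by (auto simp: invariants_def)

lemma scalar_part_invariant: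
  assumes t: "t \<in> invariants" and g: "g \<in> G"
    and D: "\<And>s j. s \<in> set xs \<Longrightarrow> j < n \<Longrightarrow> sym_act n g (D s j) = (\<Sum>k<n. const_poly (g $$ (k, j)) * D' s k)"
    and closed: "\<And>s i. s \<in> set xs \<Longrightarrow> i < n \<Longrightarrow> D s i \<in> sym_algebra n"
  shows "const_poly (det g ^ k) * sym_act n g (scalar_part (iotas n D xs t)) = scalar_part (iotas n D' xs t)"
proof -
  have "iotas n D xs t \<in> sym_ext_space n"
    using closed invariantsD(1)[OF t] by (rule sym_ext_space_iotas)
  then have "const_poly (det g ^ k) * sym_act n g (scalar_part (iotas n D xs t))
      = scalar_part (sym_ext_act n k g (iotas n D xs t))"
    by (simp add: scalar_part_act)
  also have "sym_ext_act n k g (iotas n D xs t) = iotas n D' xs (sym_ext_act n k g t)"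
    by (rule sym_ext_act_iotas[OF D closed invariantsD(1)[OF t]])
  finally show ?thesis by (simp add: invariantsD(2)[OF t g])
qed

text \<open>When \<open>X a\<close> is scaled by \<open>b\<close>, the determinant contributes
  \<open>b ^ k\<close>, and a factor \<open>x\<^sub>a\<close> in \<open>x\<^sub>K\<close>
  contributes one more \<open>b\<close>.\<close>

lemma lookup_torus:
  assumes t: "t \<in> invariants" and a: "a < n" and K: "K \<subseteq> {..<n}" and b: "b \<noteq> 0"
  shows "const_poly (b ^ (if a \<in> K then Suc k else k)) *
    sym_act n (col_mat n a (\<lambda>i. if i = a then b else 0)) (Poly_Mapping.lookup t K) = Poly_Mapping.lookup t K"
proof -
  let ?g = "col_mat n a (\<lambda>i. if i = a then b else 0)"
  \<comment> \<open>The scaling multiplies the dual vector of \<open>X a\<close> by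
    \<open>inverse b\<close>; \<open>?D'\<close> is the transported dual basis.\<close>
  let ?d = "\<lambda>s. if s = a then inverse b else 1"
  let ?D' = "\<lambda>s i. const_poly (?d s) * unit_row s i"
  define xs where "xs = sorted_list_of_set K"
  have xs: "set xs = K" "distinct xs" using K set_sorted_sub by (auto simp: xs_def)
  have g: "?g \<in> G" using a b by (intro col_mat_in_G) auto
  have det: "det ?g = b" by (simp add: det_col_mat[OF a])
  have row: "sym_act n ?g (unit_row s j) = (\<Sum>k<n. const_poly (?g $$ (k, j)) * ?D' s k)"
    if "s \<in> set xs" "j < n" for s j
  proof -
    have s: "s < n" using that K xs by auto
    have "(\<Sum>k<n. const_poly (?g $$ (k, j)) * ?D' s k)
        = (\<Sum>k<n. if k = s then const_poly (?g $$ (s, j) * ?d s) else 0)"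
      by (rule sum.cong) (auto simp: const_poly_mult)
    also have "\<dots> = const_poly (?g $$ (s, j) * ?d s)" using s by simp
    also have "?g $$ (s, j) * ?d s = (if j = s then 1 else 0)"
      using s that(2) b by (auto simp: col_mat_index)
    finally show ?thesis by simp
  qed
  have "iotas n ?D' xs u = poly_scale (const_poly (if a \<in> set xs then inverse b else 1)) (iotas n unit_row xs u)"
    for u
    using xs(2)
  proof (induction xs)
    case (Cons s xs)
    have scale: "iota n (?D' s) v = poly_scale (const_poly (?d s)) (iota n (unit_row s) v)" for v
      by (simp add: iota_def poly_scale_sum poly_scale_poly_scale)
    show ?case
      using Cons by (auto simp: scale iota_poly_scale poly_scale_poly_scale mult_single)
  qed simp
  then have "scalar_part (iotas n ?D' xs t)
      = const_poly (if a \<in> K then inverse b else 1) * scalar_part (iotas n unit_row xs t)"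
    by (simp add: xs)
  moreover have "const_poly (b ^ k) * sym_act n ?g (scalar_part (iotas n unit_row xs t))
      = scalar_part (iotas n ?D' xs t)"
    using scalar_part_invariant[OF t g row, of xs] by (simp add: det)
  ultimately have *: "const_poly (b ^ k) * sym_act n ?g F = const_poly (if a \<in> K then inverse b else 1) * F"
    if "F = scalar_part (iotas n unit_row xs t) \<or> F = - scalar_part (iotas n unit_row xs t)" for F
    using that by (auto simp: sym_act_uminus)
  have "Poly_Mapping.lookup t K = scalar_part (iotas n unit_row xs t) \<or>
      Poly_Mapping.lookup t K = - scalar_part (iotas n unit_row xs t)"
    using lookup_eq_scalar_part[OF xs K, of t] by auto
  note F = *[OF this]
  show ?thesis
  proof (cases "a \<in> K")
    case True
    have "const_poly (b ^ Suc k) * sym_act n ?g (Poly_Mapping.lookup t K)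
        = const_poly b * (const_poly (b ^ k) * sym_act n ?g (Poly_Mapping.lookup t K))"
      by (simp only: power_Suc const_poly_mult mult.assoc)
    also have "\<dots> = const_poly (b * inverse b) * Poly_Mapping.lookup t K"
      unfolding F using True by (simp only: const_poly_mult mult.assoc if_True)
    finally show ?thesis using True b by simp
  next
    case False
    then show ?thesis using F by simp
  qed
qed

text \<open>Comparing coefficients of \<open>m\<close> in \<open>lookup_torus\<close> shows that
  this power of \<open>b\<close> is \<open>1\<close> for every unit \<open>b\<close>.\<close>

lemma keys_lookup_dvd:
  assumes "t \<in> invariants" "a < n" "K \<subseteq> {..<n}" "m \<in> Poly_Mapping.keys (Poly_Mapping.lookup t K)"
  shows "CARD('a) - 1 dvd (if a \<in> K then Suc k else k) + Poly_Mapping.lookup m a"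
proof (rule power_eq_one_dvd)
  fix b :: 'a assume b: "b \<noteq> 0"
  let ?N = "if a \<in> K then Suc k else k"
  have closed: "Poly_Mapping.lookup t K \<in> sym_algebra n"
    using invariantsD(1)[OF assms(1)] by (rule sym_ext_spaceD(2))
  have "Poly_Mapping.lookup (const_poly c * f) m = c * Poly_Mapping.lookup f m" for c and f :: "'a mpoly"
    by (simp add: mult_map_scale_conv_mult[symmetric] map.rep_eq when_def)
  then have "b ^ ?N * (b ^ Poly_Mapping.lookup m a * Poly_Mapping.lookup (Poly_Mapping.lookup t K) m)
      = Poly_Mapping.lookup (Poly_Mapping.lookup t K) m"
    using arg_cong[OF lookup_torus[OF assms(1-3) b], of "\<lambda>f. Poly_Mapping.lookup f m"]
    by (simp only: lookup_sym_act_torus[OF assms(2) closed])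
  then show "b ^ (?N + Poly_Mapping.lookup m a) = 1"
    using assms(4) by (simp add: power_add in_keys_iff flip: mult.assoc)
qed

text \<open>Here \<open>Suc k\<close> plus the exponent is a positive multiple of
  \<open>CARD('a) - 1\<close>, hence at least that.\<close>

lemma lookup_dvd_mem:
  assumes "t \<in> invariants" "a < n" "K \<subseteq> {..<n}" "a \<in> K"
  shows "X a ^ (defect - 1) dvd Poly_Mapping.lookup t K"
proof (rule X_power_dvdI)
  fix m assume "m \<in> Poly_Mapping.keys (Poly_Mapping.lookup t K)"
  then have "CARD('a) - 1 dvd Suc k + Poly_Mapping.lookup m a"
    using keys_lookup_dvd[OF assms(1-3)] assms(4) by fastforce
  then have "CARD('a) - 1 \<le> Suc k + Poly_Mapping.lookup m a" by (rule dvd_imp_le) simp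
  then show "defect - 1 \<le> Poly_Mapping.lookup m a" by (simp add: defect_def)
qed

text \<open>The transvection that adds \<open>X a\<close> to \<open>X j\<close> lies in
  \<open>G\<close> because \<open>block_start a \<le> j\<close>. If \<open>f\<close> is the
  coefficient at \<open>K\<close> with \<open>j\<close> replaced by \<open>a\<close>, invariance
  makes the coefficient at \<open>K\<close>, up to sign, the difference of \<open>f\<close> and its
  image, and the transvection is the identity modulo \<open>X a\<close>.\<close>

lemma X_dvd_lookup:
  assumes t: "t \<in> invariants" and a: "a < n" and K: "K \<subseteq> {..<n}" "a \<notin> K" and j: "j \<in> K" "block_start a \<le> j"
  shows "X a dvd Poly_Mapping.lookup t K"
proof -
  let ?g = "col_mat n j (\<lambda>i. if i = j \<or> i = a then 1 else 0)"
  \<comment> \<open>Only the dual vector of \<open>X a\<close> changes under transport: that of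
    \<open>X j\<close> is subtracted from it.\<close>
  let ?D' = "\<lambda>s i. unit_row s i - (if s = a then unit_row j i else 0)"
  define xs where "xs = sorted_list_of_set (K - {j})"
  have xs: "set xs = K - {j}" "distinct xs"
    using set_sorted_sub[of "K - {j}"] K by (auto simp: xs_def)
  have jn: "j < n" "j \<noteq> a" using K j by auto
  have g: "?g \<in> G"
  proof (rule col_mat_in_G[OF jn(1)])
    fix s i assume "s \<in> boundaries" "j < s" "s \<le> i"
    then show "(if i = j \<or> i = a then 1 else 0) = (0 :: 'a)"
      using j(2) le_block_start[of s a] by auto
  qed simp
  have det: "det ?g = 1" by (simp add: det_col_mat[OF jn(1)])
  have row: "sym_act n ?g (unit_row s i) = (\<Sum>k<n. const_poly (?g $$ (k, i)) * ?D' s k)"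
    if "s \<in> set (a # xs)" "i < n" for s i
  proof -
    have s: "s < n" using that(1) K xs a by auto
    have "(\<Sum>k<n. const_poly (?g $$ (k, i)) * ?D' s k)
        = (\<Sum>k<n. (if k = s then const_poly (?g $$ (s, i)) else 0) -
            (if k = j then if s = a then const_poly (?g $$ (j, i)) else 0 else 0))"
      by (rule sum.cong) auto
    also have "\<dots> = const_poly (?g $$ (s, i)) - (if s = a then const_poly (?g $$ (j, i)) else 0)"
      using s jn by (simp add: sum_subtractf)
    also have "\<dots> = (if i = s then 1 else 0)"
      using s jn that a xs by (auto simp: col_mat_index)
    finally show ?thesis by simp
  qed
  have minus: "iota n (\<lambda>i. E i - E' i) u = iota n E u - iota n E' u" for E E' u
    by (simp add: iota_def poly_scale_diff_left sum_subtractf)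
  have "iotas n ?D' xs t = iotas n unit_row xs t"
  proof (rule iotas_cong)
    fix s i assume "s \<in> set xs"
    then have "s \<noteq> a" using K(2) xs by auto
    then show "?D' s i = unit_row s i" by simp
  qed
  then have "iotas n ?D' (a # xs) t = iota n (?D' a) (iotas n unit_row xs t)"
    unfolding iotas_Cons by (rule arg_cong[where f = "iota n (?D' a)"])
  also have "\<dots> = iotas n unit_row (a # xs) t - iotas n unit_row (j # xs) t"
    by (simp only: minus iotas_Cons simp_thms if_True)
  finally have "scalar_part (iotas n ?D' (a # xs) t)
      = scalar_part (iotas n unit_row (a # xs) t) - scalar_part (iotas n unit_row (j # xs) t)"
    by simp
  moreover have "sym_act n ?g (scalar_part (iotas n unit_row (a # xs) t)) = scalar_part (iotas n ?D' (a # xs) t)"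
  proof -
    have "const_poly (det ?g ^ k) * sym_act n ?g (scalar_part (iotas n unit_row (a # xs) t))
        = scalar_part (iotas n ?D' (a # xs) t)"
      by (rule scalar_part_invariant[OF t g row]) simp_all
    then show ?thesis by (simp only: det power_one single_one mult_1)
  qed
  ultimately have "scalar_part (iotas n unit_row (j # xs) t) = scalar_part (iotas n unit_row (a # xs) t) -
      sym_act n ?g (scalar_part (iotas n unit_row (a # xs) t))"
    by simp
  moreover have "X a dvd f - sym_act n ?g f" if f: "f \<in> sym_algebra n" for f :: "'a mpoly"
  proof -
    have "X a dvd sym_act n (1\<^sub>m n) f - sym_act n (?g :: 'a mat) f"
    proof (rule sym_act_dvd_diff)
      fix i assume i: "i < n"
      have "lin n (\<lambda>i. if i = j \<or> i = a then 1 else 0) = (X j + X a :: 'a mpoly)"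
        unfolding X_eq_lin[OF jn(1)] X_eq_lin[OF a] lin_add by (rule lin_cong) (use jn in auto)
      moreover have "lin n (\<lambda>i. if i = j then 1 else 0) = (X j :: 'a mpoly)"
        by (rule X_eq_lin[OF jn(1), symmetric])
      ultimately have "sym_col n (1\<^sub>m n) i - sym_col n ?g i = (if i = j then - X a else 0 :: 'a mpoly)"
        unfolding col_mat_one[of n j, symmetric] sym_col_col_mat[OF i] by (simp only: split: if_split) simp
      then show "X a dvd sym_col n (1\<^sub>m n :: 'a mat) i - sym_col n ?g i" by simp
    qed
    then show ?thesis by (simp add: sym_act_one[OF f])
  qed
  moreover have "scalar_part (iotas n unit_row (a # xs) t) \<in> sym_algebra n"
    unfolding scalar_part_def
    by (intro sym_ext_spaceD(2) sym_ext_space_iotas invariantsD(1)[OF t]) simp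
  ultimately have "X a dvd scalar_part (iotas n unit_row (j # xs) t)" by simp
  moreover have "set (j # xs) = K" "distinct (j # xs)" using xs j by auto
  note lookup_eq_scalar_part[OF this K(1), of t]
  ultimately show ?thesis by (metis dvd_minus_iff)
qed

text \<open>The weight \<open>k\<close> plus the exponent is a multiple of
  \<open>CARD('a) - 1\<close>, possibly zero. The last assumption excludes zero, through
  \<open>k\<close> itself or through \<open>X_dvd_lookup\<close>.\<close>

lemma lookup_dvd_not_mem:
  assumes "t \<in> invariants" "a < n" "K \<subseteq> {..<n}" "a \<notin> K" and "0 < k \<or> (\<exists>j\<in>K. block_start a \<le> j)"
  shows "X a ^ defect dvd Poly_Mapping.lookup t K"
proof (rule X_power_dvdI)
  fix m assume m: "m \<in> Poly_Mapping.keys (Poly_Mapping.lookup t K)"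
  then have "CARD('a) - 1 dvd k + Poly_Mapping.lookup m a"
    using keys_lookup_dvd[OF assms(1-3)] assms(4) by fastforce
  moreover have "0 < k + Poly_Mapping.lookup m a"
    using assms(5)
  proof
    assume "\<exists>j\<in>K. block_start a \<le> j"
    then have "X a dvd Poly_Mapping.lookup t K" using X_dvd_lookup[OF assms(1-4)] by blast
    then show ?thesis using X_dvd_keys[OF _ m] by simp
  qed simp
  ultimately have "CARD('a) - 1 \<le> k + Poly_Mapping.lookup m a" by (rule dvd_imp_le)
  then show "defect \<le> Poly_Mapping.lookup m a" by (simp add: defect_def)
qed

text \<open>\<open>Z\<close> marks the coefficients that are not known to be divisible by \<open>x\<^sub>a\<^sup>e\<close>; contraction with an
  equivariant row keeps the divisibilities, and removes the exceptions if the row starts late enough.\<close>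

definition divisible :: "nat \<Rightarrow> (nat set \<Rightarrow> bool) \<Rightarrow> 'a sym_ext \<Rightarrow> bool" where
  "divisible a Z u \<longleftrightarrow> (\<forall>K. (a \<in> K \<longrightarrow> X a ^ (defect - 1) dvd Poly_Mapping.lookup u K) \<and>
    (a \<notin> K \<longrightarrow> \<not> Z K \<longrightarrow> X a ^ defect dvd Poly_Mapping.lookup u K))"

text \<open>The term with \<open>i = a\<close> starts from the weaker power, and the factor
  \<open>X a\<close> of \<open>row s a\<close> makes up for it. Exceptions are inherited only
  through nonzero entries of the row.\<close>

lemma divisible_iota:
  assumes div: "divisible a Z u"
    and Z: "\<And>K i. i < n \<Longrightarrow> i \<notin> K \<Longrightarrow> \<not> Z' K \<Longrightarrow> row s i \<noteq> 0 \<Longrightarrow> \<not> Z (insert i K)"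
  shows "divisible a Z' (iota n (row s) u)"
  unfolding divisible_def
proof (intro allI conjI impI)
  fix K assume aK: "a \<in> K"
  show "X a ^ (defect - 1) dvd Poly_Mapping.lookup (iota n (row s) u) K"
    unfolding lookup_iota
  proof (rule dvd_sum)
    fix i assume "i \<in> {..<n}"
    have "X a ^ (defect - 1) dvd Poly_Mapping.lookup u (insert i K)"
      using div aK unfolding divisible_def by (meson insertI2)
    then show "X a ^ (defect - 1) dvd (if i \<in> K then 0 else
        row s i * (ext_sign i K * Poly_Mapping.lookup u (insert i K)))"
      by (simp add: dvd_mult)
  qed
next
  fix K assume aK: "a \<notin> K" and ZK: "\<not> Z' K"
  show "X a ^ defect dvd Poly_Mapping.lookup (iota n (row s) u) K"
    unfolding lookup_iota
  proof (rule dvd_sum)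
    fix i assume i: "i \<in> {..<n}"
    have "X a ^ defect dvd row s i * (ext_sign i K * Poly_Mapping.lookup u (insert i K))" if iK: "i \<notin> K"
    proof (cases "i = a")
      case True
      have "X a ^ (defect - 1) dvd Poly_Mapping.lookup u (insert a K)"
        using div unfolding divisible_def by (meson insertI1)
      then have "X a * X a ^ (defect - 1) dvd row s a * (ext_sign a K * Poly_Mapping.lookup u (insert a K))"
        by (intro mult_dvd_mono X_dvd_row dvd_mult)
      then show ?thesis using True defect_pos by (metis Suc_diff_1 power_Suc)
    next
      case False
      show ?thesis
      proof (cases "row s i = 0")
        case True
        then show ?thesis by (simp only: mult_zero_left dvd_0_right)
      next
        case row: False
        have "\<not> Z (insert i K)" using Z[of i K] i iK ZK row by simp
        moreover have "a \<notin> insert i K" using False aK by simp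
        ultimately have "X a ^ defect dvd Poly_Mapping.lookup u (insert i K)"
          using div unfolding divisible_def by meson
        then show ?thesis by (intro dvd_mult)
      qed
    qed
    then show "X a ^ defect dvd (if i \<in> K then 0 else
        row s i * (ext_sign i K * Poly_Mapping.lookup u (insert i K)))"
      by simp
  qed
qed

text \<open>The case left open by \<open>lookup_dvd_not_mem\<close>: no determinant twist, and no
  element of \<open>K\<close> in the block of \<open>a\<close> or later.\<close>

definition exceptional :: "nat \<Rightarrow> nat set \<Rightarrow> bool" where
  "exceptional a K \<longleftrightarrow> k = 0 \<and> K \<subseteq> {..<block_start a}"

lemma divisible_invariant:
  assumes "t \<in> invariants" "a < n"
  shows "divisible a (exceptional a) t"
proof -
  have zero: "Poly_Mapping.lookup t K = 0" if "\<not> K \<subseteq> {..<n}" for K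
    using that sym_ext_spaceD(1)[OF invariantsD(1)[OF assms(1)]]
    by (metis Pow_iff in_keys_iff subsetD)
  show ?thesis
    unfolding divisible_def
  proof (intro allI conjI impI)
    fix K assume "a \<in> K"
    then show "X a ^ (defect - 1) dvd Poly_Mapping.lookup t K"
      using lookup_dvd_mem[OF assms] zero by (cases "K \<subseteq> {..<n}") auto
  next
    fix K assume K: "a \<notin> K" "\<not> exceptional a K"
    then have "0 < k \<or> (\<exists>j\<in>K. block_start a \<le> j)" by (auto simp: exceptional_def not_less)
    then show "X a ^ defect dvd Poly_Mapping.lookup t K"
      using lookup_dvd_not_mem[OF assms] K(1) zero by (cases "K \<subseteq> {..<n}") auto
  qed
qed

text \<open>A row \<open>s\<close> with \<open>block_start a \<le> block_start s\<close> only
  inserts indices outside \<open>{..<block_start a}\<close>, so one such row removes all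
  exceptions.\<close>

lemma divisible_iotas:
  assumes "divisible a (exceptional a) t"
  shows "divisible a (\<lambda>K. exceptional a K \<and> (\<forall>s\<in>set xs. block_start s < block_start a)) (iotas n row xs t)"
proof (induction xs)
  case (Cons s xs)
  show ?case
    unfolding iotas_Cons
  proof (rule divisible_iota[OF Cons])
    fix K i
    assume i: "row s i \<noteq> 0"
      and K: "\<not> (exceptional a K \<and> (\<forall>s\<in>set (s # xs). block_start s < block_start a))"
    have "block_start s \<le> i" using i row_zero[of i s] by (meson not_le)
    then show "\<not> (exceptional a (insert i K) \<and> (\<forall>s\<in>set xs. block_start s < block_start a))"
      using K by (auto simp: exceptional_def)
  qed
qed (use assms in simp)

text \<open>The rows are equivariant, so the transported covectors are the rows themselves.\<close>

lemma coord_semi_invariant: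
  assumes "t \<in> invariants" "g \<in> G" "J \<subseteq> {..<n}"
  shows "const_poly (det g ^ k) * sym_act n g (coord J t) = coord J t"
  unfolding coord_def
proof (rule scalar_part_invariant[OF assms(1,2)])
  fix s j assume "s \<in> set (sorted_list_of_set J)"
  then have "s < n" using set_sorted_sub[OF assms(3)] assms(3) by auto
  then show "sym_act n g (row s j) = (\<Sum>k<n. const_poly (g $$ (k, j)) * row s k)" if "j < n"
    using sym_act_row[OF assms(2)] that by simp
  show "row s j \<in> sym_algebra n" if "j < n" using row_closed \<open>s < n\<close> that by simp
qed


subsection \<open>The basis\<close>

text \<open>The \<open>m\<close> of the opening comment. For \<open>k > 0\<close> it is
  \<open>n\<close>, so that the top form transforms by the determinant; for \<open>k = 0\<close> the
  empty set has level \<open>0\<close>, which makes its basis element \<open>1\<close>.\<close>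

definition level :: "nat set \<Rightarrow> nat" where
  "level J = (if 0 < k then n else if J = {} then 0 else Min {s \<in> boundaries. Max J < s})"

text \<open>For the last claim take \<open>Max J\<close>: the block start of \<open>a\<close> is a
  boundary below \<open>level J\<close>, so by minimality it is at most
  \<open>Max J\<close>.\<close>

lemma level:
  assumes "J \<subseteq> {..<n}"
  shows "level J \<in> boundaries" "J \<subseteq> {..<level J}"
    and "a < level J \<Longrightarrow> k = 0 \<Longrightarrow> \<exists>s\<in>J. block_start a \<le> block_start s"
proof -
  have fin: "finite J" using assms by (rule finite_subset) simp
  have "level J \<in> boundaries \<and> J \<subseteq> {..<level J} \<and>
      (a < level J \<longrightarrow> k = 0 \<longrightarrow> (\<exists>s\<in>J. block_start a \<le> block_start s))"
  proof (cases "0 < k \<or> J = {}")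
    case True
    then show ?thesis using assms by (auto simp: level_def)
  next
    case False
    let ?S = "{s \<in> boundaries. Max J < s}"
    have J: "Max J \<in> J" using fin False by simp
    then have "n \<in> ?S" using assms by auto
    then have S: "finite ?S" "?S \<noteq> {}" by (simp, blast)
    have level: "level J = Min ?S" using False unfolding level_def by simp
    then have "level J \<in> ?S" using Min_in[OF S] by simp
    moreover have "J \<subseteq> {..<level J}"
      using \<open>level J \<in> ?S\<close> Max_ge[OF fin] by (auto intro: le_less_trans)
    moreover have "block_start a \<le> block_start (Max J)" if "a < level J"
    proof -
      have "block_start a < level J" using block_start(2)[of a] that by simp
      then have "block_start a \<notin> ?S" using Min_le[OF S(1)] level by (metis not_le)
      then show ?thesis using block_start(1)[of a] by (intro le_block_start) auto
    qed
    ultimately show ?thesis using J by blast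
  qed
  then show "level J \<in> boundaries" "J \<subseteq> {..<level J}"
    "a < level J \<Longrightarrow> k = 0 \<Longrightarrow> \<exists>s\<in>J. block_start a \<le> block_start s" by auto
qed

lemma X_power_dvd_coord:
  assumes "t \<in> invariants" "J \<subseteq> {..<n}" "a < level J"
  shows "X a ^ defect dvd coord J t"
proof -
  have "a < n" using assms(3) boundaries_le[OF level(1)[OF assms(2)]] by simp
  then have "divisible a (\<lambda>K. exceptional a K \<and>
      (\<forall>s\<in>set (sorted_list_of_set J). block_start s < block_start a))
      (iotas n row (sorted_list_of_set J) t)"
    using divisible_iotas divisible_invariant assms(1) by blast
  \<comment> \<open>For \<open>k = 0\<close> the empty set is exceptional by itself;
    \<open>level\<close> provides a row in \<open>J\<close> that starts late enough.\<close>
  moreover have "\<not> (exceptional a {} \<and> (\<forall>s\<in>set (sorted_list_of_set J). block_start s < block_start a))"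
    using level(3)[OF assms(2,3)] unfolding set_sorted_sub[OF assms(2)] exceptional_def
    by (meson not_le)
  ultimately show ?thesis
    unfolding divisible_def coord_def scalar_part_def by (meson empty_iff)
qed

text \<open>The matrix sending \<open>X a\<close> to \<open>X a - v\<close> lies in
  \<open>G\<close>, as \<open>v\<close> only involves earlier variables. Semi-invariance carries the
  divisibility by \<open>X a ^ defect\<close> over.\<close>

lemma form_power_dvd_coord:
  assumes "t \<in> invariants" "J \<subseteq> {..<n}" "a < level J" "v \<in> forms_upto n a"
  shows "(X a - v) ^ defect dvd coord J t"
proof -
  have a: "a < n" using assms(3) boundaries_le[OF level(1)[OF assms(2)]] by simp
  obtain u where u: "v = lin n u" "\<forall>k\<ge>a. u k = 0" using assms(4) by (auto simp: forms_upto_def)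
  let ?g = "col_mat n a (\<lambda>i. (if i = a then 1 else 0) - u i)"
  have g: "?g \<in> G" by (rule col_mat_in_G[OF a]) (use u(2) in auto)
  have "sym_act n ?g (X a) = X a - v"
    unfolding sym_act_X[OF a] sym_col_col_mat[OF a] u(1) by (simp add: X_eq_lin[OF a] lin_diff)
  moreover obtain f where "coord J t = X a ^ defect * f"
    using X_power_dvd_coord[OF assms(1-3)] by (rule dvdE)
  ultimately have eq: "coord J t = const_poly (det ?g ^ k) * ((X a - v) ^ defect * sym_act n ?g f)"
    using coord_semi_invariant[OF assms(1) g assms(2)] by (simp add: sym_act_mult sym_act_power)
  show ?thesis unfolding eq by (intro dvd_mult dvd_triv_left)
qed

lemma form_prod_power_dvd_coord:
  assumes "t \<in> invariants" "J \<subseteq> {..<n}"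
  shows "form_prod (level J) ^ defect dvd coord J t"
proof (rule form_prod_power_dvd[OF prime card_field])
  show "level J \<le> n" using boundaries_le[OF level(1)[OF assms(2)]] .
  show "coord J t \<in> sym_algebra n" using assms invariantsD(1) by (intro coord_closed)
qed (rule form_power_dvd_coord[OF assms])

definition top_form :: "nat \<Rightarrow> 'a sym_ext" where
  "top_form m = Poly_Mapping.single {..<m} 1"

lemma top_form_closed: "m \<le> n \<Longrightarrow> top_form m \<in> sym_ext_space n"
  unfolding top_form_def by (rule sym_ext_space_single) auto

text \<open>Contracting the rows outside \<open>J\<close> leaves those of \<open>J\<close> for
  \<open>coord J\<close>; together they give one factor \<open>form_prod (level J)\<close> up to
  sign, and the prefactor raises the exponent to \<open>defect\<close>.\<close>

definition basis_elt :: "nat set \<Rightarrow> 'a sym_ext" where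
  "basis_elt J = poly_scale (form_prod (level J) ^ (defect - 1))
    (iotas n row (sorted_list_of_set ({..<level J} - J)) (top_form (level J)))"

text \<open>Up to sign, \<open>form_prod m\<close> is the full contraction of the top form with
  equivariant rows, so both transform by the same \<open>\<delta>\<close>. The bound
  \<open>k\<close> shadows that of the locale: its value \<open>0\<close> removes the
  determinant.\<close>

lemma sym_act_top_form:
  assumes g: "g \<in> G" and m: "m \<in> boundaries"
  obtains \<delta> where "\<delta> \<noteq> 0" "\<And>k. sym_ext_act n k g (top_form m) = poly_scale (const_poly (det g ^ k * \<delta>)) (top_form m)"
    "sym_act n g (form_prod m) = const_poly \<delta> * form_prod m"
proof -
  have mn: "m \<le> n" using m by (rule boundaries_le)
  obtain h where gh: "g \<in> carrier_mat n n" "h \<in> carrier_mat n n" "h * g = 1\<^sub>m n"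
    using g unfolding G_def by (auto elim: parabolicE)
  have zero: "g $$ (i, j) = 0" if "j < m" "m \<le> i" "i < n" for i j
    using G_zero[OF g m] that by simp
  obtain \<delta> where \<delta>: "ext_gen n g {..<m} = Poly_Mapping.single {..<m} (const_poly \<delta>)"
    using ext_gen_top[OF mn zero] by blast
  have act: "sym_ext_act n k g (top_form m) = poly_scale (const_poly (det g ^ k * \<delta>)) (top_form m)" for k
    unfolding top_form_def sym_ext_act_single \<delta>
    by (rule poly_mapping_eqI) (simp add: lookup_single when_def mult_single)
  let ?L = "scalar_part (iotas n row [0..<m] (top_form m))"
  have row: "sym_act n g (row s j) = (\<Sum>k<n. const_poly (g $$ (k, j)) * row s k)"
      if "s \<in> set [0..<m]" "j < n" for s j
    using that mn by (intro sym_act_row[OF g]) auto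
  have closed: "row s j \<in> sym_algebra n" if "s \<in> set [0..<m]" "j < n" for s j
    using that mn by (intro row_closed) auto
  have "iotas n row [0..<m] (top_form m) \<in> sym_ext_space n"
    using closed top_form_closed[OF mn] by (rule sym_ext_space_iotas)
  then have "sym_act n g ?L = scalar_part (sym_ext_act n 0 g (iotas n row [0..<m] (top_form m)))"
    by (simp add: scalar_part_act)
  also have "\<dots> = const_poly \<delta> * ?L"
  proof -
    have "sym_ext_act n 0 g (iotas n row [0..<m] (top_form m))
        = iotas n row [0..<m] (sym_ext_act n 0 g (top_form m))"
      by (rule sym_ext_act_iotas[OF row closed top_form_closed[OF mn]])
    then show ?thesis by (simp add: act iotas_poly_scale)
  qed
  finally have "sym_act n g ?L = const_poly \<delta> * ?L" .
  then have L: "sym_act n g (form_prod m) = const_poly \<delta> * form_prod m"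
    using scalar_part_top[OF mn] unfolding top_form_def[symmetric] by (auto simp: sym_act_uminus)
  \<comment> \<open>Undoing \<open>g\<close> by \<open>h\<close> recovers
    \<open>form_prod m\<close>, so \<open>g\<close> cannot send it to zero.\<close>
  have "sym_act n h (sym_act n g (form_prod m)) = form_prod m"
    unfolding form_prod_eq[OF prime card_field mn] sym_act_prod
  proof (rule prod.cong[OF refl])
    fix i :: "nat \<times> 'a mpoly" assume "i \<in> (SIGMA a:{..<m}. forms_upto n a)"
    then obtain a u where "i = (a, lin n u)" "a < m" by (rule form_indexE)
    then have i: "(case i of (a, v) \<Rightarrow> X a - v) = lin n (\<lambda>k. (if k = a then 1 else 0) - u k)"
      using mn by (simp add: X_eq_lin[of a n] lin_diff)
    show "sym_act n h (sym_act n g (case i of (a, v) \<Rightarrow> X a - v)) = (case i of (a, v) \<Rightarrow> X a - v)"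
      unfolding i by (rule sym_act_sym_act_lin[OF gh])
  qed
  then have "\<delta> \<noteq> 0" using form_prod_nonzero[OF prime card_field, of m] by (auto simp: L)
  then show ?thesis using that act L by blast
qed

text \<open>The total factor is \<open>det g ^ k * \<delta> ^ defect\<close>. For
  \<open>k > 0\<close> the level is \<open>n\<close> and \<open>\<delta> = det g\<close>; for
  \<open>k = 0\<close> the exponent of \<open>\<delta>\<close> is \<open>CARD('a) - 1\<close>
  already. Either way it is a unit to the power \<open>CARD('a) - 1\<close>.\<close>

lemma basis_elt_invariant:
  assumes J: "J \<subseteq> {..<n}"
  shows "basis_elt J \<in> invariants"
proof -
  let ?m = "level J" and ?xs = "sorted_list_of_set ({..<level J} - J)"
  have mn: "?m \<le> n" using boundaries_le[OF level(1)[OF J]] .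
  have xs: "set ?xs \<subseteq> {..<n}" using mn by auto
  have closed: "row s j \<in> sym_algebra n" if "s \<in> set ?xs" "j < n" for s j
    using that xs by (intro row_closed) auto
  have space: "basis_elt J \<in> sym_ext_space n"
    unfolding basis_elt_def
    by (intro sym_ext_space_poly_scale sym_algebra_power form_prod_closed mn sym_ext_space_rows xs top_form_closed)
  have "sym_ext_act n k g (basis_elt J) = basis_elt J" if g: "g \<in> G" for g
  proof -
    obtain \<delta> where \<delta>: "\<delta> \<noteq> 0"
      "\<And>k. sym_ext_act n k g (top_form ?m) = poly_scale (const_poly (det g ^ k * \<delta>)) (top_form ?m)"
      "sym_act n g (form_prod ?m) = const_poly \<delta> * form_prod ?m"
      using sym_act_top_form[OF g level(1)[OF J]] by blast
    have row: "sym_act n g (row s j) = (\<Sum>k<n. const_poly (g $$ (k, j)) * row s k)"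
      if "s \<in> set ?xs" "j < n" for s j
      using that xs by (intro sym_act_row[OF g]) auto
    have "det g ^ k * \<delta> ^ defect = 1"
    proof (cases "0 < k")
      case True
      then have "?m = n" by (simp add: level_def)
      moreover have "g \<in> carrier_mat n n" using g unfolding G_def by (auto elim: parabolicE)
      ultimately have "const_poly \<delta> * form_prod n = const_poly (det g) * (form_prod n :: 'a mpoly)"
        using sym_act_form_prod[OF prime card_field] \<delta>(3) by metis
      then have "det g = \<delta>" using form_prod_nonzero[OF prime card_field, of n] by simp
      then have "det g ^ k * \<delta> ^ defect = \<delta> ^ (CARD('a) - 1)"
        using k_le by (simp add: defect_def flip: power_add)
      then show ?thesis using power_card_minus_one[OF \<delta>(1)] by simp
    next
      case False
      then show ?thesis using power_card_minus_one[OF \<delta>(1)] unfolding defect_def by simp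
    qed
    moreover have "\<delta> ^ defect = \<delta> ^ (defect - 1) * \<delta>"
      using defect_pos by (metis power_minus_mult)
    ultimately have weight: "\<delta> ^ (defect - 1) * (det g ^ k * \<delta>) = 1" by (simp add: mult_ac)
    have "sym_ext_act n k g (iotas n row ?xs (top_form ?m)) = iotas n row ?xs (sym_ext_act n k g (top_form ?m))"
      by (rule sym_ext_act_iotas[OF row closed top_form_closed[OF mn]])
    then have "sym_ext_act n k g (basis_elt J)
        = poly_scale (const_poly (\<delta> ^ (defect - 1) * (det g ^ k * \<delta>))) (basis_elt J)"
      unfolding basis_elt_def sym_ext_act_poly_scale \<delta>(2)
        iotas_poly_scale poly_scale_poly_scale sym_act_power \<delta>(3) power_mult_distrib const_poly_power[symmetric]
        const_poly_mult
      by (simp only: iotas_poly_scale poly_scale_poly_scale mult_ac)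
    then show ?thesis by (simp only: weight single_one poly_scale_1)
  qed
  then show ?thesis using space by (simp add: invariants_def)
qed

lemma coord_basis_elt:
  assumes J: "J \<subseteq> {..<n}" and J': "J' \<subseteq> {..<n}"
  shows "J' \<noteq> J \<Longrightarrow> coord J' (basis_elt J) = 0"
    and "coord J (basis_elt J) = form_prod (level J) ^ defect \<or> coord J (basis_elt J) = - (form_prod (level J) ^ defect)"
proof -
  let ?m = "level J" and ?xs = "sorted_list_of_set ({..<level J} - J)"
  let ?y = "top_form ?m"
  have mn: "?m \<le> n" using boundaries_le[OF level(1)[OF J]] .
  have coord: "coord K (basis_elt J)
      = form_prod ?m ^ (defect - 1) * scalar_part (iotas n row (sorted_list_of_set K @ ?xs) ?y)" for K
    by (simp add: coord_def basis_elt_def iotas_poly_scale iotas_append)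
  have J'set: "set (sorted_list_of_set J') = J'" using J' by (rule set_sorted_sub)
  have Jset: "set (sorted_list_of_set J) = J" using J by (rule set_sorted_sub)
  show "coord J' (basis_elt J) = 0" if "J' \<noteq> J"
  proof (cases "J' \<subseteq> {..<?m}")
    case False
    then obtain s where s: "s \<in> J'" "?m \<le> s" by (meson lessThan_iff not_le subsetI)
    \<comment> \<open>As \<open>level J\<close> is a boundary, row \<open>s\<close> vanishes on all
      variables of the top form.\<close>
    have "?m \<le> block_start s" using level(1)[OF J] s(2) by (rule le_block_start)
    then have "iota n (row s) ?y = 0"
      unfolding iota_def by (intro sum.neutral) (auto simp: top_form_def contr_single row_zero)
    then have "iotas n row (sorted_list_of_set J' @ ?xs) ?y = 0"
      using s(1) J'set by (intro iotas_eq_0[of s]) auto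
    then show ?thesis by (simp add: coord)
  next
    case True
    show ?thesis
    proof (cases "J' \<subseteq> J")
      case False
      \<comment> \<open>Some row of \<open>J'\<close> is already among the complementary
        rows.\<close>
      then have "\<not> distinct (sorted_list_of_set J' @ ?xs)" using True J'set by auto
      then show ?thesis by (simp add: coord iotas_not_distinct)
    next
      case sub: True
      have fin: "finite J" using J by (rule finite_subset) simp
      \<comment> \<open>Fewer than \<open>level J\<close> contractions leave a positive exterior
        degree.\<close>
      then have "card J' < card J" using sub that by (intro psubset_card_mono) auto
      moreover have "card J \<le> ?m" using card_mono[of "{..<?m}" J] level(2)[OF J] by simp
      ultimately have len: "length (sorted_list_of_set J' @ ?xs) < ?m"
        using fin level(2)[OF J] by (simp add: card_Diff_subset)
      have "homogeneous ?m ?y" by (simp add: homogeneous_def top_form_def)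
      then have hom: "homogeneous (?m - length (sorted_list_of_set J' @ ?xs))
          (iotas n row (sorted_list_of_set J' @ ?xs) ?y)" by (rule homogeneous_iotas)
      have "scalar_part (iotas n row (sorted_list_of_set J' @ ?xs) ?y) = 0"
        by (rule homogeneous_scalar_part[OF hom]) (use len in simp)
      then show ?thesis by (simp only: coord mult_zero_right)
    qed
  qed
  have fin: "finite J" using J by (rule finite_subset) simp
  \<comment> \<open>For \<open>J\<close> itself each row below \<open>level J\<close> is contracted
    exactly once.\<close>
  have "mset (sorted_list_of_set J @ ?xs) = mset [0..<?m]"
    by (rule set_eq_iff_mset_eq_distinct[THEN iffD1]) (use Jset level(2)[OF J] in auto)
  from iotas_perm[OF this, of n row ?y]
  have "scalar_part (iotas n row (sorted_list_of_set J @ ?xs) ?y) = form_prod ?m \<or>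
      scalar_part (iotas n row (sorted_list_of_set J @ ?xs) ?y) = - form_prod ?m"
    using scalar_part_top[OF mn] by (auto simp: top_form_def[symmetric])
  moreover have "form_prod ?m ^ (defect - 1) * form_prod ?m = (form_prod ?m ^ defect :: 'a mpoly)"
    using defect_pos by (rule power_minus_mult)
  ultimately show "coord J (basis_elt J) = form_prod (level J) ^ defect \<or>
      coord J (basis_elt J) = - (form_prod (level J) ^ defect)"
    by (auto simp: coord)
qed

lemma coord_basis_elt_nonzero: "J \<subseteq> {..<n} \<Longrightarrow> coord J (basis_elt J) \<noteq> 0"
  using coord_basis_elt(2)[of J J] form_prod_nonzero[OF prime card_field] by auto

text \<open>\<open>coord J t\<close> and \<open>coord J (basis_elt J)\<close> are semi-invariant of
  the same weight, so their quotient is invariant.\<close>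

lemma coefficient:
  assumes t: "t \<in> invariants" and J: "J \<subseteq> {..<n}"
  obtains c where "c \<in> sym_algebra n" "\<forall>g\<in>G. sym_act n g c = c" "coord J t = c * coord J (basis_elt J)"
proof -
  have "coord J (basis_elt J) dvd coord J t"
    using form_prod_power_dvd_coord[OF t J] coord_basis_elt(2)[OF J J] by auto
  then obtain c where c: "coord J t = coord J (basis_elt J) * c" by (rule dvdE)
  have "coord J t \<in> sym_algebra n" "coord J (basis_elt J) \<in> sym_algebra n"
    using t J basis_elt_invariant invariantsD(1) by (auto intro: coord_closed)
  then have "c \<in> sym_algebra n"
    using sym_algebra_cancel coord_basis_elt_nonzero[OF J] unfolding c by blast
  moreover have "sym_act n g c = c" if g: "g \<in> G" for g
  proof -
    have "coord J (basis_elt J) * sym_act n g c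
        = const_poly (det g ^ k) * sym_act n g (coord J (basis_elt J)) * sym_act n g c"
      by (simp add: coord_semi_invariant[OF basis_elt_invariant[OF J] g J])
    also have "\<dots> = const_poly (det g ^ k) * sym_act n g (coord J t)"
      by (simp add: c sym_act_mult mult.assoc)
    also have "\<dots> = coord J (basis_elt J) * c"
      using coord_semi_invariant[OF t g J] by (simp add: c)
    finally show ?thesis using coord_basis_elt_nonzero[OF J] by simp
  qed
  ultimately show ?thesis using that c by (simp add: mult.commute)
qed

lemma coord_combination:
  assumes "J \<subseteq> {..<n}"
  shows "coord J (\<Sum>K\<in>Pow {..<n}. poly_scale (c K) (basis_elt K)) = c J * coord J (basis_elt J)"
proof -
  have "coord J (\<Sum>K\<in>Pow {..<n}. poly_scale (c K) (basis_elt K))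
      = (\<Sum>K\<in>Pow {..<n}. if K = J then c J * coord J (basis_elt J) else 0)"
    unfolding coord_sum coord_poly_scale
    by (rule sum.cong) (use assms coord_basis_elt(1) in auto)
  then show ?thesis using assms by simp
qed

text \<open>The coefficients are read off the coordinates; the difference of both sides then has all
  coordinates zero, and \<open>coords_eq_0\<close> applies.\<close>

lemma basis_expansion:
  assumes t: "t \<in> invariants"
  obtains c where "\<And>J. J \<subseteq> {..<n} \<Longrightarrow> c J \<in> sym_algebra n"
    "\<And>J g. J \<subseteq> {..<n} \<Longrightarrow> g \<in> G \<Longrightarrow> sym_act n g (c J) = c J"
    "t = (\<Sum>J\<in>Pow {..<n}. poly_scale (c J) (basis_elt J))"
proof -
  have "\<forall>J\<in>Pow {..<n}. \<exists>c. c \<in> sym_algebra n \<and> (\<forall>g\<in>G. sym_act n g c = c) \<and>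
      coord J t = c * coord J (basis_elt J)"
    using coefficient[OF t] by (metis PowD)
  then obtain c where c: "\<And>J. J \<subseteq> {..<n} \<Longrightarrow> c J \<in> sym_algebra n"
    "\<And>J. J \<subseteq> {..<n} \<Longrightarrow> \<forall>g\<in>G. sym_act n g (c J) = c J"
    "\<And>J. J \<subseteq> {..<n} \<Longrightarrow> coord J t = c J * coord J (basis_elt J)"
    unfolding Pow_iff Ball_def by metis
  let ?s = "\<Sum>J\<in>Pow {..<n}. poly_scale (c J) (basis_elt J)"
  have "?s \<in> sym_ext_space n"
    using c(1) basis_elt_invariant invariantsD(1) by (intro sym_ext_space_sum sym_ext_space_poly_scale) auto
  then have "t - ?s = 0"
    using invariantsD(1)[OF t] c(3)
    by (intro coords_eq_0 sym_ext_space_diff) (simp_all add: coord_diff coord_combination)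
  then have "t = ?s" by simp
  then show ?thesis by (rule that[rotated -1]) (use c(1,2) in blast)+
qed

end


subsection \<open>The module of invariants\<close>

lemma cring_sym_invariants: "cring (sym_invariants n G)"
proof (rule cringI)
  show "abelian_group (sym_invariants n G)"
    by (rule abelian_groupI)
       (auto simp: sym_invariants_def sym_act_add add_ac intro: sym_algebra_add
         intro!: bexI[of _ "- _"] sym_algebra_uminus simp: sym_act_uminus)
  show "comm_monoid (sym_invariants n G)"
    by (rule comm_monoidI) (auto simp: sym_invariants_def sym_act_mult mult_ac intro: sym_algebra_mult)
qed (simp add: sym_invariants_def distrib_right)

lemma abelian_group_sym_ext_invariants: "abelian_group (sym_ext_invariants n k G)"
  by (rule abelian_groupI)
     (auto simp: sym_ext_invariants_def sym_ext_act_add add_ac intro: sym_ext_space_add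
       intro!: bexI[of _ "- _"] sym_ext_space_uminus simp: sym_ext_act_uminus)

lemma module_sym_ext_invariants: "Module.module (sym_invariants n G) (sym_ext_invariants n k G)"
  by (rule Module.moduleI[OF cring_sym_invariants abelian_group_sym_ext_invariants])
     (auto simp: sym_invariants_def sym_ext_invariants_def sym_ext_act_poly_scale poly_scale_add
       poly_scale_add_left poly_scale_poly_scale intro: sym_ext_space_poly_scale)

lemma finsum_sym_ext_invariants:
  assumes "finite B" "\<And>b. b \<in> B \<Longrightarrow> f b \<in> carrier (sym_ext_invariants n k G)"
  shows "finsum (sym_ext_invariants n k G) f B = sum f B"
proof -
  interpret abelian_group "sym_ext_invariants n k G" by (rule abelian_group_sym_ext_invariants)
  show ?thesis
    using assms
  proof (induction B rule: finite_induct)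
    case empty
    show ?case unfolding finsum_empty by (simp add: sym_ext_invariants_def)
  next
    case (insert b B)
    have "finsum (sym_ext_invariants n k G) f (insert b B)
        = f b \<oplus>\<^bsub>sym_ext_invariants n k G\<^esub> finsum (sym_ext_invariants n k G) f B"
      using insert by (intro finsum_insert) auto
    also have "\<dots> = f b + sum f B" using insert by (simp add: sym_ext_invariants_def)
    finally show ?case using insert.hyps by simp
  qed
qed

context parabolic_invariants
begin

lemma carrier_invariants: "carrier (sym_ext_invariants n k G) = invariants"
  by (simp add: sym_ext_invariants_def invariants_def)

text \<open>The coordinate at \<open>J\<close> separates \<open>basis_elt J\<close> from the others,
  so the basis can be counted by its index sets.\<close>

lemma inj_basis_elt: "inj_on basis_elt (Pow {..<n})"
proof (rule inj_onI)
  fix J K assume "J \<in> Pow {..<n}" "K \<in> Pow {..<n}" "basis_elt J = basis_elt K"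
  then show "J = K"
    using coord_basis_elt(1)[of K J] coord_basis_elt_nonzero[of J] by auto
qed

lemma finsum_basis:
  assumes "c \<in> basis_elt ` Pow {..<n} \<rightarrow> carrier (sym_invariants n G)"
  shows "finsum (sym_ext_invariants n k G) (\<lambda>b. c b \<odot>\<^bsub>sym_ext_invariants n k G\<^esub> b) (basis_elt ` Pow {..<n})
    = (\<Sum>J\<in>Pow {..<n}. poly_scale (c (basis_elt J)) (basis_elt J))"
proof -
  let ?M = "sym_ext_invariants n k G"
  interpret Module.module "sym_invariants n G" ?M by (rule module_sym_ext_invariants)
  have "finsum ?M (\<lambda>b. c b \<odot>\<^bsub>?M\<^esub> b) (basis_elt ` Pow {..<n}) = (\<Sum>b\<in>basis_elt ` Pow {..<n}. c b \<odot>\<^bsub>?M\<^esub> b)"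
  proof (rule finsum_sym_ext_invariants)
    fix b assume b: "b \<in> basis_elt ` Pow {..<n}"
    then have "b \<in> carrier ?M" using basis_elt_invariant carrier_invariants by auto
    then show "c b \<odot>\<^bsub>?M\<^esub> b \<in> carrier ?M" using assms b by (intro smult_closed) auto
  qed simp
  also have "\<dots> = (\<Sum>J\<in>Pow {..<n}. poly_scale (c (basis_elt J)) (basis_elt J))"
    by (subst sum.reindex[OF inj_basis_elt]) (simp add: sym_ext_invariants_def)
  finally show ?thesis .
qed

theorem free_module: "free_module_of_rank (sym_invariants n G) (sym_ext_invariants n k G) (2 ^ n)"
  unfolding free_module_of_rank_def
proof (intro conjI exI ballI)
  let ?R = "sym_invariants n G" and ?M = "sym_ext_invariants n k G" and ?B = "basis_elt ` Pow {..<n}"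
  show "Module.module ?R ?M" by (rule module_sym_ext_invariants)
  show "?B \<subseteq> carrier ?M" using basis_elt_invariant by (auto simp: carrier_invariants)
  show "finite ?B" by simp
  show "card ?B = 2 ^ n" by (simp add: card_image[OF inj_basis_elt] card_Pow)
  fix t assume "t \<in> carrier ?M"
  then have t: "t \<in> invariants" by (simp add: carrier_invariants)
  obtain c where c: "\<And>J. J \<subseteq> {..<n} \<Longrightarrow> c J \<in> sym_algebra n"
    "\<And>J g. J \<subseteq> {..<n} \<Longrightarrow> g \<in> G \<Longrightarrow> sym_act n g (c J) = c J"
    "t = (\<Sum>J\<in>Pow {..<n}. poly_scale (c J) (basis_elt J))"
    using basis_expansion[OF t] by blast
  \<comment> \<open>The coefficients are re-indexed by basis elements; \<open>restrict\<close> is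
    there because uniqueness is claimed among extensional functions.\<close>
  define d where "d = restrict (\<lambda>b. c (the_inv_into (Pow {..<n}) basis_elt b)) ?B"
  have d_basis: "d (basis_elt J) = c J" if "J \<in> Pow {..<n}" for J
    using that by (simp add: d_def the_inv_into_f_f[OF inj_basis_elt])
  have d: "d \<in> ?B \<rightarrow>\<^sub>E carrier ?R"
  proof (rule PiE_I)
    fix b assume "b \<in> ?B"
    then obtain J where "J \<in> Pow {..<n}" "b = basis_elt J" by blast
    then show "d b \<in> carrier ?R" using c(1,2) d_basis by (simp add: sym_invariants_def)
  qed (simp add: d_def)
  show "\<exists>!c. c \<in> ?B \<rightarrow>\<^sub>E carrier ?R \<and> t = finsum ?M (\<lambda>b. c b \<odot>\<^bsub>?M\<^esub> b) ?B"
  proof (rule ex1I[of _ d])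
    have "t = (\<Sum>J\<in>Pow {..<n}. poly_scale (d (basis_elt J)) (basis_elt J))"
      unfolding c(3) by (rule sum.cong) (simp_all add: d_basis)
    moreover have "d \<in> ?B \<rightarrow> carrier ?R" using d by (simp add: PiE_def)
    ultimately show "d \<in> ?B \<rightarrow>\<^sub>E carrier ?R \<and> t = finsum ?M (\<lambda>b. d b \<odot>\<^bsub>?M\<^esub> b) ?B"
      using d by (simp only: finsum_basis simp_thms)
  next
    fix d' assume d': "d' \<in> ?B \<rightarrow>\<^sub>E carrier ?R \<and> t = finsum ?M (\<lambda>b. d' b \<odot>\<^bsub>?M\<^esub> b) ?B"
    then have "d' \<in> ?B \<rightarrow> carrier ?R" by (simp add: PiE_def)
    from finsum_basis[OF this] d'
    have t': "t = (\<Sum>J\<in>Pow {..<n}. poly_scale (d' (basis_elt J)) (basis_elt J))" by simp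
    show "d' = d"
    proof (rule PiE_ext[of _ ?B "\<lambda>_. carrier ?R"])
      fix b assume "b \<in> ?B"
      then obtain J where J: "J \<in> Pow {..<n}" "b = basis_elt J" by blast
      \<comment> \<open>For uniqueness, \<open>coord J\<close> isolates the coefficient of
        \<open>basis_elt J\<close>.\<close>
      have "d' (basis_elt J) * coord J (basis_elt J) = coord J t"
        unfolding t' using J by (simp add: coord_combination[of J "\<lambda>J. d' (basis_elt J)"])
      also have "\<dots> = c J * coord J (basis_elt J)"
        unfolding c(3) using J by (simp add: coord_combination)
      finally show "d' b = d b" using J d_basis coord_basis_elt_nonzero by auto
    qed (use d d' in auto)
  qed
qed

end

theorem theoremA:
  fixes p r q n k :: nat and I :: "nat list"
  assumes "prime p" and "r \<ge> 1" and "q = p ^ r"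
    and "card (UNIV :: 'a::{field,finite} set) = q"
    and "n \<ge> 1"
    and "composition I n"
    and "k + 2 \<le> q"
  shows "free_module_of_rank
           (sym_invariants n (parabolic n I :: 'a mat set))
           (sym_ext_invariants n k (parabolic n I :: 'a mat set))
           (2 ^ n)"
proof -
  interpret parabolic_invariants p r n k I "parabolic n I :: 'a mat set"
    by unfold_locales (use assms in simp_all)
  show ?thesis by (rule free_module)
qed

end
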